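(* Let $K\subset(-1/2,1/2)^2$ be an origin-symmetric convex body, and let $T_n(K)$ be the number of adjacent twin pairs in the random graph $G_K(n)$. Then, as $n\to\infty$, $$T_n(K)\xrightarrow{d}\operatorname{Poisson}\left(\frac{\operatorname{area}(K^\circ)}{16}\right),$$ where $K^\circ=\{u\in\mathbb R^2:\langle u,x\rangle\le 1\text{ for every }x\in K\}$ is the polar body of $K$. Consequently, $G_K(n)$ does not satisfy a first-order zero-one law. In particular, for every $0<r<1/2$, $$T_n([-r,r]^2)\xrightarrow{d}\operatorname{Poisson}\left(\frac1{8r^2}\right)\qquad\text{and}\qquad T_n(rB_2)\xrightarrow{d}\operatorname{Poisson}\left(\frac{\pi}{16r^2}\right),$$ where $B_2$ is the closed unit Euclidean disk in $\mathbb R^2$.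
   Context: Let $\mathbb T^2=(\mathbb R/\mathbb Z)^2$ and let $X_1,\dots,X_n$ be independent uniform random points of $\mathbb T^2$. A convex body is a compact convex set with nonempty interior. For an origin-symmetric convex body $K\subset(-1/2,1/2)^2$ (that is, $K=-K$), $G_K(n)$ is the simple graph on vertex set $[n]=\{1,\dots,n\}$ in which distinct $i,j$ are adjacent exactly when the representative of $X_j-X_i$ in $[-1/2,1/2)^2$ belongs to $K$. Two adjacent vertices $x,y$ of a graph are adjacent twins if they have the same neighbors outside the pair $\{x,y\}$; the number of adjacent twin pairs is the number of unordered pairs $\{x,y\}$ of adjacent twins. Graphs are finite, simple, undirected, and regarded as structures in the first-order language with equality and one binary relation symbol $E$. A sequence of random graphs satisfies a first-order zero-one law if, for every first-order graph sentence, the probability that the sentence holds tends to either $0$ or $1$ as $n\to\infty$. $\operatorname{Poisson}(\lambda)$ is the Poisson distribution with mean $\lambda$. *)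

theory Defs
  imports "HOL-Probability.Probability"
begin

section \<open>The torus\<close>

definition circle_rel :: "real \<Rightarrow> real \<Rightarrow> bool" where
  "circle_rel x y \<longleftrightarrow> x - y \<in> \<int>"

lemma equivp_circle_rel: "equivp circle_rel"
proof (rule equivpI)
  show "reflp circle_rel" by (auto simp: reflp_def circle_rel_def)
  show "symp circle_rel"
    by (metis (no_types, lifting) sympI circle_rel_def minus_diff_eq Ints_minus)
  show "transp circle_rel"
  proof (rule transpI)
    fix x y z assume "circle_rel x y" "circle_rel y z"
    then have "(x - y) + (y - z) \<in> \<int>" unfolding circle_rel_def by (rule Ints_add)
    then show "circle_rel x z" by (simp add: circle_rel_def)
  qed
qed

quotient_type circle = real / circle_rel
  morphisms circle_lift circle_of
  by (rule equivp_circle_rel)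

instantiation circle :: ab_group_add
begin

lift_definition zero_circle :: circle is 0 .

lift_definition plus_circle :: "circle \<Rightarrow> circle \<Rightarrow> circle" is "(+)"
proof -
  fix a b c d :: real
  assume "circle_rel a b" "circle_rel c d"
  then have "(a - b) + (c - d) \<in> \<int>" unfolding circle_rel_def by (rule Ints_add)
  then show "circle_rel (a + c) (b + d)" by (simp add: circle_rel_def algebra_simps)
qed

lift_definition uminus_circle :: "circle \<Rightarrow> circle" is uminus
proof -
  fix a b :: real
  assume "circle_rel a b"
  then have "- (a - b) \<in> \<int>" unfolding circle_rel_def by (rule Ints_minus)
  then show "circle_rel (- a) (- b)" by (simp add: circle_rel_def)
qed

lift_definition minus_circle :: "circle \<Rightarrow> circle \<Rightarrow> circle" is "(-)"
proof -
  fix a b c d :: real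
  assume "circle_rel a b" "circle_rel c d"
  then have "(a - b) - (c - d) \<in> \<int>" unfolding circle_rel_def by (rule Ints_diff)
  then show "circle_rel (a - c) (b - d)" by (simp add: circle_rel_def algebra_simps)
qed

instance
  by (standard; transfer) (auto simp: circle_rel_def)

end

type_synonym torus = "circle ^ 2"

definition torus_of :: "real ^ 2 \<Rightarrow> torus" where
  "torus_of x = (\<chi> i. circle_of (x $ i))"

lemma circle_of_eq_iff: "circle_of x = circle_of y \<longleftrightarrow> x - y \<in> \<int>"
  by (simp add: circle.abs_eq_iff circle_rel_def)

lemma torus_of_eq_iff: "torus_of x = torus_of y \<longleftrightarrow> (\<forall>i. x $ i - y $ i \<in> \<int>)"
  by (simp add: torus_of_def vec_eq_iff circle_of_eq_iff)

lemma torus_of_diff: "torus_of (x - y) = torus_of x - torus_of y"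
  by (simp add: torus_of_def vec_eq_iff minus_circle.abs_eq)

lemma surj_torus_of: "surj torus_of"
proof (rule surjI)
  fix t :: torus
  show "torus_of (\<chi> i. circle_lift (t $ i)) = t"
    using Quotient_abs_rep[OF Quotient_circle] by (simp add: torus_of_def vec_eq_iff)
qed

definition torus_rep :: "torus \<Rightarrow> real ^ 2" where
  "torus_rep t = (THE v. (\<forall>i. - 1/2 \<le> v $ i \<and> v $ i < 1/2) \<and> torus_of v = t)"

lemma torus_rep_torus_of: "torus_rep (torus_of x) = (\<chi> i. x $ i - of_int \<lfloor>x $ i + 1/2\<rfloor>)"
  unfolding torus_rep_def
proof (rule the_equality)
  show "(\<forall>i. - 1/2 \<le> (\<chi> i. x $ i - of_int \<lfloor>x $ i + 1/2\<rfloor>) $ i \<and>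
      (\<chi> i. x $ i - of_int \<lfloor>x $ i + 1/2\<rfloor>) $ i < 1/2) \<and>
      torus_of (\<chi> i. x $ i - of_int \<lfloor>x $ i + 1/2\<rfloor>) = torus_of x"
    unfolding torus_of_eq_iff by (simp, linarith)
next
  fix v :: "real ^ 2"
  assume v: "(\<forall>i. - 1/2 \<le> v $ i \<and> v $ i < 1/2) \<and> torus_of v = torus_of x"
  show "v = (\<chi> i. x $ i - of_int \<lfloor>x $ i + 1/2\<rfloor>)"
  proof (simp add: vec_eq_iff, intro allI)
    fix i
    obtain k :: int where k: "v $ i - x $ i = of_int k"
      using v unfolding torus_of_eq_iff by (metis Ints_cases)
    have "\<lfloor>x $ i + 1/2\<rfloor> = - k"
      using v k by (simp add: floor_eq_iff) (smt (verit) field_sum_of_halves)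
    then show "v $ i = x $ i - of_int \<lfloor>x $ i + 1/2\<rfloor>" using k by simp
  qed
qed

text \<open>The quotient \<open>\<sigma>\<close>-algebra; it is the Borel \<open>\<sigma>\<close>-algebra of the quotient topology.\<close>

definition torus_borel :: "torus measure" where
  "torus_borel = sigma UNIV {A. torus_of -` A \<in> sets borel}"

lemma sets_torus_borel: "sets torus_borel = {A. torus_of -` A \<in> sets borel}"
proof -
  have "sigma_algebra UNIV {A. torus_of -` A \<in> sets borel}"
    unfolding sigma_algebra_iff2
    by (auto simp: vimage_Diff vimage_UN Compl_eq_Diff_UNIV[symmetric] vimage_Compl)
  then show ?thesis
    by (simp add: torus_borel_def sigma_algebra.sigma_sets_eq)
qed

lemma space_torus_borel: "space torus_borel = UNIV"
  by (simp add: torus_borel_def)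

lemma measurable_torus_of: "torus_of \<in> measurable borel torus_borel"
  by (auto simp: measurable_def sets_torus_borel space_torus_borel)

definition torus_uniform :: "torus measure" where
  "torus_uniform =
     distr (uniform_measure lborel {x. \<forall>i. 0 \<le> x $ i \<and> x $ i < 1}) torus_borel torus_of"

definition iid_uniform :: "'w measure \<Rightarrow> nat \<Rightarrow> (nat \<Rightarrow> 'w \<Rightarrow> torus) \<Rightarrow> bool" where
  "iid_uniform M n X \<longleftrightarrow>
     prob_space M \<and>
     prob_space.indep_vars M (\<lambda>_. torus_borel) X {1..n} \<and>
     (\<forall>i\<in>{1..n}. distr M torus_borel (X i) = torus_uniform)"


section \<open>Convex bodies\<close>

definition convex_body :: "'a :: euclidean_space set \<Rightarrow> bool" where
  "convex_body K \<longleftrightarrow> compact K \<and> convex K \<and> interior K \<noteq> {}"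

definition origin_symmetric :: "'a :: euclidean_space set \<Rightarrow> bool" where
  "origin_symmetric K \<longleftrightarrow> K = uminus ` K"

definition polar_body :: "'a :: euclidean_space set \<Rightarrow> 'a set" where
  "polar_body K = {u. \<forall>x\<in>K. u \<bullet> x \<le> 1}"


section \<open>Graphs\<close>

record 'a graph =
  verts :: "'a set"
  adj :: "'a \<Rightarrow> 'a \<Rightarrow> bool"

definition simple_graph :: "'a graph \<Rightarrow> bool" where
  "simple_graph G \<longleftrightarrow>
     finite (verts G) \<and>
     (\<forall>x y. adj G x y \<longrightarrow> x \<in> verts G \<and> y \<in> verts G \<and> x \<noteq> y \<and> adj G y x)"

definition adjacent_twins :: "'a graph \<Rightarrow> 'a \<Rightarrow> 'a \<Rightarrow> bool" where
  "adjacent_twins G x y \<longleftrightarrow>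
     x \<in> verts G \<and> y \<in> verts G \<and> adj G x y \<and>
     (\<forall>z \<in> verts G - {x, y}. adj G x z \<longleftrightarrow> adj G y z)"

definition num_adjacent_twins :: "'a graph \<Rightarrow> nat" where
  "num_adjacent_twins G = card {{x, y} | x y. adjacent_twins G x y}"

definition geom_graph :: "(real ^ 2) set \<Rightarrow> nat \<Rightarrow> (nat \<Rightarrow> torus) \<Rightarrow> nat graph" where
  "geom_graph K n x =
     \<lparr>verts = {1..n},
      adj = (\<lambda>i j. i \<in> {1..n} \<and> j \<in> {1..n} \<and> i \<noteq> j \<and> torus_rep (x j - x i) \<in> K)\<rparr>"

definition random_geom_graph ::
  "(nat \<Rightarrow> nat \<Rightarrow> 'w \<Rightarrow> torus) \<Rightarrow> (real ^ 2) set \<Rightarrow> nat \<Rightarrow> 'w \<Rightarrow> nat graph" where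
  "random_geom_graph X K n \<omega> = geom_graph K n (\<lambda>i. X n i \<omega>)"

definition twin_count ::
  "(nat \<Rightarrow> nat \<Rightarrow> 'w \<Rightarrow> torus) \<Rightarrow> (real ^ 2) set \<Rightarrow> nat \<Rightarrow> 'w \<Rightarrow> nat" where
  "twin_count X K n \<omega> = num_adjacent_twins (random_geom_graph X K n \<omega>)"

text \<open>Symmetry of the adjacency relation uses that \<open>K\<close> avoids the boundary of the square,
  where \<open>torus_rep\<close> does not commute with negation.\<close>

lemma simple_graph_geom_graph:
  assumes "origin_symmetric K" "K \<subseteq> {v. \<forall>i. - 1/2 < v $ i \<and> v $ i < 1/2}"
  shows "simple_graph (geom_graph K n x)"
proof -
  have neg: "torus_rep (- t) \<in> K" if "torus_rep t \<in> K" for t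
  proof -
    obtain v where t: "t = torus_of v" using surj_torus_of by blast
    define w where "w = torus_rep t"
    have w: "w \<in> K" "torus_of w = t"
      using that by (simp_all add: w_def t torus_rep_torus_of torus_of_eq_iff)
    have nt: "- t = torus_of (- w)"
      using torus_of_diff[of 0 w] torus_of_diff[of 0 0] w(2) by simp
    have "\<lfloor>- w $ i + 1/2\<rfloor> = 0" for i
    proof -
      have "- 1/2 < w $ i \<and> w $ i < 1/2" using w(1) assms(2) by blast
      then show ?thesis by (simp add: floor_eq_iff)
    qed
    then have "torus_rep (- t) = - w"
      unfolding nt torus_rep_torus_of by (simp add: vec_eq_iff)
    then show ?thesis using w(1) assms(1) unfolding origin_symmetric_def by force
  qed
  show ?thesis
    unfolding simple_graph_def geom_graph_def
    using neg by (auto, metis minus_diff_eq)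
qed


section \<open>First-order sentences and zero-one laws\<close>

datatype fo_formula =
    Eq nat nat
  | Edge nat nat
  | Neg fo_formula
  | Conj fo_formula fo_formula
  | Ex nat fo_formula

fun fo_free :: "fo_formula \<Rightarrow> nat set" where
  "fo_free (Eq a b) = {a, b}"
| "fo_free (Edge a b) = {a, b}"
| "fo_free (Neg \<phi>) = fo_free \<phi>"
| "fo_free (Conj \<phi> \<psi>) = fo_free \<phi> \<union> fo_free \<psi>"
| "fo_free (Ex a \<phi>) = fo_free \<phi> - {a}"

fun fo_sat :: "'a graph \<Rightarrow> (nat \<Rightarrow> 'a) \<Rightarrow> fo_formula \<Rightarrow> bool" where
  "fo_sat G e (Eq a b) \<longleftrightarrow> e a = e b"
| "fo_sat G e (Edge a b) \<longleftrightarrow> adj G (e a) (e b)"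
| "fo_sat G e (Neg \<phi>) \<longleftrightarrow> \<not> fo_sat G e \<phi>"
| "fo_sat G e (Conj \<phi> \<psi>) \<longleftrightarrow> fo_sat G e \<phi> \<and> fo_sat G e \<psi>"
| "fo_sat G e (Ex a \<phi>) \<longleftrightarrow> (\<exists>v\<in>verts G. fo_sat G (e(a := v)) \<phi>)"

definition fo_sentence :: "fo_formula \<Rightarrow> bool" where
  "fo_sentence \<phi> \<longleftrightarrow> fo_free \<phi> = {}"

lemma fo_sat_cong:
  "(\<And>a. a \<in> fo_free \<phi> \<Longrightarrow> e a = e' a) \<Longrightarrow> fo_sat G e \<phi> \<longleftrightarrow> fo_sat G e' \<phi>"
proof (induction \<phi> arbitrary: e e')
  case (Ex a \<phi>)
  have "fo_sat G (e(a := v)) \<phi> \<longleftrightarrow> fo_sat G (e'(a := v)) \<phi>" for v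
    by (rule Ex.IH) (use Ex.prems in auto)
  then show ?case by simp
next
  case (Conj \<phi> \<psi>)
  then show ?case by (metis UnCI fo_free.simps(4) fo_sat.simps(4))
next
  case (Neg \<phi>)
  then show ?case by (metis fo_free.simps(3) fo_sat.simps(3))
qed auto

text \<open>For a sentence the valuation is irrelevant by \<open>fo_sat_cong\<close>. It is not restricted to
  \<open>verts G\<close>, so that the empty graph is not a model of every sentence.\<close>

definition fo_models :: "'a graph \<Rightarrow> fo_formula \<Rightarrow> bool" where
  "fo_models G \<phi> \<longleftrightarrow> (\<forall>e. fo_sat G e \<phi>)"

definition fo_zero_one_law :: "(nat \<Rightarrow> 'w measure) \<Rightarrow> (nat \<Rightarrow> 'w \<Rightarrow> 'a graph) \<Rightarrow> bool" where
  "fo_zero_one_law M G \<longleftrightarrow>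
     (\<forall>\<phi>. fo_sentence \<phi> \<longrightarrow>
        (\<lambda>n. measure (M n) {\<omega> \<in> space (M n). fo_models (G n \<omega>) \<phi>}) \<longlonglongrightarrow> 0 \<or>
        (\<lambda>n. measure (M n) {\<omega> \<in> space (M n). fo_models (G n \<omega>) \<phi>}) \<longlonglongrightarrow> 1)"


section \<open>Convergence in distribution to a Poisson variable\<close>

definition converges_to_poisson ::
  "(nat \<Rightarrow> 'w measure) \<Rightarrow> (nat \<Rightarrow> 'w \<Rightarrow> nat) \<Rightarrow> real \<Rightarrow> bool" where
  "converges_to_poisson M T rate \<longleftrightarrow>
     weak_conv_m (\<lambda>n. distr (M n) borel (\<lambda>\<omega>. real (T n \<omega>)))
       (distr (measure_pmf (poisson_pmf rate)) borel real)"

end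

theory Submission
  imports Defs "HOL-Real_Asymp.Real_Asymp"
begin

text \<open>
  Write \<open>\<sigma>(h)\<close> for the area of the symmetric difference of \<open>K\<close> and \<open>K + h\<close> on the torus. Two points
  at difference \<open>h \<in> K\<close> are twins iff no other point falls into a translate of that symmetric
  difference, and \<open>\<sigma>(h) \<sim> 4 w(h)\<close> as \<open>h \<rightarrow> 0\<close>, where \<open>w\<close> is a rotated support function of \<open>K\<close>;
  hence the expected number of twin pairs tends to
  \<open>\<integral> exp (- 4 w(u)) du / 2 = area(K\<degree>) / 16 = \<lambda>\<close>.

  The Poisson law is obtained from the recursion \<open>(k + 1) P(T = k + 1) - \<lambda> P(T = k) \<rightarrow> 0\<close>, whose first
  term is a sum over pairs of \<open>P(a, b are twins and T = k + 1)\<close>. Adding a twin pair \<open>a, b\<close> to a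
  configuration typically changes nothing but increases \<open>T\<close> by one. Moreover, given the other
  points, the probability that \<open>a, b\<close> are twins is a random variable whose variance is negligible,
  because the pair is placed uniformly and two shells placed independently meet in mean area
  \<open>\<sigma>(h) \<sigma>(h')\<close>. So being twins decouples from the value of \<open>T\<close>.
\<close>

section \<open>Convergence to a Poisson law from a recursion\<close>

text \<open>Some n^2 / 2 pairs are summed, so each may carry only an error o(n^-2), although being
  twins has itself a probability of order n^-2. A disturbance is only bounded by O(1/n), and
  multiplying this with the twin probability would presuppose independence. Instead Cauchy-Schwarz
  is applied with all points but the second twin fixed, which costs a square root and leaves
  O(n^(-5/2)). Likewise the conditional twin probability has standard deviation O(n^(-5/2)), the
  root of n times the square of an integral of order n^-3. All these orders follow from one
  estimate: the integral of exp (- \<alpha> \<sigma>) over \<open>K\<close> is O(\<alpha>^-2). It is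
  the only geometric input besides the limit of the mean, so the probabilistic half is carried out
  for any abelian group with an invariant probability. The recursion fixes the law only up to a
  factor; a bound on the mean of T keeps mass from escaping and determines that factor. The
  denominator 16 is 4^2: the integral of exp (- 4 w) is 2 / 4^2 times the area, and unordered pairs
  halve it.\<close>

lemma pmf_convergence_of_recursion:
  fixes p :: "nat \<Rightarrow> nat \<Rightarrow> real"
  assumes rate: "0 \<le> rate"
    and rec: "\<And>k. (\<lambda>n. real (Suc k) * p n (Suc k) - rate * p n k) \<longlonglongrightarrow> 0"
    and nonneg: "\<And>n k. 0 \<le> p n k"
    and le1: "\<And>n m. (\<Sum>k<m. p n k) \<le> 1"
    and tight: "eventually (\<lambda>n. \<forall>m>0. 1 - B / real m \<le> (\<Sum>k<m. p n k)) sequentially"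
  shows "(\<lambda>n. p n k) \<longlonglongrightarrow> rate ^ k / fact k * exp (- rate)"
proof -
  \<comment> \<open>By induction along the recursion every \<open>p n k\<close> is asymptotic to its
    Poisson weight relative to \<open>p n 0\<close>; only \<open>p n 0\<close> remains
    unknown.\<close>
  have diff: "(\<lambda>n. p n k - rate ^ k / fact k * p n 0) \<longlonglongrightarrow> 0" for k
  proof (induction k)
    case (Suc k)
    have "(\<lambda>n. (real (Suc k) * p n (Suc k) - rate * p n k
        + rate * (p n k - rate ^ k / fact k * p n 0)) / real (Suc k)) \<longlonglongrightarrow> (0 + rate * 0) / real (Suc k)"
      by (intro tendsto_intros rec Suc) auto
    moreover have "(real (Suc k) * p n (Suc k) - rate * p n k
        + rate * (p n k - rate ^ k / fact k * p n 0)) / real (Suc k)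
        = p n (Suc k) - rate ^ Suc k / fact (Suc k) * p n 0" for n
      by (simp add: field_simps del: of_nat_Suc)
    ultimately show ?case by (simp only: mult_zero_right add_0 div_0)
  qed simp
  define S where "S m = (\<Sum>k<m. rate ^ k / fact k)" for m :: nat
  have sumdiff: "(\<lambda>n. (\<Sum>k<m. p n k) - S m * p n 0) \<longlonglongrightarrow> 0" for m
  proof -
    have "(\<lambda>n. \<Sum>k<m. p n k - rate ^ k / fact k * p n 0) \<longlonglongrightarrow> (\<Sum>k<m. 0)"
      by (intro tendsto_sum diff)
    then show ?thesis by (simp add: S_def sum_subtractf sum_distrib_right)
  qed
  have S_lim: "S \<longlonglongrightarrow> exp rate"
    using exp_converges[of rate] unfolding sums_def S_def by (simp add: divide_inverse_commute)
  have S_le: "S m \<le> exp rate" for m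
  proof -
    have "summable (\<lambda>k. rate ^ k / fact k)"
      using exp_converges[of rate] by (simp add: divide_inverse_commute sums_iff)
    then have "S m \<le> (\<Sum>k. rate ^ k / fact k)"
      unfolding S_def using rate by (intro sum_le_suminf) auto
    then show ?thesis
      by (simp add: exp_def divide_inverse_commute)
  qed
  have p0_le1: "p n 0 \<le> 1" for n using le1[of n 1] by simp
  \<comment> \<open>Normalisation determines the factor: by \<open>tight\<close> all but
    \<open>B / m\<close> of the mass lies below \<open>m\<close>, uniformly in large
    \<open>n\<close>, so \<open>S m * p n 0\<close> is close to 1 for a fixed large
    \<open>m\<close>.\<close>
  have p0: "(\<lambda>n. p n 0) \<longlonglongrightarrow> exp (- rate)"
  proof (rule LIMSEQ_I)
    fix e :: real assume "0 < e"
    have "(\<lambda>m. \<bar>B\<bar> / real m + (exp rate - S m)) \<longlonglongrightarrow> 0 + (exp rate - exp rate)"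
      by (intro tendsto_intros S_lim lim_const_over_n)
    then have "eventually (\<lambda>m. \<bar>B\<bar> / real m + (exp rate - S m) < e / 2) sequentially"
      by (rule order_tendstoD) (use \<open>0 < e\<close> in auto)
    then have "eventually (\<lambda>m. \<bar>B\<bar> / real m + (exp rate - S m) < e / 2 \<and> 0 < m) sequentially"
      by (intro eventually_conj eventually_gt_at_top)
    then obtain m where m: "\<bar>B\<bar> / real m + (exp rate - S m) < e / 2" "0 < m"
      by (auto simp: eventually_sequentially)
    have "eventually (\<lambda>n. \<bar>(\<Sum>k<m. p n k) - S m * p n 0\<bar> < e / 2) sequentially"
      using tendstoD[OF sumdiff[of m], of "e / 2"] \<open>0 < e\<close> by (simp add: dist_real_def)
    with tight have "eventually (\<lambda>n. norm (p n 0 - exp (- rate)) < e) sequentially"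
    proof eventually_elim
      case (elim n)
      have 1: "1 - B / real m \<le> (\<Sum>k<m. p n k)" using elim(1) m(2) by blast
      have 2: "(\<Sum>k<m. p n k) \<le> 1" by (rule le1)
      have 3: "0 \<le> (exp rate - S m) * p n 0" "(exp rate - S m) * p n 0 \<le> exp rate - S m"
        using S_le[of m] nonneg[of n 0] p0_le1[of n]
        by (auto simp: mult_left_le)
      have 4: "B / real m \<le> \<bar>B\<bar> / real m" using m(2) by (simp add: divide_right_mono)
      have "\<bar>exp rate * p n 0 - 1\<bar> < e"
        using 1 2 3 4 m(1) elim(2) \<open>0 < e\<close> unfolding left_diff_distrib abs_less_iff by linarith
      moreover have "\<bar>p n 0 - exp (- rate)\<bar> = exp (- rate) * \<bar>exp rate * p n 0 - 1\<bar>"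
      proof -
        have "p n 0 - exp (- rate) = exp (- rate) * (exp rate * p n 0 - 1)"
          by (simp add: algebra_simps exp_minus)
        then show ?thesis by (simp add: abs_mult)
      qed
      moreover have "exp (- rate) * \<bar>exp rate * p n 0 - 1\<bar> \<le> \<bar>exp rate * p n 0 - 1\<bar>"
        using rate by (simp add: mult_left_le_one_le)
      ultimately show ?case by simp
    qed
    then show "\<exists>N. \<forall>n\<ge>N. norm (p n 0 - exp (- rate)) < e"
      by (simp add: eventually_sequentially)
  qed
  have "(\<lambda>n. (p n k - rate ^ k / fact k * p n 0) + rate ^ k / fact k * p n 0)
      \<longlonglongrightarrow> 0 + rate ^ k / fact k * exp (- rate)"
    by (intro tendsto_intros diff p0)
  then show ?thesis by simp
qed

text \<open>A distribution function at \<open>x\<close> is a finite sum of point masses here, so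
  convergence of the point masses suffices. Measurability is asked only eventually because the
  application provides it for \<open>n > 0\<close>.\<close>

lemma converges_to_poissonI:
  assumes M: "\<And>n. prob_space (M n)"
    and T: "eventually (\<lambda>n. T n \<in> measurable (M n) (count_space UNIV)) sequentially"
    and rate: "0 < rate"
    and lim: "\<And>k. (\<lambda>n. measure (M n) {\<omega> \<in> space (M n). T n \<omega> = k}) \<longlonglongrightarrow> rate ^ k / fact k * exp (- rate)"
  shows "converges_to_poisson M T rate"
  unfolding converges_to_poisson_def weak_conv_m_def weak_conv_def
proof (intro allI impI)
  fix x :: real
  have fin: "finite {k::nat. real k \<le> x}"
    by (rule finite_subset[of _ "{..nat \<lfloor>x\<rfloor>}"]) (auto simp: le_nat_floor)
  have "(\<lambda>n. \<Sum>k\<in>{k::nat. real k \<le> x}. measure (M n) {\<omega> \<in> space (M n). T n \<omega> = k})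
      \<longlonglongrightarrow> (\<Sum>k\<in>{k::nat. real k \<le> x}. rate ^ k / fact k * exp (- rate))"
    by (intro tendsto_sum lim)
  moreover have "(\<Sum>k\<in>{k::nat. real k \<le> x}. rate ^ k / fact k * exp (- rate))
      = cdf (distr (measure_pmf (poisson_pmf rate)) borel real) x"
  proof -
    have "cdf (distr (measure_pmf (poisson_pmf rate)) borel real) x
        = measure (measure_pmf (poisson_pmf rate)) {k. real k \<le> x}"
      unfolding cdf_def by (subst measure_distr) (auto simp: vimage_def)
    then show ?thesis
      using rate fin by (simp add: measure_measure_pmf_finite)
  qed
  moreover have "eventually (\<lambda>n. (\<Sum>k\<in>{k::nat. real k \<le> x}. measure (M n) {\<omega> \<in> space (M n). T n \<omega> = k})
      = cdf (distr (M n) borel (\<lambda>\<omega>. real (T n \<omega>))) x) sequentially"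
    using T
  proof eventually_elim
    case (elim n)
    note [measurable] = elim
    interpret prob_space "M n" by (rule M)
    have "cdf (distr (M n) borel (\<lambda>\<omega>. real (T n \<omega>))) x = measure (M n) {\<omega> \<in> space (M n). real (T n \<omega>) \<le> x}"
      unfolding cdf_def by (subst measure_distr) (auto simp: vimage_def Int_def conj_commute)
    also have "{\<omega> \<in> space (M n). real (T n \<omega>) \<le> x}
        = (\<Union>k\<in>{k::nat. real k \<le> x}. {\<omega> \<in> space (M n). T n \<omega> = k})" by auto
    also have "measure (M n) \<dots> = (\<Sum>k\<in>{k::nat. real k \<le> x}. measure (M n) {\<omega> \<in> space (M n). T n \<omega> = k})"
      by (rule finite_measure_finite_Union) (auto simp: disjoint_family_on_def fin)
    finally show ?case by simp
  qed
  ultimately show "(\<lambda>n. cdf (distr (M n) borel (\<lambda>\<omega>. real (T n \<omega>))) x)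
      \<longlonglongrightarrow> cdf (distr (measure_pmf (poisson_pmf rate)) borel real) x"
    using Lim_transform_eventually by simp
qed

section \<open>Uniform measure on the torus\<close>

lemma measurable_torus_rep [measurable]: "torus_rep \<in> measurable torus_borel borel"
proof -
  have [measurable]: "(\<lambda>x::real^2. \<chi> i. x $ i - of_int \<lfloor>x $ i + 1/2\<rfloor>) \<in> borel_measurable borel"
  proof (subst borel_measurable_euclidean_space, intro ballI)
    fix b :: "real^2" assume "b \<in> Basis"
    then obtain i where b: "b = axis i 1" by (auto simp: Basis_vec_def)
    have "(\<lambda>x::real^2. (x \<bullet> axis i 1) - of_int \<lfloor>(x \<bullet> axis i 1) + 1/2\<rfloor>) \<in> borel_measurable borel"
      by measurable
    then show "(\<lambda>x::real^2. (\<chi> i. x $ i - of_int \<lfloor>x $ i + 1/2\<rfloor>) \<bullet> b) \<in> borel_measurable borel"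
      by (simp add: b inner_axis)
  qed
  have "torus_rep -` A \<in> sets torus_borel" if [measurable]: "A \<in> sets borel" for A
  proof -
    have "torus_of -` torus_rep -` A = (\<lambda>x::real^2. \<chi> i. x $ i - of_int \<lfloor>x $ i + 1/2\<rfloor>) -` A \<inter> space borel"
      by (auto simp: torus_rep_torus_of)
    also have "\<dots> \<in> sets borel" by measurable
    finally show ?thesis by (simp add: sets_torus_borel)
  qed
  then show ?thesis by (auto simp: measurable_def space_torus_borel)
qed

lemma torus_of_torus_rep [simp]: "torus_of (torus_rep t) = t"
proof -
  obtain x where "t = torus_of x" using surj_torus_of by blast
  then show ?thesis by (simp add: torus_rep_torus_of torus_of_eq_iff)
qed

lemma torus_of_add: "torus_of (x + y) = torus_of x + torus_of y"
  by (simp add: torus_of_def vec_eq_iff plus_circle.abs_eq)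

lemma torus_of_uminus: "torus_of (- x) = - torus_of x"
  by (simp add: torus_of_def vec_eq_iff uminus_circle.abs_eq)

lemma measurable_torus_add [measurable]:
  "(\<lambda>p. fst p + snd p) \<in> measurable (torus_borel \<Otimes>\<^sub>M torus_borel) torus_borel"
proof -
  have "(\<lambda>p. torus_of (torus_rep (fst p) + torus_rep (snd p)))
      \<in> measurable (torus_borel \<Otimes>\<^sub>M torus_borel) torus_borel"
    by (rule measurable_compose[OF _ measurable_torus_of]) measurable
  then show ?thesis by (simp add: torus_of_add)
qed

lemma measurable_torus_uminus [measurable]: "uminus \<in> measurable torus_borel torus_borel"
proof -
  have "(\<lambda>t. torus_of (- torus_rep t)) \<in> measurable torus_borel torus_borel"
    by (rule measurable_compose[OF _ measurable_torus_of]) measurable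
  then show ?thesis by (simp add: torus_of_uminus)
qed

section \<open>Unit cells as fundamental domains and translation invariance\<close>

definition cell :: "real^2 \<Rightarrow> (real^2) set" where
  "cell c = {x. \<forall>i. c $ i \<le> x $ i \<and> x $ i < c $ i + 1}"

lemma cell_eq: "cell c = {x. c $ 1 \<le> x $ 1 \<and> x $ 1 < c $ 1 + 1 \<and> c $ 2 \<le> x $ 2 \<and> x $ 2 < c $ 2 + 1}"
  by (auto simp: cell_def forall_2)

lemma borel_measurable_vec_nth2 [measurable]: "(\<lambda>x::real^2. x $ i) \<in> borel_measurable borel"
  by (intro borel_measurable_continuous_onI continuous_intros)

lemma cell_borel [measurable]: "cell c \<in> sets borel"
  unfolding cell_eq by measurable

definition lattice_pt :: "int \<times> int \<Rightarrow> real^2" where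
  "lattice_pt z = vector [of_int (fst z), of_int (snd z)]"

lemma lattice_pt_nth [simp]: "lattice_pt z $ 1 = of_int (fst z)" "lattice_pt z $ 2 = of_int (snd z)"
  by (simp_all add: lattice_pt_def)

lemma torus_of_lattice_add: "torus_of (x + lattice_pt z) = torus_of x"
  by (simp add: torus_of_eq_iff forall_2)

lemma floor_unique_shift:
  fixes c x :: real and a :: int
  assumes "c \<le> x + of_int a" "x + of_int a < c + 1"
  shows "a = \<lceil>c - x\<rceil>"
  using assms by linarith

text \<open>In each coordinate exactly one integer shift lands in a half-open unit interval. This
  makes the pieces in \<open>emeasure_cell_indep\<close> disjoint and exhaustive.\<close>

lemma cell_shift_iff:
  "x + lattice_pt z \<in> cell c \<longleftrightarrow> z = (\<lceil>c $ 1 - x $ 1\<rceil>, \<lceil>c $ 2 - x $ 2\<rceil>)"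
proof
  assume "x + lattice_pt z \<in> cell c"
  then show "z = (\<lceil>c $ 1 - x $ 1\<rceil>, \<lceil>c $ 2 - x $ 2\<rceil>)"
    by (intro prod_eqI) (auto simp: cell_eq intro!: floor_unique_shift)
next
  assume "z = (\<lceil>c $ 1 - x $ 1\<rceil>, \<lceil>c $ 2 - x $ 2\<rceil>)"
  then show "x + lattice_pt z \<in> cell c"
    by (simp add: cell_eq) linarith
qed

lemma emeasure_lborel_shift:
  fixes B :: "'a::euclidean_space set"
  assumes B: "B \<in> sets borel"
  shows "emeasure lborel ((\<lambda>x. x + v) -` B) = emeasure lborel B"
proof -
  have [measurable]: "(\<lambda>x::'a. x + v) \<in> borel_measurable borel" by measurable
  have "emeasure lborel B = emeasure (distr lborel borel (\<lambda>x. v + 1 *\<^sub>R x)) B"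
    by (subst lborel_affine[of 1 v]) (auto simp: density_1)
  also have "\<dots> = emeasure lborel ((\<lambda>x. x + v) -` B)"
    using B by (subst emeasure_distr) (auto simp: add.commute)
  finally show ?thesis ..
qed

text \<open>The part of \<open>B\<close> in one cell is cut into countably many pieces according to
  the lattice vector that carries a point into the other cell; translating the pieces reassembles
  the part of \<open>B\<close> in that cell.\<close>

lemma emeasure_cell_indep:
  assumes B: "B \<in> sets borel" and per: "\<And>x z. x + lattice_pt z \<in> B \<longleftrightarrow> x \<in> B"
  shows "emeasure lborel (B \<inter> cell c) = emeasure lborel (B \<inter> cell d)"
proof -
  define F where "F z = B \<inter> cell c \<inter> (\<lambda>x. x + lattice_pt z) -` cell d" for z
  have [measurable]: "(\<lambda>x::real^2. x + v) \<in> borel_measurable borel" for v by measurable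
  note B[measurable]
  have sh[measurable]: "(\<lambda>x. x + v) -` C \<in> sets borel" if "C \<in> sets borel" for C and v :: "real^2"
    using measurable_sets[of "\<lambda>x::real^2. x + v" borel borel C] that by simp
  have Fm: "F z \<in> sets lborel" for z unfolding F_def by simp
  define G where "G z = B \<inter> cell d \<inter> (\<lambda>x. x + lattice_pt z) -` cell c" for z
  have Gm: "G z \<in> sets lborel" for z unfolding G_def by simp
  have UF: "B \<inter> cell c = (\<Union>z. F z)" and UG: "B \<inter> cell d = (\<Union>z. G z)"
    by (auto simp: F_def G_def cell_shift_iff)
  have dF: "disjoint_family F" and dG: "disjoint_family G"
    by (auto simp: disjoint_family_on_def F_def G_def cell_shift_iff)
  have FG: "emeasure lborel (F z) = emeasure lborel (G (- fst z, - snd z))" for z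
  proof -
    have inv: "lattice_pt (- fst z, - snd z) = - lattice_pt z"
      by (simp add: vec_eq_iff forall_2)
    have "(\<lambda>x. x + lattice_pt z) -` G (- fst z, - snd z) = F z"
      unfolding F_def G_def inv by (auto simp: per)
    then show ?thesis using emeasure_lborel_shift[of "G (- fst z, - snd z)" "lattice_pt z"] Gm by simp
  qed
  have "emeasure lborel (B \<inter> cell c) = (\<integral>\<^sup>+z. emeasure lborel (F z) \<partial>count_space UNIV)"
    unfolding UF by (rule emeasure_UN_countable) (use Fm dF in auto)
  also have "\<dots> = (\<integral>\<^sup>+z. emeasure lborel (G (- fst z, - snd z)) \<partial>count_space UNIV)"
    by (simp add: FG)
  also have "\<dots> = (\<integral>\<^sup>+z. emeasure lborel (G z) \<partial>count_space UNIV)"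
    by (rule nn_integral_bij_count_space[where g = "\<lambda>z. (- fst z, - snd z)"])
       (rule bij_betwI[where g = "\<lambda>z. (- fst z, - snd z)"]; auto)
  also have "\<dots> = emeasure lborel (B \<inter> cell d)"
    unfolding UG by (rule emeasure_UN_countable[symmetric]) (use Gm dG in auto)
  finally show ?thesis .
qed

lemma emeasure_cell: "emeasure lborel (cell c) = 1"
proof (rule antisym)
  have "(\<Prod>b\<in>Basis. ((c + 1) - c) \<bullet> b) = (1::real)"
    by (rule prod.neutral) (auto simp: Basis_vec_def inner_axis)
  then have "emeasure lborel (cbox c (c + 1)) = 1" "emeasure lborel (box c (c + 1)) = 1"
    by (auto simp: emeasure_lborel_cbox_eq emeasure_lborel_box_eq Basis_vec_def inner_axis)
  moreover have "emeasure lborel (box c (c + 1)) \<le> emeasure lborel (cell c)"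
    "emeasure lborel (cell c) \<le> emeasure lborel (cbox c (c + 1))"
    by (auto intro!: emeasure_mono simp: cell_def mem_box_cart less_imp_le)
  ultimately show "emeasure lborel (cell c) \<le> 1" "1 \<le> emeasure lborel (cell c)" by auto
qed

text \<open>The free choice of the cell is the point: a shifted cell gives translation invariance,
  and the centred cell makes \<open>torus_rep\<close> invert \<open>torus_of\<close>.\<close>

lemma emeasure_torus_uniform_cell:
  assumes A: "A \<in> sets torus_borel"
  shows "emeasure torus_uniform A = emeasure lborel (torus_of -` A \<inter> cell c)"
proof -
  have B: "torus_of -` A \<in> sets borel" using A by (simp add: sets_torus_borel)
  have c0: "{x::real^2. \<forall>i. 0 \<le> x $ i \<and> x $ i < 1} = cell 0" by (simp add: cell_def)
  have "emeasure torus_uniform A = emeasure lborel (cell 0 \<inter> torus_of -` A)"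
    unfolding torus_uniform_def c0 using A B
    by (subst emeasure_distr)
      (auto simp: emeasure_cell measurable_torus_of measurable_cong_sets[OF sets_uniform_measure refl]
        divide_ennreal_def)
  also have "\<dots> = emeasure lborel (torus_of -` A \<inter> cell c)"
    using emeasure_cell_indep[OF B, of 0 c] by (simp add: torus_of_lattice_add Int_commute)
  finally show ?thesis .
qed

lemma sets_torus_uniform [simp, measurable_cong]: "sets torus_uniform = sets torus_borel"
  by (simp add: torus_uniform_def)

lemma space_torus_uniform [simp]: "space torus_uniform = UNIV"
  by (simp add: torus_uniform_def space_torus_borel)

lemma prob_space_torus_uniform: "prob_space torus_uniform"
  by (rule prob_spaceI) (simp add: emeasure_torus_uniform_cell[of _ 0] emeasure_cell sets_torus_borel)

text \<open>Lifted to the plane, translating the set amounts to moving the cell, and all cells give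
  the same measure.\<close>

lemma torus_uniform_translate: "distr torus_uniform torus_uniform (\<lambda>x. x + t) = torus_uniform"
proof (rule measure_eqI)
  fix A assume "A \<in> sets (distr torus_uniform torus_uniform (\<lambda>x. x + t))"
  then have A: "A \<in> sets torus_borel" by simp
  have [measurable]: "(\<lambda>x. x + t) \<in> measurable torus_borel torus_borel"
  proof -
    have "(\<lambda>x. fst (x, t) + snd (x, t)) \<in> measurable torus_borel torus_borel"
      by (rule measurable_compose[OF _ measurable_torus_add])
        (simp add: measurable_Pair1' space_torus_borel)
    then show ?thesis by simp
  qed
  define B where "B = torus_of -` A"
  have B: "B \<in> sets borel" using A by (simp add: B_def sets_torus_borel)
  define v where "v = torus_rep t"
  have "emeasure (distr torus_uniform torus_uniform (\<lambda>x. x + t)) A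
      = emeasure torus_uniform ((\<lambda>x. x + t) -` A)"
    using A by (subst emeasure_distr) auto
  also have "\<dots> = emeasure lborel (torus_of -` (\<lambda>x. x + t) -` A \<inter> cell 0)"
    using measurable_sets[of "\<lambda>x. x + t" torus_borel torus_borel A] A
    by (intro emeasure_torus_uniform_cell) (simp add: space_torus_borel)
  also have "torus_of -` (\<lambda>x. x + t) -` A \<inter> cell 0 = (\<lambda>x. x + v) -` (B \<inter> cell v)"
    by (auto simp: B_def v_def torus_of_add cell_def)
  also have "emeasure lborel \<dots> = emeasure lborel (B \<inter> cell v)"
    using B by (intro emeasure_lborel_shift) auto
  also have "\<dots> = emeasure torus_uniform A"
    unfolding B_def using A by (rule emeasure_torus_uniform_cell[symmetric])
  finally show "emeasure (distr torus_uniform torus_uniform (\<lambda>x. x + t)) A = emeasure torus_uniform A" .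
qed simp

section \<open>Twins in neighbourhood graphs\<close>

definition closed_twins :: "'g::ab_group_add set \<Rightarrow> 'i set \<Rightarrow> ('i \<Rightarrow> 'g) \<Rightarrow> 'i \<Rightarrow> 'i \<Rightarrow> bool" where
  "closed_twins A J x i j \<longleftrightarrow> (\<forall>z\<in>J. x z - x i \<in> A \<longleftrightarrow> x z - x j \<in> A)"

text \<open>The case \<open>z = j\<close> of \<open>closed_twins\<close> encodes adjacency of \<open>i\<close> and \<open>j\<close>, since \<open>0 \<in> A\<close> in all uses.\<close>

definition twin_pairs :: "'g::ab_group_add set \<Rightarrow> 'i set \<Rightarrow> ('i \<Rightarrow> 'g) \<Rightarrow> 'i set set" where
  "twin_pairs A J x = {{i, j} | i j. i \<in> J \<and> j \<in> J \<and> i \<noteq> j \<and> closed_twins A J x i j}"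

text \<open>What must not happen if inserting \<open>a\<close> is to leave the twin pairs as they
  are: \<open>a\<close> becomes a twin of an old point, or \<open>a\<close> separates an old pair. A
  new pair of old points cannot arise, since \<open>closed_twins\<close> passes to smaller vertex
  sets.\<close>

definition disturbs :: "'g::ab_group_add set \<Rightarrow> 'i set \<Rightarrow> 'i \<Rightarrow> ('i \<Rightarrow> 'g) \<Rightarrow> bool" where
  "disturbs A J a x \<longleftrightarrow> (\<exists>j\<in>J. closed_twins A (insert a J) x a j) \<or>
     (\<exists>i\<in>J. \<exists>j\<in>J. i \<noteq> j \<and> closed_twins A J x i j \<and> \<not> closed_twins A (insert a J) x i j)"

lemma closed_twins_sym: "closed_twins A J x i j \<Longrightarrow> closed_twins A J x j i"
  by (auto simp: closed_twins_def)

lemma closed_twins_trans: "closed_twins A J x i j \<Longrightarrow> closed_twins A J x j k \<Longrightarrow> closed_twins A J x i k"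
  by (auto simp: closed_twins_def)

lemma closed_twins_mono: "closed_twins A J x i j \<Longrightarrow> I \<subseteq> J \<Longrightarrow> closed_twins A I x i j"
  by (auto simp: closed_twins_def)

lemma closed_twins_cong:
  "(\<And>z. z \<in> J \<Longrightarrow> x z = y z) \<Longrightarrow> i \<in> J \<Longrightarrow> j \<in> J \<Longrightarrow> closed_twins A J x i j = closed_twins A J y i j"
  by (auto simp: closed_twins_def)

lemma twin_pairs_cong: "(\<And>z. z \<in> J \<Longrightarrow> x z = y z) \<Longrightarrow> twin_pairs A J x = twin_pairs A J y"
  unfolding twin_pairs_def using closed_twins_cong[of J x y] by blast

lemma disturbs_cong: "(\<And>z. z \<in> insert a J \<Longrightarrow> x z = y z) \<Longrightarrow> disturbs A J a x = disturbs A J a y"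
  unfolding disturbs_def
  using closed_twins_cong[of J x y _ _ A] closed_twins_cong[of "insert a J" x y _ _ A]
  by (intro arg_cong2[of _ _ _ _ "(\<or>)"] bex_cong refl) auto

lemma mem_twin_pairs_iff:
  "{i, j} \<in> twin_pairs A J x \<longleftrightarrow> i \<in> J \<and> j \<in> J \<and> i \<noteq> j \<and> closed_twins A J x i j"
  unfolding twin_pairs_def using closed_twins_sym by (fastforce simp: doubleton_eq_iff)

lemma twin_pairs_eqI:
  assumes "\<And>i j. i \<noteq> j \<Longrightarrow> {i, j} \<in> twin_pairs A J x \<longleftrightarrow> {i, j} \<in> P"
    and "\<And>e. e \<in> P \<Longrightarrow> \<exists>i j. i \<noteq> j \<and> e = {i, j}"
  shows "twin_pairs A J x = P"
proof (rule set_eqI)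
  fix e
  have "\<exists>i j. i \<noteq> j \<and> e = {i, j}" if "e \<in> twin_pairs A J x"
    using that by (auto simp: twin_pairs_def)
  then show "e \<in> twin_pairs A J x \<longleftrightarrow> e \<in> P" using assms by metis
qed

lemma twin_pairs_undisturbed:
  assumes "a \<notin> J" "\<not> disturbs A J a x"
  shows "twin_pairs A (insert a J) x = twin_pairs A J x"
proof (rule twin_pairs_eqI)
  fix i j :: 'a assume ij: "i \<noteq> j"
  have no: "\<not> closed_twins A (insert a J) x a k" "\<not> closed_twins A (insert a J) x k a" if "k \<in> J" for k
    using assms(2) that closed_twins_sym[of A "insert a J" x k a] by (auto simp: disturbs_def)
  have "closed_twins A (insert a J) x i j \<longleftrightarrow> closed_twins A J x i j" if "i \<in> J" "j \<in> J"
    using assms(2) that ij closed_twins_mono[of A "insert a J" x i j J] by (auto simp: disturbs_def)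
  then show "{i, j} \<in> twin_pairs A (insert a J) x \<longleftrightarrow> {i, j} \<in> twin_pairs A J x"
    using no ij unfolding mem_twin_pairs_iff by auto
qed (auto simp: twin_pairs_def)

text \<open>Being closed twins is transitive, so a twin of \<open>b\<close> would be a twin of
  \<open>a\<close>, which the absence of a disturbance excludes. By the symmetry of
  \<open>A\<close>, the point \<open>b\<close> is seen by every old point exactly as
  \<open>a\<close> is, so it separates no pair that \<open>a\<close> leaves together.\<close>

lemma twin_pairs_add_twins:
  assumes "a \<notin> J" "b \<notin> J" "a \<noteq> b"
    and tw: "closed_twins A (insert b (insert a J)) x a b" and und: "\<not> disturbs A J a x"
    and sym: "\<And>w. w \<in> A \<longleftrightarrow> - w \<in> A"
  shows "twin_pairs A (insert b (insert a J)) x = insert {a, b} (twin_pairs A J x)"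
proof (rule twin_pairs_eqI)
  fix i j :: 'a assume ij: "i \<noteq> j"
  let ?K = "insert b (insert a J)"
  have no_a: False if "closed_twins A ?K x a k" "k \<in> J" for k
    using und that closed_twins_mono[of A ?K x a k "insert a J"] by (auto simp: disturbs_def)
  have no_b: False if "closed_twins A ?K x b k" "k \<in> J" for k
    using no_a closed_twins_trans[OF tw that(1)] that(2) by blast
  have ext: "closed_twins A ?K x i j" if ct: "closed_twins A J x i j" and "i \<in> J" "j \<in> J"
  proof -
    have 1: "closed_twins A (insert a J) x i j"
      using und that ij unfolding disturbs_def by blast
    have sw: "x b - x k \<in> A \<longleftrightarrow> x a - x k \<in> A" if "k \<in> J" for k
    proof -
      have "x b - x k \<in> A \<longleftrightarrow> x k - x b \<in> A" using sym[of "x b - x k"] by simp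
      also have "\<dots> \<longleftrightarrow> x k - x a \<in> A" using tw that by (auto simp: closed_twins_def)
      also have "\<dots> \<longleftrightarrow> x a - x k \<in> A" using sym[of "x k - x a"] by simp
      finally show ?thesis .
    qed
    show ?thesis using 1 sw that by (auto simp: closed_twins_def)
  qed
  show "{i, j} \<in> twin_pairs A ?K x \<longleftrightarrow> {i, j} \<in> insert {a, b} (twin_pairs A J x)"
  proof
    assume "{i, j} \<in> twin_pairs A ?K x"
    then have "i \<in> ?K" "j \<in> ?K" "closed_twins A ?K x i j" by (auto simp: mem_twin_pairs_iff)
    then show "{i, j} \<in> insert {a, b} (twin_pairs A J x)"
      using no_a[of i] no_a[of j] no_b[of i] no_b[of j] closed_twins_sym[of A ?K x i j]
        closed_twins_mono[of A ?K x i j J] ij by (auto simp: mem_twin_pairs_iff)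
  next
    assume "{i, j} \<in> insert {a, b} (twin_pairs A J x)"
    then show "{i, j} \<in> twin_pairs A ?K x"
      using ext tw closed_twins_sym[OF tw] assms(3) by (auto simp: mem_twin_pairs_iff doubleton_eq_iff)
  qed
qed (use assms(3) in \<open>auto simp: twin_pairs_def\<close>)

lemma finite_twin_pairs: "finite J \<Longrightarrow> finite (twin_pairs A J x)"
  by (rule finite_subset[of _ "Pow J"]) (auto simp: twin_pairs_def)

text \<open>Each unordered pair comes from two ordered ones. Writing the count as a sum of
  indicators gives its measurability and its expectation.\<close>

lemma card_twin_pairs:
  assumes J: "finite J"
  shows "2 * card (twin_pairs A J x) = (\<Sum>i\<in>J. \<Sum>j\<in>J - {i}. of_bool (closed_twins A J x i j))"
proof -
  let ?R = "{(i, j). i \<in> J \<and> j \<in> J \<and> i \<noteq> j \<and> closed_twins A J x i j}"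
  have fR: "finite ?R" by (rule finite_subset[of _ "J \<times> J"]) (use J in auto)
  have "(\<Sum>i\<in>J. \<Sum>j\<in>J - {i}. of_bool (closed_twins A J x i j)) = (\<Sum>i\<in>J. card {j \<in> J - {i}. closed_twins A J x i j})"
    using J by (auto intro!: sum.cong simp: sum.If_cases of_bool_def Int_def)
  also have "\<dots> = card (Sigma J (\<lambda>i. {j \<in> J - {i}. closed_twins A J x i j}))"
    using J by simp
  also have "Sigma J (\<lambda>i. {j \<in> J - {i}. closed_twins A J x i j}) = ?R" by auto
  also have "?R = (\<Union>e\<in>twin_pairs A J x. {(i, j). {i, j} = e \<and> i \<noteq> j})"
    by (auto simp: mem_twin_pairs_iff)
  also have "card \<dots> = (\<Sum>e\<in>twin_pairs A J x. card {(i, j). {i, j} = e \<and> i \<noteq> j})"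
  proof (rule card_UN_disjoint)
    show "\<forall>e\<in>twin_pairs A J x. finite {(i, j). {i, j} = e \<and> i \<noteq> j}"
      by (intro ballI finite_subset[OF _ fR]) (auto simp: mem_twin_pairs_iff)
  qed (use finite_twin_pairs[OF J] in auto)
  also have "\<dots> = (\<Sum>e\<in>twin_pairs A J x. 2)"
  proof (rule sum.cong[OF refl])
    fix e assume "e \<in> twin_pairs A J x"
    then obtain i j where "i \<noteq> j" "e = {i, j}" by (auto simp: twin_pairs_def)
    then have "{(i, j). {i, j} = e \<and> i \<noteq> j} = {(i, j), (j, i)}" by (auto simp: doubleton_eq_iff)
    then show "card {(i, j). {i, j} = e \<and> i \<noteq> j} = 2" using \<open>i \<noteq> j\<close> by simp
  qed
  finally show ?thesis by simp
qed

section \<open>Random points in a group with invariant probability\<close>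

text \<open>The abstract setting of the probabilistic half: points \<open>x\<close> and
  \<open>y\<close> count as adjacent when \<open>y - x\<close> lies in the connection set
  \<open>A\<close>, and only the invariance of \<open>\<mu>\<close> and the symmetry of
  \<open>A\<close> are used. Geometry enters later, through estimates of \<open>sd\<close>.\<close>

locale invariant_prob_space = prob_space \<mu> for \<mu> :: "'g::ab_group_add measure" +
  fixes A :: "'g set"
  assumes space_mu [simp]: "space \<mu> = UNIV"
    and add_measurable: "(\<lambda>p. fst p + snd p) \<in> measurable (\<mu> \<Otimes>\<^sub>M \<mu>) \<mu>"
    and uminus_measurable [measurable]: "uminus \<in> measurable \<mu> \<mu>"
    and translate: "\<And>c. distr \<mu> \<mu> (\<lambda>x. x + c) = \<mu>"
    and A_sets [measurable]: "A \<in> sets \<mu>"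
    and zero_in_A [simp]: "0 \<in> A"
    and sym_A: "\<And>w. w \<in> A \<longleftrightarrow> - w \<in> A"
begin

lemma measurable_add [measurable (raw)]:
  assumes "f \<in> measurable N \<mu>" "g \<in> measurable N \<mu>"
  shows "(\<lambda>x. f x + g x) \<in> measurable N \<mu>"
  using measurable_compose[OF measurable_Pair[OF assms] add_measurable] by simp

lemma measurable_diff [measurable (raw)]:
  assumes "f \<in> measurable N \<mu>" and [measurable]: "g \<in> measurable N \<mu>"
  shows "(\<lambda>x. f x - g x) \<in> measurable N \<mu>"
  using measurable_add[of f N "\<lambda>x. - g x"] assms by simp

lemma nn_integral_translate:
  assumes [measurable]: "f \<in> borel_measurable \<mu>"
  shows "(\<integral>\<^sup>+x. f (x + c) \<partial>\<mu>) = (\<integral>\<^sup>+x. f x \<partial>\<mu>)"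
proof -
  have "(\<integral>\<^sup>+x. f x \<partial>distr \<mu> \<mu> (\<lambda>x. x + c)) = (\<integral>\<^sup>+x. f (x + c) \<partial>\<mu>)"
    by (rule nn_integral_distr) measurable
  then show ?thesis by (simp add: translate)
qed

lemma measure_translate:
  assumes [measurable]: "Measurable.pred \<mu> P"
  shows "prob {x. P (x + c)} = prob {x. P x}"
proof -
  have "{x. P x} \<in> sets \<mu>" using assms by (simp add: pred_def)
  then have "measure (distr \<mu> \<mu> (\<lambda>x. x + c)) {x. P x} = prob {x. P (x + c)}"
    by (subst measure_distr) (auto simp: vimage_def)
  then show ?thesis by (simp add: translate)
qed

text \<open>On the torus this is the area \<sigma>(h).\<close>

definition sd :: "'g \<Rightarrow> real" where
  "sd h = prob {w. (w \<in> A) \<noteq> (w - h \<in> A)}"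

text \<open>The points adjacent to exactly one of \<open>p\<close> and \<open>p + h\<close>, that
  is, the region that all further points must avoid if these two are to be twins.\<close>

definition shell :: "'g \<Rightarrow> 'g \<Rightarrow> 'g set" where
  "shell p h = {w. (w - p \<in> A) \<noteq> (w - p - h \<in> A)}"

lemma shell_sets [measurable]: "shell p h \<in> sets \<mu>"
proof -
  have "Measurable.pred \<mu> (\<lambda>w. (w - p \<in> A) \<noteq> (w - p - h \<in> A))" by measurable
  then show ?thesis by (simp add: pred_def shell_def)
qed

lemma prob_shell: "prob (shell p h) = sd h"
  using measure_translate[of "\<lambda>w. (w \<in> A) \<noteq> (w - h \<in> A)" "- p"]
  by (simp add: shell_def sd_def)

text \<open>Reflection, allowed by the symmetry of \<open>A\<close>, exchanges the roles of the
  point and of the position of the shell. It is what permits averaging over the position.\<close>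

lemma prob_shell': "prob {p. z \<in> shell p h} = sd h"
proof -
  have "z \<in> shell p h \<longleftrightarrow> ((p - z + h) - h \<in> A) \<noteq> (p - z + h \<in> A)" for p
    using sym_A[of "z - p"] sym_A[of "z - p - h"]
    by (simp add: shell_def algebra_simps)
  then have "{p. z \<in> shell p h} = {p. (p + (h - z) \<in> A) \<noteq> (p + (h - z) - h \<in> A)}"
    by (auto simp: algebra_simps)
  then show ?thesis
    using measure_translate[of "\<lambda>w. (w \<in> A) \<noteq> (w - h \<in> A)" "h - z"]
    by (simp add: sd_def)
qed

lemma sd_nonneg [simp]: "0 \<le> sd h" and sd_le1 [simp]: "sd h \<le> 1"
  by (simp_all add: sd_def)

lemma sd_measurable [measurable]: "sd \<in> borel_measurable \<mu>"
proof -
  let ?Q = "{q \<in> space (\<mu> \<Otimes>\<^sub>M \<mu>). (snd q \<in> A) \<noteq> (snd q - fst q \<in> A)}"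
  have "?Q \<in> sets (\<mu> \<Otimes>\<^sub>M \<mu>)" by measurable
  then have "(\<lambda>h. emeasure \<mu> (Pair h -` ?Q)) \<in> borel_measurable \<mu>"
    by (rule measurable_emeasure_Pair)
  moreover have "sd h = enn2real (emeasure \<mu> (Pair h -` ?Q))" for h
    by (simp add: sd_def measure_def space_pair_measure vimage_def)
  ultimately show ?thesis by (subst measurable_cong) auto
qed

abbreviation "P J \<equiv> PiM J (\<lambda>_. \<mu>)"

sublocale PP: product_prob_space "\<lambda>_. \<mu>" UNIV
  by standard

lemma prob_space_P: "prob_space (P J)"
  by (rule prob_space_PiM) (rule prob_space_axioms)

lemma closed_twins_measurable [measurable]:
  assumes J: "finite J" "J \<subseteq> K" and [measurable]: "i \<in> K" "j \<in> K"
  shows "Measurable.pred (P K) (\<lambda>x. closed_twins A J x i j)"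
  unfolding closed_twins_def
proof (rule pred_intros_finite(3)[OF J(1)])
  fix z assume "z \<in> J"
  with J have [measurable]: "z \<in> K" by auto
  show "Measurable.pred (P K) (\<lambda>x. (x z - x i \<in> A) = (x z - x j \<in> A))" by measurable
qed

lemma card_twin_pairs_measurable [measurable]:
  assumes J: "finite J" "J \<subseteq> K"
  shows "(\<lambda>x. card (twin_pairs A J x)) \<in> measurable (P K) (count_space UNIV)"
proof -
  have "(\<lambda>x. (\<Sum>i\<in>J. \<Sum>j\<in>J - {i}. of_bool (closed_twins A J x i j) :: nat)) \<in> measurable (P K) (count_space UNIV)"
  proof (intro measurable_sum_nat)
    fix i j assume "i \<in> J" "j \<in> J - {i}"
    then have [measurable]: "Measurable.pred (P K) (\<lambda>x. closed_twins A J x i j)"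
      using J by (intro closed_twins_measurable) auto
    show "(\<lambda>x. of_bool (closed_twins A J x i j) :: nat) \<in> measurable (P K) (count_space UNIV)"
      unfolding of_bool_def by measurable
  qed
  then have "(\<lambda>x. (\<Sum>i\<in>J. \<Sum>j\<in>J - {i}. of_bool (closed_twins A J x i j) :: nat) div 2) \<in> measurable (P K) (count_space UNIV)"
    by (rule measurable_compose) simp
  then show ?thesis by (simp add: card_twin_pairs[OF J(1), symmetric])
qed

lemma disturbs_measurable [measurable]:
  assumes J: "finite J" "insert a J \<subseteq> K"
  shows "Measurable.pred (P K) (disturbs A J a)"
proof -
  have *: "Measurable.pred (P K) (\<lambda>x. closed_twins A L x i j)"
    if "L = J \<or> L = insert a J" "i \<in> insert a J" "j \<in> insert a J" for L i j
    using that J by (intro closed_twins_measurable) auto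
  have 1: "Measurable.pred (P K) (\<lambda>x. closed_twins A (insert a J) x i j)"
    if "i \<in> insert a J" "j \<in> J" for i j
    using * that by blast
  have 2: "Measurable.pred (P K) (\<lambda>x. closed_twins A J x i j)" if "i \<in> J" "j \<in> J" for i j
    using * that by blast
  show ?thesis
    unfolding disturbs_def
    by (intro pred_intros_logic pred_intros_finite J 1 2) auto
qed

text \<open>Over the points indexed by \<open>I\<close>, the pair \<open>p\<close>,
  \<open>p + h\<close> would be adjacent (first conjunct) and not separated by any point (second
  conjunct).\<close>

definition void :: "'i set \<Rightarrow> ('i \<Rightarrow> 'g) \<Rightarrow> 'g \<Rightarrow> 'g \<Rightarrow> bool" where
  "void I x p h \<longleftrightarrow> h \<in> A \<and> (\<forall>z\<in>I. x z \<notin> shell p h)"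

lemma void_measurable [measurable (raw)]:
  assumes I: "finite I" "I \<subseteq> K" and f: "f \<in> measurable N (P K)"
    and [measurable]: "g \<in> measurable N \<mu>" "k \<in> measurable N \<mu>"
  shows "Measurable.pred N (\<lambda>y. void I (f y) (g y) (k y))"
  unfolding void_def shell_def mem_Collect_eq
proof -
  have [measurable]: "Measurable.pred N (\<lambda>y. \<forall>z\<in>I. \<not> (f y z - g y \<in> A) \<noteq> (f y z - g y - k y \<in> A))"
  proof (rule pred_intros_finite(3)[OF I(1)])
    fix z assume "z \<in> I"
    then have [measurable]: "(\<lambda>y. f y z) \<in> measurable N \<mu>"
      using I by (intro measurable_compose[OF f]) (auto intro!: measurable_component_singleton)
    show "Measurable.pred N (\<lambda>y. \<not> (f y z - g y \<in> A) \<noteq> (f y z - g y - k y \<in> A))"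
      by measurable
  qed
  show "Measurable.pred N (\<lambda>y. k y \<in> A \<and> (\<forall>z\<in>I. \<not> (f y z - g y \<in> A) \<noteq> (f y z - g y - k y \<in> A)))"
    by measurable
qed

lemma closed_twins_void:
  assumes "a \<notin> I" "b \<notin> I" "a \<noteq> b"
  shows "closed_twins A (insert b (insert a I)) (x(a := p, b := p + h)) a b \<longleftrightarrow> void I x p h"
proof -
  have "z \<in> I \<Longrightarrow> z \<noteq> a \<and> z \<noteq> b" for z using assms by auto
  then show ?thesis
    using assms(3) sym_A[of h]
    by (auto simp: closed_twins_def void_def shell_def diff_diff_eq)
qed

lemma closed_twins_void':
  assumes "b \<notin> I" "a \<in> I" 
  shows "closed_twins A (insert b I) (x(b := x a + h)) a b \<longleftrightarrow> void (I - {a}) x (x a) h"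
  using closed_twins_void[of a "I - {a}" b x "x a" h] assms
  by (auto simp: insert_absorb)

text \<open>By invariance the last point may be drawn as a uniform displacement from the position of
  \<open>a\<close>. The displacement alone determines adjacency and the measure of the
  shell.\<close>

lemma nn_integral_P_insert2:
  assumes I: "finite I" "a \<notin> I" "b \<notin> I" "a \<noteq> b"
    and F [measurable]: "F \<in> borel_measurable (P (insert b (insert a I)))"
  shows "(\<integral>\<^sup>+x. F x \<partial>P (insert b (insert a I))) = (\<integral>\<^sup>+x. \<integral>\<^sup>+h. F (x(b := x a + h)) \<partial>\<mu> \<partial>P (insert a I))"
proof -
  have "(\<integral>\<^sup>+x. F x \<partial>P (insert b (insert a I))) = (\<integral>\<^sup>+x. \<integral>\<^sup>+q. F (x(b := q)) \<partial>\<mu> \<partial>P (insert a I))"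
    using I by (subst PP.product_nn_integral_insert) auto
  also have "\<dots> = (\<integral>\<^sup>+x. \<integral>\<^sup>+h. F (x(b := x a + h)) \<partial>\<mu> \<partial>P (insert a I))"
  proof (rule nn_integral_cong)
    fix x assume x: "x \<in> space (P (insert a I))"
    have "(\<lambda>q. F (x(b := q))) \<in> borel_measurable \<mu>"
      using measurable_compose[OF measurable_component_update[OF x, of b] F] I by simp
    from nn_integral_translate[OF this, of "x a"]
    show "(\<integral>\<^sup>+q. F (x(b := q)) \<partial>\<mu>) = (\<integral>\<^sup>+h. F (x(b := x a + h)) \<partial>\<mu>)"
      by (simp add: add.commute)
  qed
  finally show ?thesis .
qed

lemma nn_integral_P_insert:
  assumes I: "finite I" "a \<notin> I"
    and F [measurable]: "F \<in> borel_measurable (P (insert a I))"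
  shows "(\<integral>\<^sup>+x. F x \<partial>P (insert a I)) = (\<integral>\<^sup>+x. \<integral>\<^sup>+p. F (x(a := p)) \<partial>\<mu> \<partial>P I)"
  using I by (subst PP.product_nn_integral_insert) auto

lemma emeasure_P_avoid:
  assumes I: "finite I" and S: "S \<in> sets \<mu>"
  shows "(\<integral>\<^sup>+x. of_bool (\<forall>z\<in>I. x z \<notin> S) \<partial>P I) = ennreal ((1 - prob S) ^ card I)"
proof -
  have "(\<integral>\<^sup>+x. of_bool (\<forall>z\<in>I. x z \<notin> S) \<partial>P I) = (\<integral>\<^sup>+x. indicator (Pi\<^sub>E I (\<lambda>_. - S)) x \<partial>P I)"
    by (rule nn_integral_cong) (auto simp: space_PiM PiE_def split: split_indicator)
  also have "\<dots> = emeasure (P I) (Pi\<^sub>E I (\<lambda>_. - S))"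
    using I S by (intro nn_integral_indicator sets_PiM_I_finite) (use sets.compl_sets[of S \<mu>] in \<open>auto simp: Compl_eq_Diff_UNIV\<close>)
  also have "\<dots> = (\<Prod>i\<in>I. emeasure \<mu> (- S))"
    using I S by (intro PP.emeasure_PiM) (use sets.compl_sets[of S \<mu>] in \<open>auto simp: Compl_eq_Diff_UNIV\<close>)
  also have "emeasure \<mu> (- S) = ennreal (1 - prob S)"
    using prob_compl[OF S] by (simp add: emeasure_eq_measure Compl_eq_Diff_UNIV)
  finally show ?thesis by (simp add: ennreal_power)
qed

lemma emeasure_void:
  assumes "finite I"
  shows "(\<integral>\<^sup>+x. of_bool (void I x p h) \<partial>P I) = of_bool (h \<in> A) * ennreal ((1 - sd h) ^ card I)"
  using emeasure_P_avoid[OF assms, of "shell p h"]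
  by (cases "h \<in> A") (auto simp: void_def prob_shell)

text \<open>Both pairs are tested against the same points, so their dependence enters only through
  the measure of the union of the two shells.\<close>

lemma emeasure_void_void:
  assumes "finite I"
  shows "(\<integral>\<^sup>+x. of_bool (void I x p h) * of_bool (void I x q k) \<partial>P I)
    = of_bool (h \<in> A) * of_bool (k \<in> A) * ennreal ((1 - prob (shell p h \<union> shell q k)) ^ card I)"
proof -
  have "of_bool (void I x p h) * of_bool (void I x q k)
      = of_bool (h \<in> A) * of_bool (k \<in> A) * (of_bool (\<forall>z\<in>I. x z \<notin> shell p h \<union> shell q k) :: ennreal)" for x
    by (auto simp: void_def)
  moreover have "(\<integral>\<^sup>+x. of_bool (h \<in> A) * of_bool (k \<in> A) * (of_bool (\<forall>z\<in>I. x z \<notin> shell p h \<union> shell q k) :: ennreal) \<partial>P I)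
     = of_bool (h \<in> A) * of_bool (k \<in> A) * ennreal ((1 - prob (shell p h \<union> shell q k)) ^ card I)"
    using emeasure_P_avoid[OF assms, of "shell p h \<union> shell q k"]
    by (cases "h \<in> A"; cases "k \<in> A") auto
  ultimately show ?thesis by simp
qed

end

section \<open>Elementary inequalities for powers\<close>

lemma power_diff_bound:
  fixes a c :: real
  assumes "0 \<le> c" "c \<le> a"
  shows "a ^ n \<le> c ^ n + real n * (a - c) * a ^ (n - 1)"
proof (induction n)
  case (Suc n)
  have "a ^ Suc n = a * a ^ n" by simp
  also have "\<dots> \<le> a * (c ^ n + real n * (a - c) * a ^ (n - 1))"
    using Suc assms by (intro mult_left_mono) auto
  also have "\<dots> = c ^ Suc n + (a - c) * c ^ n + real n * (a - c) * (a * a ^ (n - 1))"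
    by (simp add: algebra_simps)
  also have "real n * (a - c) * (a * a ^ (n - 1)) = real n * (a - c) * a ^ n"
    by (cases n) auto
  also have "(a - c) * c ^ n \<le> (a - c) * a ^ n"
    using assms by (intro mult_left_mono power_mono) auto
  finally show ?case by (simp add: algebra_simps)
qed simp

lemma one_minus_power_le_exp:
  fixes s :: real
  assumes "0 \<le> s" "s \<le> 1"
  shows "(1 - s) ^ n \<le> exp (- (real n * s))"
proof -
  have "(1 - s) ^ n \<le> exp (- s) ^ n"
    using assms exp_ge_add_one_self[of "- s"] by (intro power_mono) auto
  then show ?thesis by (simp add: exp_of_nat_mult[symmetric])
qed

text \<open>
  Here \<open>s\<close>, \<open>t\<close> and \<open>u\<close> are the measures of two shells and of their union: the joint void
  probability exceeds the product by at most a multiple of the measure of the intersection.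
\<close>

lemma correlation_bound:
  fixes s t u :: real
  assumes "0 \<le> s" "0 \<le> t" "s \<le> u" "t \<le> u" "u \<le> 1" "u \<le> s + t"
  shows "(1 - u) ^ n \<le> (1 - s) ^ n * (1 - t) ^ n
    + real n * (s + t - u) * (exp (- (real (n - 1) / 2 * s)) * exp (- (real (n - 1) / 2 * t)))"
proof (cases "1 - u \<le> (1 - s) * (1 - t)")
  case True
  then have "(1 - u) ^ n \<le> ((1 - s) * (1 - t)) ^ n"
    using assms by (intro power_mono) auto
  also have "\<dots> = (1 - s) ^ n * (1 - t) ^ n" by (rule power_mult_distrib)
  finally show ?thesis using assms by (simp add: add_increasing2)
next
  case False
  have 0: "0 \<le> (1 - s) * (1 - t)" using assms by (intro mult_nonneg_nonneg) auto
  have "(1 - u) ^ n \<le> ((1 - s) * (1 - t)) ^ n + real n * ((1 - u) - (1 - s) * (1 - t)) * (1 - u) ^ (n - 1)"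
    using False by (intro power_diff_bound 0) auto
  also have "real n * ((1 - u) - (1 - s) * (1 - t)) * (1 - u) ^ (n - 1)
      \<le> real n * (s + t - u) * (exp (- (real (n - 1) / 2 * s)) * exp (- (real (n - 1) / 2 * t)))"
  proof (rule mult_mono)
    \<comment> \<open>The product \<open>s * t\<close> is dropped; what remains,
      \<open>s + t - u\<close>, is the measure of the intersection in the application.\<close>
    have "0 \<le> s * t" using assms by simp
    then show "real n * (1 - u - (1 - s) * (1 - t)) \<le> real n * (s + t - u)"
      by (intro mult_left_mono) (auto simp: algebra_simps)
    have "(1 - u) ^ (n - 1) \<le> exp (- (real (n - 1) * u))"
      using assms by (intro one_minus_power_le_exp) auto
    \<comment> \<open>As \<open>u\<close> is at least the mean of \<open>s\<close> and
      \<open>t\<close>, the decay in \<open>u\<close> splits into one factor for each of them, at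
      half the rate. Factors in separate variables are needed to integrate over the two
      displacements independently.\<close>
    also have "\<dots> \<le> exp (- (real (n - 1) / 2 * s) + - (real (n - 1) / 2 * t))"
    proof -
      have "real (n - 1) * ((s + t) / 2) \<le> real (n - 1) * u"
        using assms by (intro mult_left_mono) auto
      then show ?thesis by (simp add: algebra_simps)
    qed
    finally show "(1 - u) ^ (n - 1) \<le> exp (- (real (n - 1) / 2 * s)) * exp (- (real (n - 1) / 2 * t))"
      by (simp only: exp_add)
  qed (use assms in auto)
  finally show ?thesis by (simp add: power_mult_distrib)
qed

section \<open>Mean twin probability and moments of the conditional one\<close>

context invariant_prob_space
begin

text \<open>This turns out to be the probability that two given points among \<open>m + 2\<close>
  are adjacent twins.\<close>

definition mean_void :: "nat \<Rightarrow> real" where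
  "mean_void m = (LINT h|\<mu>. of_bool (h \<in> A) * (1 - sd h) ^ m)"

text \<open>The exponential majorant of \<open>mean_void\<close>. Its parameter is real because half
  rates occur.\<close>

definition laplace :: "real \<Rightarrow> real" where
  "laplace \<alpha> = (LINT h|\<mu>. of_bool (h \<in> A) * exp (- (\<alpha> * sd h)))"

text \<open>Formally the negative derivative of \<open>laplace\<close>. The extra factor
  \<open>sd\<close> appears when a further point hits the shell, or when two shells meet.\<close>

definition laplace1 :: "real \<Rightarrow> real" where
  "laplace1 \<alpha> = (LINT h|\<mu>. of_bool (h \<in> A) * (sd h * exp (- (\<alpha> * sd h))))"

lemma integrable_mean_void: "integrable \<mu> (\<lambda>h. of_bool (h \<in> A) * (1 - sd h) ^ m)"
  by (rule integrable_const_bound[where B = 1]) (auto intro!: power_le_one AE_I2)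

lemma integrable_laplace: "0 \<le> \<alpha> \<Longrightarrow> integrable \<mu> (\<lambda>h. of_bool (h \<in> A) * exp (- (\<alpha> * sd h)))"
  by (rule integrable_const_bound[where B = 1]) (auto intro!: AE_I2)

lemma integrable_laplace1: "0 \<le> \<alpha> \<Longrightarrow> integrable \<mu> (\<lambda>h. of_bool (h \<in> A) * (sd h * exp (- (\<alpha> * sd h))))"
  by (rule integrable_const_bound[where B = 1]) (auto intro!: AE_I2 mult_le_one)

lemma nn_mean_void: "(\<integral>\<^sup>+h. of_bool (h \<in> A) * ennreal ((1 - sd h) ^ m) \<partial>\<mu>) = ennreal (mean_void m)"
  unfolding mean_void_def
  by (subst nn_integral_eq_integral[OF integrable_mean_void, symmetric])
     (auto intro!: nn_integral_cong simp: of_bool_def)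

lemma nn_laplace: "0 \<le> \<alpha> \<Longrightarrow> (\<integral>\<^sup>+h. of_bool (h \<in> A) * ennreal (exp (- (\<alpha> * sd h))) \<partial>\<mu>) = ennreal (laplace \<alpha>)"
  unfolding laplace_def
  by (subst nn_integral_eq_integral[OF integrable_laplace, symmetric])
     (auto intro!: nn_integral_cong simp: of_bool_def)

lemma nn_laplace1: "0 \<le> \<alpha> \<Longrightarrow> (\<integral>\<^sup>+h. of_bool (h \<in> A) * ennreal (sd h * exp (- (\<alpha> * sd h))) \<partial>\<mu>) = ennreal (laplace1 \<alpha>)"
  unfolding laplace1_def
  by (subst nn_integral_eq_integral[OF integrable_laplace1, symmetric])
     (auto intro!: nn_integral_cong simp: of_bool_def)

lemma mean_void_nonneg: "0 \<le> mean_void m"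
  unfolding mean_void_def by (intro integral_nonneg_AE AE_I2) simp

lemma laplace_nonneg: "0 \<le> laplace \<alpha>"
  unfolding laplace_def by (intro integral_nonneg_AE AE_I2) simp

lemma laplace1_nonneg: "0 \<le> laplace1 \<alpha>"
  unfolding laplace1_def by (intro integral_nonneg_AE AE_I2) simp

lemma mean_void_le_laplace: "mean_void m \<le> laplace (real m)"
  unfolding mean_void_def laplace_def
  by (intro integral_mono integrable_mean_void integrable_laplace) (auto intro!: one_minus_power_le_exp)

text \<open>The difference is the probability that one further point separates a pair that was not
  separated by \<open>m\<close> points, which costs one factor \<open>sd h\<close>.\<close>

lemma mean_void_diff_le: "mean_void m - mean_void (Suc m) \<le> laplace1 (real m)"
proof -
  have "mean_void m - mean_void (Suc m)
      = (LINT h|\<mu>. of_bool (h \<in> A) * (1 - sd h) ^ m - of_bool (h \<in> A) * (1 - sd h) ^ Suc m)"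
    unfolding mean_void_def by (rule Bochner_Integration.integral_diff[symmetric]) (rule integrable_mean_void)+
  also have "\<dots> \<le> laplace1 (real m)"
    unfolding laplace1_def
  proof (intro integral_mono integrable_laplace1 Bochner_Integration.integrable_diff integrable_mean_void)
    fix h
    have "(1 - sd h) ^ m - (1 - sd h) ^ Suc m = sd h * (1 - sd h) ^ m" by (simp add: algebra_simps)
    also have "\<dots> \<le> sd h * exp (- (real m * sd h))"
      by (intro mult_left_mono one_minus_power_le_exp) auto
    finally show "of_bool (h \<in> A) * (1 - sd h) ^ m - of_bool (h \<in> A) * (1 - sd h) ^ Suc m
        \<le> of_bool (h \<in> A) * (sd h * exp (- (real m * sd h)))"
      by (auto simp: of_bool_def)
  qed simp
  finally show ?thesis .
qed

text \<open>Half of the exponential decay absorbs the factor \<open>\<alpha> * sd h\<close>, so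
  \<open>laplace1\<close> is smaller than \<open>laplace\<close> by one power of
  \<open>\<alpha>\<close>.\<close>

lemma laplace1_le: "0 < \<alpha> \<Longrightarrow> laplace1 \<alpha> \<le> laplace (\<alpha> / 2) / \<alpha>"
proof -
  assume \<alpha>: "0 < \<alpha>"
  have "laplace1 \<alpha> \<le> (LINT h|\<mu>. (of_bool (h \<in> A) * exp (- (\<alpha> / 2 * sd h))) / \<alpha>)"
    unfolding laplace1_def
  proof (intro integral_mono integrable_laplace1 integrable_divide integrable_laplace)
    fix h
    define y where "y = \<alpha> * sd h"
    have y: "0 \<le> y" using \<alpha> by (simp add: y_def)
    have "y \<le> exp (y / 2)"
    proof -
      \<comment> \<open>The difference of the two sides is ((y - 2)^2 + 4) / 8.\<close>
      have "y \<le> 1 + y/2 + (y/2)^2/2"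
        using sum_power2_ge_zero[of "y - 2" 2] by (simp add: power2_eq_square algebra_simps)
      also have "\<dots> \<le> exp (y / 2)" using exp_lower_Taylor_quadratic[of "y/2"] y by simp
      finally show ?thesis .
    qed
    then have "y * exp (- y) \<le> exp (y / 2) * exp (- y)" by (intro mult_right_mono) auto
    also have "\<dots> = exp (- (y / 2))" by (simp add: exp_add[symmetric])
    finally have "sd h * exp (- (\<alpha> * sd h)) \<le> exp (- (\<alpha> / 2 * sd h)) / \<alpha>"
      using \<alpha> by (simp add: y_def field_simps)
    then show "of_bool (h \<in> A) * (sd h * exp (- (\<alpha> * sd h))) \<le> of_bool (h \<in> A) * exp (- (\<alpha> / 2 * sd h)) / \<alpha>"
      by (auto simp: of_bool_def)
  qed (use \<alpha> in auto)
  also have "\<dots> = laplace (\<alpha> / 2) / \<alpha>"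
    unfolding laplace_def by simp
  finally show ?thesis .
qed

lemma nn_integral_P_pair:
  assumes I: "finite I" "a \<notin> I" "b \<notin> I" "a \<noteq> b"
    and F [measurable]: "F \<in> borel_measurable (P (insert b (insert a I)))"
  shows "(\<integral>\<^sup>+x. F x \<partial>P (insert b (insert a I))) = (\<integral>\<^sup>+x. \<integral>\<^sup>+p. \<integral>\<^sup>+h. F (x(a := p, b := p + h)) \<partial>\<mu> \<partial>\<mu> \<partial>P I)"
proof -
  have "(\<lambda>x. \<integral>\<^sup>+h. F (x(b := x a + h)) \<partial>\<mu>) \<in> borel_measurable (P (insert a I))"
    using I by measurable
  then have "(\<integral>\<^sup>+x. \<integral>\<^sup>+h. F (x(b := x a + h)) \<partial>\<mu> \<partial>P (insert a I))
      = (\<integral>\<^sup>+x. \<integral>\<^sup>+p. \<integral>\<^sup>+h. F ((x(a := p))(b := p + h)) \<partial>\<mu> \<partial>\<mu> \<partial>P I)"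
    using I by (subst nn_integral_P_insert) auto
  then show ?thesis using nn_integral_P_insert2[OF I F] by simp
qed

text \<open>Given the points in \<open>I\<close>, the conditional probability that two further
  uniform points are adjacent twins over \<open>I\<close>. The decoupling rests on its small
  variance.\<close>

definition void_mass :: "'i set \<Rightarrow> ('i \<Rightarrow> 'g) \<Rightarrow> ennreal" where
  "void_mass I x = (\<integral>\<^sup>+p. \<integral>\<^sup>+h. of_bool (void I x p h) \<partial>\<mu> \<partial>\<mu>)"

lemma void_mass_measurable [measurable]:
  assumes "finite I" shows "void_mass I \<in> borel_measurable (P I)"
  unfolding void_mass_def using assms by measurable auto

lemma nn_integral_closed_twins:
  assumes I: "finite I" "a \<notin> I" "b \<notin> I" "a \<noteq> b"
    and Q [measurable]: "Measurable.pred (P (insert b (insert a I))) Q"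
    and QI: "\<And>x y z. Q (x(a := y, b := z)) \<longleftrightarrow> R x"
  shows "(\<integral>\<^sup>+x. of_bool (closed_twins A (insert b (insert a I)) x a b \<and> Q x) \<partial>P (insert b (insert a I)))
    = (\<integral>\<^sup>+x. of_bool (R x) * void_mass I x \<partial>P I)"
proof -
  have [measurable]: "Measurable.pred (P (insert b (insert a I))) (\<lambda>x. closed_twins A (insert b (insert a I)) x a b)"
    using I by (intro closed_twins_measurable) auto
  show ?thesis
  proof (subst nn_integral_P_pair[OF I], measurable, rule nn_integral_cong)
    fix x assume "x \<in> space (P I)"
    show "(\<integral>\<^sup>+p. \<integral>\<^sup>+h. of_bool (closed_twins A (insert b (insert a I)) (x(a := p, b := p + h)) a b \<and> Q (x(a := p, b := p + h))) \<partial>\<mu> \<partial>\<mu>)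
       = of_bool (R x) * void_mass I x"
      by (simp add: closed_twins_void[OF I(2-4)] QI void_mass_def)
  qed
qed

lemma pair_sigma_finite_P: "pair_sigma_finite (P I) \<mu>" "pair_sigma_finite \<mu> (P I)" "pair_sigma_finite \<mu> \<mu>"
    "pair_sigma_finite (\<mu> \<Otimes>\<^sub>M \<mu>) (\<mu> \<Otimes>\<^sub>M \<mu>)" "pair_sigma_finite (\<mu> \<Otimes>\<^sub>M \<mu>) (P I)"
proof -
  have 1: "sigma_finite_measure (P I)" for I
    using prob_space_P by (rule prob_space_imp_sigma_finite)
  have 2: "sigma_finite_measure \<mu>" by unfold_locales
  have 3: "sigma_finite_measure (\<mu> \<Otimes>\<^sub>M \<mu>)"
    by (rule sigma_finite_pair_measure) (rule 2)+
  show "pair_sigma_finite (P I) \<mu>" "pair_sigma_finite \<mu> (P I)" "pair_sigma_finite \<mu> \<mu>"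
    "pair_sigma_finite (\<mu> \<Otimes>\<^sub>M \<mu>) (\<mu> \<Otimes>\<^sub>M \<mu>)" "pair_sigma_finite (\<mu> \<Otimes>\<^sub>M \<mu>) (P I)"
    using 1 2 3 by (auto simp: pair_sigma_finite_def)
qed

lemma void_mass_pair:
  assumes I: "finite I" and x: "x \<in> space (P I)"
  shows "void_mass I x = (\<integral>\<^sup>+w. of_bool (void I x (fst w) (snd w)) \<partial>(\<mu> \<Otimes>\<^sub>M \<mu>))"
proof -
  have [measurable]: "Measurable.pred (\<mu> \<Otimes>\<^sub>M \<mu>) (\<lambda>w. void I x (fst w) (snd w))"
    using I x by (intro void_measurable[where K = I]) auto
  show ?thesis
    unfolding void_mass_def
    by (subst nn_integral_fst[symmetric]) auto
qed

lemma nn_integral_void_mass: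
  assumes I: "finite I"
  shows "(\<integral>\<^sup>+x. void_mass I x \<partial>P I) = ennreal (mean_void (card I))"
proof -
  have [measurable]: "Measurable.pred ((\<mu> \<Otimes>\<^sub>M \<mu>) \<Otimes>\<^sub>M P I) (\<lambda>u. void I (snd u) (fst (fst u)) (snd (fst u)))"
    using I by (intro void_measurable[where K = I]) auto
  have "(\<integral>\<^sup>+x. void_mass I x \<partial>P I) = (\<integral>\<^sup>+x. \<integral>\<^sup>+w. of_bool (void I x (fst w) (snd w)) \<partial>(\<mu> \<Otimes>\<^sub>M \<mu>) \<partial>P I)"
    by (rule nn_integral_cong) (rule void_mass_pair[OF I])
  also have "\<dots> = (\<integral>\<^sup>+w. \<integral>\<^sup>+x. of_bool (void I x (fst w) (snd w)) \<partial>P I \<partial>(\<mu> \<Otimes>\<^sub>M \<mu>))"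
    by (rule pair_sigma_finite.Fubini'[OF pair_sigma_finite_P(5)[of I]])
       (simp add: split_beta', measurable)
  also have "\<dots> = (\<integral>\<^sup>+w. of_bool (snd w \<in> A) * ennreal ((1 - sd (snd w)) ^ card I) \<partial>(\<mu> \<Otimes>\<^sub>M \<mu>))"
    by (simp add: emeasure_void[OF I])
  also have "\<dots> = (\<integral>\<^sup>+p. \<integral>\<^sup>+h. of_bool (h \<in> A) * ennreal ((1 - sd h) ^ card I) \<partial>\<mu> \<partial>\<mu>)"
    by (subst nn_integral_fst[symmetric]) auto
  also have "\<dots> = ennreal (mean_void (card I))"
    by (simp add: nn_mean_void emeasure_space_1[simplified])
  finally show ?thesis .
qed

text \<open>A shell at a uniform position covers each fixed point with probability
  \<open>sd h\<close>, so on average it covers this proportion of any set.\<close>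

lemma nn_integral_shell_Int:
  assumes [measurable]: "S \<in> sets \<mu>"
  shows "(\<integral>\<^sup>+p. ennreal (prob (S \<inter> shell p h)) \<partial>\<mu>) = ennreal (prob S * sd h)"
proof -
  have [measurable]: "Measurable.pred (\<mu> \<Otimes>\<^sub>M \<mu>) (\<lambda>u. snd u \<in> shell (fst u) h)"
    "Measurable.pred (\<mu> \<Otimes>\<^sub>M \<mu>) (\<lambda>u. fst u \<in> shell (snd u) h)"
    unfolding shell_def mem_Collect_eq by measurable
  have [measurable]: "Measurable.pred \<mu> (\<lambda>p. z \<in> shell p h)" for z
    unfolding shell_def mem_Collect_eq by measurable
  have "(\<integral>\<^sup>+p. ennreal (prob (S \<inter> shell p h)) \<partial>\<mu>) = (\<integral>\<^sup>+p. \<integral>\<^sup>+z. of_bool (z \<in> S) * of_bool (z \<in> shell p h) \<partial>\<mu> \<partial>\<mu>)"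
  proof (rule nn_integral_cong)
    fix p
    have "ennreal (prob (S \<inter> shell p h)) = (\<integral>\<^sup>+z. indicator (S \<inter> shell p h) z \<partial>\<mu>)"
      by (simp add: emeasure_eq_measure)
    also have "\<dots> = (\<integral>\<^sup>+z. of_bool (z \<in> S) * of_bool (z \<in> shell p h) \<partial>\<mu>)"
      by (rule nn_integral_cong) (auto split: split_indicator)
    finally show "ennreal (prob (S \<inter> shell p h)) = (\<integral>\<^sup>+z. of_bool (z \<in> S) * of_bool (z \<in> shell p h) \<partial>\<mu>)" .
  qed
  also have "\<dots> = (\<integral>\<^sup>+z. \<integral>\<^sup>+p. of_bool (z \<in> S) * of_bool (z \<in> shell p h) \<partial>\<mu> \<partial>\<mu>)"
    by (rule pair_sigma_finite.Fubini'[OF pair_sigma_finite_P(3)]) (simp add: split_beta')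
  also have "\<dots> = (\<integral>\<^sup>+z. of_bool (z \<in> S) * ennreal (sd h) \<partial>\<mu>)"
  proof (rule nn_integral_cong)
    fix z
    have "(\<integral>\<^sup>+p. of_bool (z \<in> shell p h) \<partial>\<mu>) = (\<integral>\<^sup>+p. indicator {p. z \<in> shell p h} p \<partial>\<mu>)"
      by (rule nn_integral_cong) (auto split: split_indicator)
    also have "\<dots> = ennreal (sd h)"
    proof (subst nn_integral_indicator)
      have "Measurable.pred \<mu> (\<lambda>p. z \<in> shell p h)" by measurable
      then show "{p. z \<in> shell p h} \<in> sets \<mu>" by (simp add: pred_def)
    qed (simp add: emeasure_eq_measure prob_shell')
    finally show "(\<integral>\<^sup>+p. of_bool (z \<in> S) * of_bool (z \<in> shell p h) \<partial>\<mu>) = of_bool (z \<in> S) * ennreal (sd h)"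
      by (simp add: nn_integral_cmult)
  qed
  also have "\<dots> = (\<integral>\<^sup>+z. ennreal (sd h) * indicator S z \<partial>\<mu>)"
    by (rule nn_integral_cong) (auto split: split_indicator)
  also have "\<dots> = ennreal (prob S * sd h)"
    by (subst nn_integral_cmult) (auto simp: emeasure_eq_measure ennreal_mult mult.commute)
  finally show ?thesis .
qed

text \<open>This is \<open>correlation_bound\<close> for two shells, where inclusion and exclusion
  identify \<open>s + t - u\<close> with the measure of their intersection. Apart from that measure,
  every factor depends on one displacement only.\<close>

lemma void_void_le:
  assumes I: "finite I"
  shows "(\<integral>\<^sup>+x. of_bool (void I x p h) * of_bool (void I x q k) \<partial>P I)
    \<le> (of_bool (h \<in> A) * ennreal ((1 - sd h) ^ card I)) * (of_bool (k \<in> A) * ennreal ((1 - sd k) ^ card I))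
      + ennreal (real (card I)) * (of_bool (h \<in> A) * ennreal (exp (- (real (card I - 1) / 2 * sd h))))
        * (of_bool (k \<in> A) * ennreal (exp (- (real (card I - 1) / 2 * sd k)))) * ennreal (prob (shell p h \<inter> shell q k))"
proof -
  let ?n = "card I" and ?u = "prob (shell p h \<union> shell q k)"
  have Un: "?u = sd h + sd k - prob (shell p h \<inter> shell q k)"
    using finite_measure_Union'[of "shell p h" "shell q k"] finite_measure_Diff'[of "shell q k" "shell p h"]
    by (simp add: prob_shell Int_commute)
  have le: "sd h \<le> ?u" "sd k \<le> ?u"
    using finite_measure_mono[of "shell p h" "shell p h \<union> shell q k"]
      finite_measure_mono[of "shell q k" "shell p h \<union> shell q k"] by (auto simp: prob_shell)
  have "(1 - ?u) ^ ?n \<le> (1 - sd h) ^ ?n * (1 - sd k) ^ ?n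
    + real ?n * (sd h + sd k - ?u) * (exp (- (real (?n - 1) / 2 * sd h)) * exp (- (real (?n - 1) / 2 * sd k)))"
    using prob_le_1[of "shell p h \<union> shell q k"] by (intro correlation_bound le) (auto simp: Un)
  also have "sd h + sd k - ?u = prob (shell p h \<inter> shell q k)" using Un by simp
  finally have "ennreal ((1 - ?u) ^ ?n) \<le> ennreal ((1 - sd h) ^ ?n * (1 - sd k) ^ ?n
    + real ?n * prob (shell p h \<inter> shell q k) * (exp (- (real (?n - 1) / 2 * sd h)) * exp (- (real (?n - 1) / 2 * sd k))))"
    by (rule ennreal_leI)
  then show ?thesis
    unfolding emeasure_void_void[OF I]
    by (cases "h \<in> A"; cases "k \<in> A") (auto simp: ennreal_plus ennreal_mult mult_ac)
qed

text \<open>The square is the probability that two independently placed pairs are both void for the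
  same points. Averaging the intersection of their shells over the position of one pair gives
  \<open>sd h * sd k\<close>; so the excess over the squared mean is a product of two integrals with
  one factor \<open>sd\<close> each.\<close>

lemma nn_integral_void_mass_square:
  assumes I: "finite I"
  shows "(\<integral>\<^sup>+x. (void_mass I x)\<^sup>2 \<partial>P I)
    \<le> ennreal ((mean_void (card I))\<^sup>2 + real (card I) * (laplace1 (real (card I - 1) / 2))\<^sup>2)"
proof -
  let ?n = "card I" and ?k = "\<mu> \<Otimes>\<^sub>M \<mu>" and ?a = "real (card I - 1) / 2"
  define E where "E h = of_bool (h \<in> A) * ennreal ((1 - sd h) ^ ?n)" for h
  define F where "F h = of_bool (h \<in> A) * ennreal (exp (- (?a * sd h)))" for h
  have [measurable]: "E \<in> borel_measurable \<mu>" "F \<in> borel_measurable \<mu>"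
    unfolding E_def F_def by measurable
  interpret K: sigma_finite_measure ?k
    using pair_sigma_finite_P(4) by (simp add: pair_sigma_finite_def)
  have vm: "Measurable.pred N (\<lambda>u. void I (f u) (fst (g u)) (snd (g u)))"
    if "f \<in> measurable N (P I)" "g \<in> measurable N ?k" for N :: "'z measure" and f g
    using I that by (intro void_measurable[where K = I]) auto
  have sh: "(\<lambda>u. ennreal (prob (shell (fst (f u)) (snd (f u)) \<inter> shell (fst (g u)) (snd (g u))))) \<in> borel_measurable N"
    if [measurable]: "f \<in> measurable N ?k" "g \<in> measurable N ?k" for N :: "'z measure" and f g
  proof -
    let ?Q = "{v \<in> space (N \<Otimes>\<^sub>M \<mu>). snd v \<in> shell (fst (f (fst v))) (snd (f (fst v))) \<and>
      snd v \<in> shell (fst (g (fst v))) (snd (g (fst v)))}"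
    have "?Q \<in> sets (N \<Otimes>\<^sub>M \<mu>)"
      unfolding shell_def mem_Collect_eq by measurable
    then have "(\<lambda>u. emeasure \<mu> (Pair u -` ?Q)) \<in> borel_measurable N"
      by (rule measurable_emeasure_Pair)
    moreover have "ennreal (prob (shell (fst (f u)) (snd (f u)) \<inter> shell (fst (g u)) (snd (g u))))
        = emeasure \<mu> (Pair u -` ?Q)" if "u \<in> space N" for u
      using that by (simp add: emeasure_eq_measure[symmetric] space_pair_measure vimage_def Int_def)
    ultimately show ?thesis by (subst measurable_cong) auto
  qed
  have "(\<integral>\<^sup>+x. (void_mass I x)\<^sup>2 \<partial>P I)
      = (\<integral>\<^sup>+x. \<integral>\<^sup>+w. \<integral>\<^sup>+w'. of_bool (void I x (fst w) (snd w)) * of_bool (void I x (fst w') (snd w')) \<partial>?k \<partial>?k \<partial>P I)"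
  proof (rule nn_integral_cong)
    fix x assume x: "x \<in> space (P I)"
    have [measurable]: "Measurable.pred ?k (\<lambda>w. void I x (fst w) (snd w))"
      using x by (intro vm) auto
    show "(void_mass I x)\<^sup>2 = (\<integral>\<^sup>+w. \<integral>\<^sup>+w'. of_bool (void I x (fst w) (snd w)) * of_bool (void I x (fst w') (snd w')) \<partial>?k \<partial>?k)"
      by (simp add: void_mass_pair[OF I x] power2_eq_square nn_integral_cmult nn_integral_multc)
  qed
  also have "\<dots> = (\<integral>\<^sup>+w. \<integral>\<^sup>+x. \<integral>\<^sup>+w'. of_bool (void I x (fst w) (snd w)) * of_bool (void I x (fst w') (snd w')) \<partial>?k \<partial>P I \<partial>?k)"
  proof (rule pair_sigma_finite.Fubini'[OF pair_sigma_finite_P(5)[of I]])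
    have [measurable]: "Measurable.pred ((?k \<Otimes>\<^sub>M P I) \<Otimes>\<^sub>M ?k) (\<lambda>u. void I (snd (fst u)) (fst (snd u)) (snd (snd u)))"
      "Measurable.pred ((?k \<Otimes>\<^sub>M P I) \<Otimes>\<^sub>M ?k) (\<lambda>u. void I (snd (fst u)) (fst (fst (fst u))) (snd (fst (fst u))))"
      by (rule vm; measurable)+
    show "(\<lambda>(w, x). \<integral>\<^sup>+w'. of_bool (void I x (fst w) (snd w)) * of_bool (void I x (fst w') (snd w')) \<partial>?k)
      \<in> borel_measurable (?k \<Otimes>\<^sub>M P I)"
      unfolding split_beta' by measurable
  qed
  also have "\<dots> = (\<integral>\<^sup>+w. \<integral>\<^sup>+w'. \<integral>\<^sup>+x. of_bool (void I x (fst w) (snd w)) * of_bool (void I x (fst w') (snd w')) \<partial>P I \<partial>?k \<partial>?k)"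
  proof (intro nn_integral_cong pair_sigma_finite.Fubini'[OF pair_sigma_finite_P(5)[of I]])
    fix w assume w: "w \<in> space ?k"
    have [measurable]: "Measurable.pred (?k \<Otimes>\<^sub>M P I) (\<lambda>u. void I (snd u) (fst w) (snd w))"
      "Measurable.pred (?k \<Otimes>\<^sub>M P I) (\<lambda>u. void I (snd u) (fst (fst u)) (snd (fst u)))"
      using vm[of snd "?k \<Otimes>\<^sub>M P I" "\<lambda>_. w"] vm[of snd "?k \<Otimes>\<^sub>M P I" fst] w by auto
    show "(\<lambda>(w', x). of_bool (void I x (fst w) (snd w)) * of_bool (void I x (fst w') (snd w')))
      \<in> borel_measurable (?k \<Otimes>\<^sub>M P I)"
      unfolding split_beta' by measurable
  qed
  also have "\<dots> \<le> (\<integral>\<^sup>+w. \<integral>\<^sup>+w'. E (snd w) * E (snd w')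
      + ennreal ?n * F (snd w) * F (snd w') * ennreal (prob (shell (fst w) (snd w) \<inter> shell (fst w') (snd w'))) \<partial>?k \<partial>?k)"
    by (intro nn_integral_mono) (unfold E_def F_def, rule void_void_le[OF I])
  also have "\<dots> = (\<integral>\<^sup>+w. E (snd w) * ennreal (mean_void ?n)
      + ennreal ?n * F (snd w) * (ennreal (sd (snd w)) * ennreal (laplace1 ?a)) \<partial>?k)"
  proof (rule nn_integral_cong)
    fix w assume w: "w \<in> space ?k"
    have [measurable]: "(\<lambda>w'. ennreal (prob (shell (fst w) (snd w) \<inter> shell (fst w') (snd w')))) \<in> borel_measurable ?k"
      by (rule sh) (use w in auto)
    have [measurable]: "(\<lambda>u. ennreal (prob (shell (fst w) (snd w) \<inter> shell (snd u) (fst u)))) \<in> borel_measurable ?k"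
      using sh[of "\<lambda>_. w" ?k "\<lambda>u. (snd u, fst u)"] w by simp
    have EE: "(\<integral>\<^sup>+w'. E (snd w') \<partial>?k) = ennreal (mean_void ?n)"
    proof -
      have "(\<integral>\<^sup>+w'. E (snd w') \<partial>?k) = (\<integral>\<^sup>+p. \<integral>\<^sup>+h. E h \<partial>\<mu> \<partial>\<mu>)"
        by (subst nn_integral_fst[symmetric]) auto
      then show ?thesis by (simp add: E_def nn_mean_void emeasure_space_1[simplified])
    qed
    \<comment> \<open>For a fixed displacement the position of the second pair is integrated out,
      which is where \<open>nn_integral_shell_Int\<close> applies.\<close>
    have "(\<integral>\<^sup>+w'. F (snd w') * ennreal (prob (shell (fst w) (snd w) \<inter> shell (fst w') (snd w'))) \<partial>?k)
        = (\<integral>\<^sup>+k. \<integral>\<^sup>+q. F k * ennreal (prob (shell (fst w) (snd w) \<inter> shell q k)) \<partial>\<mu> \<partial>\<mu>)"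
      by (subst pair_sigma_finite.nn_integral_snd[OF pair_sigma_finite_P(3), symmetric]) auto
    also have "\<dots> = (\<integral>\<^sup>+k. F k * ennreal (sd (snd w) * sd k) \<partial>\<mu>)"
    proof (rule nn_integral_cong)
      fix k
      have m: "(\<lambda>q. ennreal (prob (shell (fst w) (snd w) \<inter> shell q k))) \<in> borel_measurable \<mu>"
        using sh[of "\<lambda>_. w" \<mu> "\<lambda>q. (q, k)"] w by simp
      show "(\<integral>\<^sup>+q. F k * ennreal (prob (shell (fst w) (snd w) \<inter> shell q k)) \<partial>\<mu>) = F k * ennreal (sd (snd w) * sd k)"
        by (subst nn_integral_cmult[OF m]) (simp add: nn_integral_shell_Int prob_shell)
    qed
    also have "\<dots> = (\<integral>\<^sup>+k. ennreal (sd (snd w)) * (of_bool (k \<in> A) * ennreal (sd k * exp (- (?a * sd k)))) \<partial>\<mu>)"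
      by (rule nn_integral_cong) (simp add: F_def ennreal_mult mult_ac)
    also have "\<dots> = ennreal (sd (snd w)) * ennreal (laplace1 ?a)"
      using nn_laplace1[of ?a] by (simp add: nn_integral_cmult)
    finally have FF: "(\<integral>\<^sup>+w'. F (snd w') * ennreal (prob (shell (fst w) (snd w) \<inter> shell (fst w') (snd w'))) \<partial>?k)
        = ennreal (sd (snd w)) * ennreal (laplace1 ?a)" .
    show "(\<integral>\<^sup>+w'. E (snd w) * E (snd w')
      + ennreal ?n * F (snd w) * F (snd w') * ennreal (prob (shell (fst w) (snd w) \<inter> shell (fst w') (snd w'))) \<partial>?k)
      = E (snd w) * ennreal (mean_void ?n) + ennreal ?n * F (snd w) * (ennreal (sd (snd w)) * ennreal (laplace1 ?a))"
      unfolding EE[symmetric] FF[symmetric]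
      by (subst nn_integral_add) (auto simp: nn_integral_cmult[symmetric] mult.assoc)
  qed
  also have "\<dots> = ennreal (mean_void ?n) * ennreal (mean_void ?n) + ennreal ?n * ennreal (laplace1 ?a) * ennreal (laplace1 ?a)"
  proof -
    have "(\<integral>\<^sup>+w. E (snd w) * ennreal (mean_void ?n)
        + ennreal ?n * F (snd w) * (ennreal (sd (snd w)) * ennreal (laplace1 ?a)) \<partial>?k)
      = (\<integral>\<^sup>+p. \<integral>\<^sup>+h. E h * ennreal (mean_void ?n) + ennreal ?n * F h * (ennreal (sd h) * ennreal (laplace1 ?a)) \<partial>\<mu> \<partial>\<mu>)"
      by (subst nn_integral_fst[symmetric]) auto
    also have "\<dots> = (\<integral>\<^sup>+h. E h * ennreal (mean_void ?n) + (ennreal ?n * ennreal (laplace1 ?a)) * (of_bool (h \<in> A) * ennreal (sd h * exp (- (?a * sd h)))) \<partial>\<mu>)"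
      by (simp add: emeasure_space_1[simplified] F_def ennreal_mult mult_ac)
    also have "\<dots> = (\<integral>\<^sup>+h. E h \<partial>\<mu>) * ennreal (mean_void ?n) + (ennreal ?n * ennreal (laplace1 ?a)) * ennreal (laplace1 ?a)"
      using nn_laplace1[of ?a]
      by (subst nn_integral_add) (auto simp: nn_integral_cmult nn_integral_multc)
    finally show ?thesis by (simp add: E_def nn_mean_void)
  qed
  also have "\<dots> = ennreal ((mean_void (card I))\<^sup>2 + real (card I) * (laplace1 (real (card I - 1) / 2))\<^sup>2)"
    by (simp add: power2_eq_square ennreal_mult ennreal_plus mean_void_nonneg laplace1_nonneg mult_ac)
  finally show ?thesis .
qed

section \<open>Probabilities of twins, disturbances and their joint occurrence\<close>

lemma measure_nn_of_bool:
  assumes N: "prob_space N" and [measurable]: "Measurable.pred N Q"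
  shows "(\<integral>\<^sup>+x. of_bool (Q x) \<partial>N) = ennreal (measure N {x \<in> space N. Q x})"
proof -
  interpret N: prob_space N by (rule N)
  have "(\<integral>\<^sup>+x. of_bool (Q x) \<partial>N) = (\<integral>\<^sup>+x. indicator {x \<in> space N. Q x} x \<partial>N)"
    by (rule nn_integral_cong) (auto split: split_indicator)
  then show ?thesis by (simp add: N.emeasure_eq_measure)
qed

abbreviation pr :: "'i set \<Rightarrow> (('i \<Rightarrow> 'g) \<Rightarrow> bool) \<Rightarrow> real" where
  "pr J Q \<equiv> measure (P J) {x \<in> space (P J). Q x}"

lemma pr_nn: "Measurable.pred (P J) Q \<Longrightarrow> (\<integral>\<^sup>+x. of_bool (Q x) \<partial>P J) = ennreal (pr J Q)"
  by (rule measure_nn_of_bool[OF prob_space_P])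

lemma pr_expectation:
  assumes [measurable]: "Measurable.pred (P J) Q"
  shows "pr J Q = (LINT x|P J. of_bool (Q x))"
proof -
  have "(LINT x|P J. of_bool (Q x)) = (LINT x|P J. indicator {x \<in> space (P J). Q x} x)"
    by (rule Bochner_Integration.integral_cong) (auto split: split_indicator)
  also have "\<dots> = measure (P J) ({x \<in> space (P J). Q x} \<inter> space (P J))"
    by (rule Bochner_Integration.integral_indicator)
  also have "{x \<in> space (P J). Q x} \<inter> space (P J) = {x \<in> space (P J). Q x}" by auto
  finally show ?thesis ..
qed

lemma pr_marginal:
  assumes J: "finite J" "a \<notin> J" and [measurable]: "Measurable.pred (P J) Q" "Measurable.pred (P (insert a J)) Q"
    and upd: "\<And>x y. Q (x(a := y)) \<longleftrightarrow> Q x"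
  shows "pr (insert a J) Q = pr J Q"
proof -
  have "ennreal (pr (insert a J) Q) = (\<integral>\<^sup>+x. of_bool (Q x) \<partial>P (insert a J))" by (simp add: pr_nn)
  also have "\<dots> = (\<integral>\<^sup>+x. of_bool (Q x) \<partial>P J)"
    using J by (subst nn_integral_P_insert) (auto simp: upd emeasure_space_1[simplified])
  also have "\<dots> = ennreal (pr J Q)" by (simp add: pr_nn)
  finally show ?thesis by simp
qed

lemma pr_closed_twins:
  assumes J: "finite J" "i \<in> J" "j \<in> J" "i \<noteq> j"
  shows "pr J (\<lambda>x. closed_twins A J x i j) = mean_void (card J - 2)"
proof -
  define I where "I = J - {i, j}"
  have JI: "J = insert j (insert i I)" and I: "finite I" "i \<notin> I" "j \<notin> I"
    using J by (auto simp: I_def)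
  have card: "card I = card J - 2"
    using J by (simp add: I_def card_Diff_subset)
  have [measurable]: "Measurable.pred (P J) (\<lambda>x. closed_twins A J x i j)"
    using J by (intro closed_twins_measurable) auto
  have "ennreal (pr J (\<lambda>x. closed_twins A J x i j)) = (\<integral>\<^sup>+x. of_bool (closed_twins A J x i j) \<partial>P J)"
    by (simp add: pr_nn)
  also have "\<dots> = (\<integral>\<^sup>+x. void_mass I x \<partial>P I)"
    using nn_integral_closed_twins[OF I J(4), of "\<lambda>_. True" "\<lambda>_. True"] by (simp add: JI)
  also have "\<dots> = ennreal (mean_void (card J - 2))"
    by (simp add: nn_integral_void_mass I card)
  finally show ?thesis by (simp add: mean_void_nonneg)
qed

text \<open>A union bound over both kinds of disturbance. For an old pair, being separated by
  \<open>a\<close> is a difference of nested events, whence the difference of two consecutive values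
  of \<open>mean_void\<close>; the ordered pairs are counted generously by the square.\<close>

lemma pr_disturbs_le:
  assumes J: "finite J" "a \<notin> J"
  shows "pr (insert a J) (disturbs A J a) \<le> real (card J) * mean_void (card J - 1)
    + (real (card J))\<^sup>2 * (mean_void (card J - 2) - mean_void (card J - 1))"
proof -
  let ?K = "insert a J" and ?n = "card J"
  interpret K: prob_space "P ?K" by (rule prob_space_P)
  have cK: "card ?K = Suc ?n" using J by simp
  have m1: "Measurable.pred (P ?K) (\<lambda>x. closed_twins A ?K x i j)" if "i \<in> ?K" "j \<in> ?K" for i j
    using that J by (intro closed_twins_measurable) auto
  have m2: "Measurable.pred (P L) (\<lambda>x. closed_twins A J x i j)" if "i \<in> J" "j \<in> J" "L = J \<or> L = ?K" for i j L
    using that J by (intro closed_twins_measurable) auto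
  define E1 where "E1 j = {x \<in> space (P ?K). closed_twins A ?K x a j}" for j
  define E2 where "E2 ij = {x \<in> space (P ?K). closed_twins A J x (fst ij) (snd ij)} -
    {x \<in> space (P ?K). closed_twins A ?K x (fst ij) (snd ij)}" for ij
  let ?R = "Sigma J (\<lambda>i. J - {i})"
  have E1s: "E1 j \<in> sets (P ?K)" if "j \<in> J" for j
    using m1[of a j] that by (simp add: E1_def pred_def)
  have E2s: "E2 ij \<in> sets (P ?K)" if "ij \<in> ?R" for ij
    using m1[of "fst ij" "snd ij"] m2[of "fst ij" "snd ij" ?K] that by (auto simp: E2_def pred_def)
  have E1p: "K.prob (E1 j) = mean_void (?n - 1)" if "j \<in> J" for j
    using pr_closed_twins[of ?K a j] J that cK unfolding E1_def by auto
  have E2p: "K.prob (E2 ij) = mean_void (?n - 2) - mean_void (?n - 1)" if ij: "ij \<in> ?R" for ij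
  proof -
    obtain i j where [simp]: "ij = (i, j)" and i: "i \<in> J" "j \<in> J" "i \<noteq> j" using ij by auto
    have "K.prob (E2 ij) = K.prob {x \<in> space (P ?K). closed_twins A J x i j} - K.prob {x \<in> space (P ?K). closed_twins A ?K x i j}"
      unfolding E2_def using m1[of i j] m2[of i j ?K] i
      by (subst K.finite_measure_Diff) (auto simp: pred_def dest: closed_twins_mono[of A ?K _ _ _ J])
    also have "K.prob {x \<in> space (P ?K). closed_twins A J x i j} = pr J (\<lambda>x. closed_twins A J x i j)"
    proof (intro pr_marginal m2)
      show "closed_twins A J (x(a := y)) i j \<longleftrightarrow> closed_twins A J x i j" for x y
        using i J by (intro closed_twins_cong) auto
    qed (use i J in auto)
    finally show ?thesis
      using pr_closed_twins[of J i j] pr_closed_twins[of ?K i j] i J cK by simp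
  qed
  have "pr ?K (disturbs A J a) \<le> K.prob ((\<Union>j\<in>J. E1 j) \<union> (\<Union>ij\<in>?R. E2 ij))"
  proof (rule K.finite_measure_mono)
    show "(\<Union>j\<in>J. E1 j) \<union> (\<Union>ij\<in>?R. E2 ij) \<in> sets (P ?K)"
      using J E1s E2s by (intro sets.Un sets.finite_UN) auto
  qed (auto simp: disturbs_def E1_def E2_def)
  also have "\<dots> \<le> K.prob (\<Union>j\<in>J. E1 j) + K.prob (\<Union>ij\<in>?R. E2 ij)"
    using J E1s E2s by (intro measure_Un_le sets.finite_UN) auto
  also have "\<dots> \<le> (\<Sum>j\<in>J. K.prob (E1 j)) + (\<Sum>ij\<in>?R. K.prob (E2 ij))"
    using J E1s E2s by (intro add_mono K.finite_measure_subadditive_finite) auto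
  also have "\<dots> = real ?n * mean_void (?n - 1) + real (card ?R) * (mean_void (?n - 2) - mean_void (?n - 1))"
    using E1p E2p by simp
  also have "real (card ?R) * (mean_void (?n - 2) - mean_void (?n - 1)) \<le> (real ?n)\<^sup>2 * (mean_void (?n - 2) - mean_void (?n - 1))"
  proof (cases "?R = {}")
    case True
    have "mean_void (?n - 1) \<le> mean_void (?n - 2)"
      unfolding mean_void_def
      by (intro integral_mono integrable_mean_void) (auto intro!: power_decreasing simp: of_bool_def)
    then show ?thesis using True by simp
  next
    case False
    then obtain ij where ij: "ij \<in> ?R" by auto
    have "0 \<le> mean_void (?n - 2) - mean_void (?n - 1)" using E2p[OF ij] by (metis measure_nonneg)
    moreover have "card ?R \<le> card (J \<times> J)" using J by (intro card_mono) auto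
    then have "real (card ?R) \<le> (real ?n)\<^sup>2"
      by (simp add: card_cartesian_product power2_eq_square flip: of_nat_mult)
    ultimately show ?thesis by (intro mult_right_mono)
  qed
  finally show ?thesis by simp
qed

lemma void_mass_le_1: "void_mass I x \<le> 1"
proof -
  have "void_mass I x \<le> (\<integral>\<^sup>+p. \<integral>\<^sup>+h. 1 \<partial>\<mu> \<partial>\<mu>)"
    unfolding void_mass_def by (intro nn_integral_mono) auto
  then show ?thesis by (simp add: emeasure_space_1[simplified])
qed

text \<open>Given the points in \<open>I\<close>, the twin event has probability
  \<open>void_mass I\<close> while \<open>Q\<close> is determined. The error is thus the mean of the
  centred conditional probability on \<open>Q\<close>, which is at most its standard
  deviation.\<close>

lemma pr_twins_decouple:
  assumes I: "finite I" "a \<notin> I" "b \<notin> I" "a \<noteq> b"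
    and Qm: "Measurable.pred (P (insert b (insert a I))) Q" and QI[measurable]: "Measurable.pred (P I) Q"
    and upd: "\<And>x y z. Q (x(a := y, b := z)) \<longleftrightarrow> Q x"
  shows "\<bar>pr (insert b (insert a I)) (\<lambda>x. closed_twins A (insert b (insert a I)) x a b \<and> Q x)
      - mean_void (card I) * pr I Q\<bar> \<le> sqrt (real (card I)) * laplace1 (real (card I - 1) / 2)"
proof -
  let ?J = "insert b (insert a I)" and ?e = "mean_void (card I)" and ?g = "laplace1 (real (card I - 1) / 2)"
  interpret I: prob_space "P I" by (rule prob_space_P)
  define V where "V x = enn2real (void_mass I x)" for x
  have eV: "void_mass I x = ennreal (V x)" for x
    unfolding V_def using le_less_trans[OF void_mass_le_1[of I x] ennreal_one_less_top]
    by (simp add: ennreal_enn2real)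
  have V01: "0 \<le> V x" "V x \<le> 1" for x
    using void_mass_le_1[of I x] unfolding eV by (auto simp: V_def)
  have [measurable]: "V \<in> borel_measurable (P I)"
    unfolding V_def using I by measurable
  \<comment> \<open>A convenient common bound: the functions to which this is applied are at most 1
    in absolute value.\<close>
  have bdd: "integrable (P I) f" if "f \<in> borel_measurable (P I)" "\<And>x. \<bar>f x\<bar> \<le> 4" for f :: "_ \<Rightarrow> real"
    using that by (intro I.integrable_const_bound[where B = 4]) auto
  have e01: "0 \<le> ?e" "?e \<le> 1"
  proof -
    have "?e \<le> (LINT h|\<mu>. 1)" unfolding mean_void_def
      by (intro integral_mono integrable_mean_void) (auto intro!: power_le_one simp: of_bool_def)
    then show "?e \<le> 1" by (simp add: prob_space[simplified])
  qed (rule mean_void_nonneg)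
  have intV: "integrable (P I) V"
  proof (rule bdd)
    show "\<bar>V x\<bar> \<le> 4" for x using V01[of x] by auto
  qed measurable
  have V2le: "(V x)\<^sup>2 \<le> 1" for x using V01[of x] by (simp add: power_le_one)
  have intV2: "integrable (P I) (\<lambda>x. (V x)\<^sup>2)"
    by (rule bdd) (use V2le in \<open>auto simp: order_trans[OF V2le]\<close>)
  have EV: "I.expectation V = ?e"
  proof -
    have "ennreal (I.expectation V) = (\<integral>\<^sup>+x. ennreal (V x) \<partial>P I)"
      using V01 by (intro nn_integral_eq_integral[symmetric] intV) auto
    also have "\<dots> = ennreal ?e" using nn_integral_void_mass[OF I(1)] by (simp add: eV)
    finally show ?thesis using V01 e01 by (simp add: integral_nonneg_AE)
  qed
  have EV2: "I.expectation (\<lambda>x. (V x)\<^sup>2) \<le> ?e\<^sup>2 + real (card I) * ?g\<^sup>2"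
  proof -
    have "ennreal (I.expectation (\<lambda>x. (V x)\<^sup>2)) = (\<integral>\<^sup>+x. ennreal ((V x)\<^sup>2) \<partial>P I)"
      by (intro nn_integral_eq_integral[symmetric] intV2) auto
    also have "\<dots> \<le> ennreal (?e\<^sup>2 + real (card I) * ?g\<^sup>2)"
      using nn_integral_void_mass_square[OF I(1)] V01 by (simp add: eV ennreal_power)
    finally show ?thesis by (subst (asm) ennreal_le_iff) auto
  qed
  define X where "X x = of_bool (Q x) * (V x - ?e)" for x
  have X1: "\<bar>X x\<bar> \<le> 1" for x using V01[of x] e01 by (auto simp: X_def abs_if)
  have [measurable]: "X \<in> borel_measurable (P I)" unfolding X_def by measurable
  have intX: "integrable (P I) X" by (rule bdd) (auto intro: order_trans[OF X1])
  have X2: "(X x)\<^sup>2 \<le> 1" for x using X1[of x] by (simp add: abs_square_le_1)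
  have intX2: "integrable (P I) (\<lambda>x. (X x)\<^sup>2)" by (rule bdd) (auto intro: order_trans[OF X2])
  have EX: "I.expectation X = pr ?J (\<lambda>x. closed_twins A ?J x a b \<and> Q x) - ?e * pr I Q"
  proof -
    have intQV: "integrable (P I) (\<lambda>x. of_bool (Q x) * V x)"
    proof (rule bdd)
      show "\<bar>of_bool (Q x) * V x\<bar> \<le> 4" for x using V01[of x] by auto
    qed measurable
    have intQ: "integrable (P I) (\<lambda>x. of_bool (Q x) * ?e)"
      by (rule bdd) (use e01 in auto)
    have [measurable]: "Measurable.pred (P ?J) (\<lambda>x. closed_twins A ?J x a b)"
      using I by (intro closed_twins_measurable) auto
    note Qm[measurable]
    have "ennreal (pr ?J (\<lambda>x. closed_twins A ?J x a b \<and> Q x)) = (\<integral>\<^sup>+x. of_bool (Q x) * void_mass I x \<partial>P I)"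
      by (subst nn_integral_closed_twins[OF I Qm, symmetric]) (auto simp: upd pr_nn)
    also have "\<dots> = (\<integral>\<^sup>+x. ennreal (of_bool (Q x) * V x) \<partial>P I)"
      by (rule nn_integral_cong) (auto simp: eV)
    also have "\<dots> = ennreal (I.expectation (\<lambda>x. of_bool (Q x) * V x))"
      using V01 by (intro nn_integral_eq_integral intQV) auto
    finally have eq: "ennreal (pr ?J (\<lambda>x. closed_twins A ?J x a b \<and> Q x)) = ennreal (I.expectation (\<lambda>x. of_bool (Q x) * V x))" .
    have nonneg: "0 \<le> I.expectation (\<lambda>x. of_bool (Q x) * V x)"
      by (intro integral_nonneg_AE AE_I2) (simp add: V01)
    have 1: "I.expectation (\<lambda>x. of_bool (Q x) * V x) = pr ?J (\<lambda>x. closed_twins A ?J x a b \<and> Q x)"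
      by (rule sym, rule iffD1[OF ennreal_inj[OF measure_nonneg nonneg] eq])
    have 2: "I.expectation (\<lambda>x. of_bool (Q x)) = pr I Q"
      by (rule pr_expectation[OF QI, symmetric])
    have 3: "I.expectation (\<lambda>x. of_bool (Q x) * ?e) = ?e * pr I Q"
      using 2 by (simp add: mult.commute)
    show ?thesis
      unfolding X_def right_diff_distrib
      by (subst Bochner_Integration.integral_diff[OF intQV intQ]) (simp only: 1 3)
  qed
  have "(I.expectation X)\<^sup>2 \<le> I.expectation (\<lambda>x. (X x)\<^sup>2)"
    using I.variance_positive[of X] I.variance_eq[OF intX intX2] by simp
  also have "\<dots> \<le> I.expectation (\<lambda>x. (V x - ?e)\<^sup>2)"
  proof (rule integral_mono[OF intX2])
    show "integrable (P I) (\<lambda>x. (V x - ?e)\<^sup>2)"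
    proof (rule bdd)
      fix x have "\<bar>V x - ?e\<bar> \<le> 1" using V01[of x] e01 by auto
      then have "(V x - ?e)\<^sup>2 \<le> 1" by (simp add: abs_square_le_1)
      then show "\<bar>(V x - ?e)\<^sup>2\<bar> \<le> 4" by simp
    qed measurable
  qed (auto simp: X_def)
  also have "\<dots> = I.expectation (\<lambda>x. (V x)\<^sup>2) - ?e\<^sup>2"
    using I.variance_eq[OF intV intV2] by (simp add: EV)
  also have "\<dots> \<le> real (card I) * ?g\<^sup>2" using EV2 by simp
  finally have "\<bar>I.expectation X\<bar> \<le> sqrt (real (card I) * ?g\<^sup>2)"
    using real_sqrt_le_mono by fastforce
  then show ?thesis unfolding EX by (simp add: real_sqrt_mult laplace1_nonneg)
qed

text \<open>The disturbance does not involve \<open>b\<close>. With all other points fixed,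
  \<open>b\<close> contributes the measure \<open>U\<close> of admissible displacements, and
  Cauchy-Schwarz separates \<open>U\<close> from the indicator of the disturbance. The second moment
  of \<open>U\<close> concerns two shells at the same position \<open>p\<close>, whose joint void
  probability again decays at half rate in each.\<close>

lemma pr_twins_disturbs_le:
  assumes I: "finite I" "a \<notin> I" "b \<notin> I" "a \<noteq> b"
  shows "pr (insert b (insert a I)) (\<lambda>x. closed_twins A (insert b (insert a I)) x a b \<and> disturbs A I a x)
    \<le> laplace (real (card I) / 2) * sqrt (pr (insert a I) (disturbs A I a))"
proof -
  let ?J = "insert b (insert a I)" and ?K = "insert a I" and ?n = "card I" and ?l = "laplace (real (card I) / 2)"
  have [measurable]: "Measurable.pred (P ?J) (\<lambda>x. closed_twins A ?J x a b)"
    using I by (intro closed_twins_measurable) auto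
  have [measurable]: "Measurable.pred (P ?J) (disturbs A I a)" "Measurable.pred (P ?K) (disturbs A I a)"
    using I by (intro disturbs_measurable; auto)+
  have vm: "Measurable.pred N (\<lambda>u. void I (f u) (g u) (h u))"
    if "f \<in> measurable N (P I)" "g \<in> measurable N \<mu>" "h \<in> measurable N \<mu>" for N :: "'z measure" and f g h
    using I that by (intro void_measurable[where K = I]) auto
  have vK: "Measurable.pred N (\<lambda>u. void I (f u) (g u) (h u))"
    if "f \<in> measurable N (P ?K)" "g \<in> measurable N \<mu>" "h \<in> measurable N \<mu>" for N :: "'z measure" and f g h
    using I that by (intro void_measurable[where K = ?K]) auto
  define U where "U x = (\<integral>\<^sup>+h. of_bool (void I x (x a) h) \<partial>\<mu>)" for x
  have [measurable]: "U \<in> borel_measurable (P ?K)"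
    unfolding U_def
  proof (rule borel_measurable_nn_integral)
    have [measurable]: "Measurable.pred (P ?K \<Otimes>\<^sub>M \<mu>) (\<lambda>u. void I (fst u) (fst u a) (snd u))"
      by (rule vK) (auto intro!: measurable_compose[OF measurable_fst measurable_component_singleton])
    show "(\<lambda>(x, h). of_bool (void I x (x a) h)) \<in> borel_measurable (P ?K \<Otimes>\<^sub>M \<mu>)"
      unfolding split_beta' by measurable
  qed
  have 1: "ennreal (pr ?J (\<lambda>x. closed_twins A ?J x a b \<and> disturbs A I a x)) = (\<integral>\<^sup>+x. U x * of_bool (disturbs A I a x) \<partial>P ?K)"
  proof -
    have "ennreal (pr ?J (\<lambda>x. closed_twins A ?J x a b \<and> disturbs A I a x))
        = (\<integral>\<^sup>+x. of_bool (closed_twins A ?J x a b \<and> disturbs A I a x) \<partial>P ?J)"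
      by (simp add: pr_nn)
    also have "\<dots> = (\<integral>\<^sup>+x. \<integral>\<^sup>+h. of_bool (closed_twins A ?J (x(b := x a + h)) a b \<and> disturbs A I a (x(b := x a + h))) \<partial>\<mu> \<partial>P ?K)"
      using I by (subst nn_integral_P_insert2) auto
    also have "\<dots> = (\<integral>\<^sup>+x. U x * of_bool (disturbs A I a x) \<partial>P ?K)"
    proof (rule nn_integral_cong)
      fix x assume x: "x \<in> space (P ?K)"
      have [measurable]: "Measurable.pred \<mu> (\<lambda>h. void I x (x a) h)"
        using x by (intro vK) auto
      have "disturbs A I a (x(b := y)) = disturbs A I a x" for y
        using I by (intro disturbs_cong) auto
      moreover have "closed_twins A ?J (x(b := x a + h)) a b = void I x (x a) h" for h
        using closed_twins_void'[of b ?K a x h] I by (simp add: insert_absorb)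
      ultimately show "(\<integral>\<^sup>+h. of_bool (closed_twins A ?J (x(b := x a + h)) a b \<and> disturbs A I a (x(b := x a + h))) \<partial>\<mu>)
          = U x * of_bool (disturbs A I a x)"
        by (simp add: U_def of_bool_conj nn_integral_multc)
    qed
    finally show ?thesis .
  qed
  have 2: "(\<integral>\<^sup>+x. (U x)\<^sup>2 \<partial>P ?K) \<le> ennreal (?l\<^sup>2)"
  proof -
    define F where "F h = of_bool (h \<in> A) * ennreal (exp (- (real ?n / 2 * sd h)))" for h
    have [measurable]: "F \<in> borel_measurable \<mu>" unfolding F_def by measurable
    have Fl: "(\<integral>\<^sup>+h. F h \<partial>\<mu>) = ennreal ?l"
      unfolding F_def by (rule nn_laplace) simp
    have "(\<integral>\<^sup>+x. (U x)\<^sup>2 \<partial>P ?K) = (\<integral>\<^sup>+p. \<integral>\<^sup>+x. (U (x(a := p)))\<^sup>2 \<partial>P I \<partial>\<mu>)"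
      using I by (subst PP.product_nn_integral_insert_rev) auto
    also have "\<dots> = (\<integral>\<^sup>+p. \<integral>\<^sup>+x. (\<integral>\<^sup>+h. of_bool (void I x p h) \<partial>\<mu>)\<^sup>2 \<partial>P I \<partial>\<mu>)"
    proof -
      have "void I (x(a := p)) p h = void I x p h" for x p h using I(2) by (auto simp: void_def)
      then show ?thesis by (simp add: U_def)
    qed
    also have "\<dots> \<le> (\<integral>\<^sup>+p. (ennreal ?l)\<^sup>2 \<partial>\<mu>)"
    proof (rule nn_integral_mono)
      fix p
      have [measurable]: "Measurable.pred \<mu> (\<lambda>h. void I x p h)" if "x \<in> space (P I)" for x
        using that by (intro vm) auto
      have [measurable]: "Measurable.pred (\<mu> \<Otimes>\<^sub>M P I) (\<lambda>u. void I (snd u) p (fst u))"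
        by (rule vm) auto
      have [measurable]: "Measurable.pred ((\<mu> \<Otimes>\<^sub>M P I) \<Otimes>\<^sub>M \<mu>) (\<lambda>u. void I (snd (fst u)) p (snd u))"
        "Measurable.pred ((\<mu> \<Otimes>\<^sub>M P I) \<Otimes>\<^sub>M \<mu>) (\<lambda>u. void I (snd (fst u)) p (fst (fst u)))"
        by (rule vm; measurable)+
      have "(\<integral>\<^sup>+x. (\<integral>\<^sup>+h. of_bool (void I x p h) \<partial>\<mu>)\<^sup>2 \<partial>P I)
          = (\<integral>\<^sup>+x. \<integral>\<^sup>+h. \<integral>\<^sup>+k. of_bool (void I x p h) * of_bool (void I x p k) \<partial>\<mu> \<partial>\<mu> \<partial>P I)"
        by (rule nn_integral_cong) (simp add: power2_eq_square nn_integral_cmult nn_integral_multc)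
      also have "\<dots> = (\<integral>\<^sup>+h. \<integral>\<^sup>+x. \<integral>\<^sup>+k. of_bool (void I x p h) * of_bool (void I x p k) \<partial>\<mu> \<partial>P I \<partial>\<mu>)"
      proof (rule pair_sigma_finite.Fubini'[OF pair_sigma_finite_P(2)])
        show "(\<lambda>(h, x). \<integral>\<^sup>+k. of_bool (void I x p h) * of_bool (void I x p k) \<partial>\<mu>) \<in> borel_measurable (\<mu> \<Otimes>\<^sub>M P I)"
          unfolding split_beta' by measurable
      qed
      also have "\<dots> = (\<integral>\<^sup>+h. \<integral>\<^sup>+k. \<integral>\<^sup>+x. of_bool (void I x p h) * of_bool (void I x p k) \<partial>P I \<partial>\<mu> \<partial>\<mu>)"
      proof (intro nn_integral_cong pair_sigma_finite.Fubini'[OF pair_sigma_finite_P(2)])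
        fix h
        have [measurable]: "Measurable.pred (\<mu> \<Otimes>\<^sub>M P I) (\<lambda>u. void I (snd u) p h)"
          by (rule vm) auto
        show "(\<lambda>(k, x). of_bool (void I x p h) * of_bool (void I x p k)) \<in> borel_measurable (\<mu> \<Otimes>\<^sub>M P I)"
          unfolding split_beta' by measurable
      qed
      also have "\<dots> \<le> (\<integral>\<^sup>+h. \<integral>\<^sup>+k. F h * F k \<partial>\<mu> \<partial>\<mu>)"
      proof (intro nn_integral_mono)
        fix h k
        let ?u = "prob (shell p h \<union> shell p k)"
        have le: "sd h \<le> ?u" "sd k \<le> ?u"
          using finite_measure_mono[of "shell p h" "shell p h \<union> shell p k"]
            finite_measure_mono[of "shell p k" "shell p h \<union> shell p k"] by (auto simp: prob_shell)
        have "(1 - ?u) ^ ?n \<le> exp (- (real ?n * ?u))" by (rule one_minus_power_le_exp) auto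
        also have "\<dots> \<le> exp (- (real ?n / 2 * sd h) + - (real ?n / 2 * sd k))"
        proof -
          \<comment> \<open>The union measures at least the mean of the two shells, so the bound
            factorises over \<open>h\<close> and \<open>k\<close>.\<close>
          have "real ?n * ((sd h + sd k) / 2) \<le> real ?n * ?u"
            using le by (intro mult_left_mono) auto
          then show ?thesis by (simp add: algebra_simps)
        qed
        finally have "ennreal ((1 - ?u) ^ ?n) \<le> ennreal (exp (- (real ?n / 2 * sd h)) * exp (- (real ?n / 2 * sd k)))"
          by (intro ennreal_leI) (simp only: exp_add)
        then show "(\<integral>\<^sup>+x. of_bool (void I x p h) * of_bool (void I x p k) \<partial>P I) \<le> F h * F k"
          unfolding emeasure_void_void[OF I(1)] F_def
          by (cases "h \<in> A"; cases "k \<in> A") (auto simp: ennreal_mult)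
      qed
      also have "\<dots> = (ennreal ?l)\<^sup>2"
        by (simp add: nn_integral_cmult nn_integral_multc Fl power2_eq_square)
      finally show "(\<integral>\<^sup>+x. (\<integral>\<^sup>+h. of_bool (void I x p h) \<partial>\<mu>)\<^sup>2 \<partial>P I) \<le> (ennreal ?l)\<^sup>2" .
    qed
    also have "\<dots> = ennreal (?l\<^sup>2)"
      by (simp add: emeasure_space_1[simplified] ennreal_power laplace_nonneg)
    finally show ?thesis .
  qed
  have "ennreal ((pr ?J (\<lambda>x. closed_twins A ?J x a b \<and> disturbs A I a x))\<^sup>2)
      = (\<integral>\<^sup>+x. U x * of_bool (disturbs A I a x) \<partial>P ?K)\<^sup>2"
    by (simp add: 1[symmetric] ennreal_power)
  also have "\<dots> \<le> (\<integral>\<^sup>+x. (U x)\<^sup>2 \<partial>P ?K) * (\<integral>\<^sup>+x. (of_bool (disturbs A I a x))\<^sup>2 \<partial>P ?K)"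
    by (rule Cauchy_Schwarz_nn_integral) measurable
  also have "(\<integral>\<^sup>+x. (of_bool (disturbs A I a x))\<^sup>2 \<partial>P ?K) = ennreal (pr ?K (disturbs A I a))"
    by (subst pr_nn[symmetric]) (auto intro!: nn_integral_cong)
  also have "(\<integral>\<^sup>+x. (U x)\<^sup>2 \<partial>P ?K) * ennreal (pr ?K (disturbs A I a)) \<le> ennreal (?l\<^sup>2) * ennreal (pr ?K (disturbs A I a))"
    by (intro mult_right_mono 2) simp
  also have "\<dots> = ennreal (?l\<^sup>2 * pr ?K (disturbs A I a))"
    by (simp add: ennreal_mult)
  finally have "(pr ?J (\<lambda>x. closed_twins A ?J x a b \<and> disturbs A I a x))\<^sup>2 \<le> ?l\<^sup>2 * pr ?K (disturbs A I a)"
    by (subst (asm) ennreal_le_iff) auto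
  then have "pr ?J (\<lambda>x. closed_twins A ?J x a b \<and> disturbs A I a x) \<le> sqrt (?l\<^sup>2 * pr ?K (disturbs A I a))"
    by (rule real_le_rsqrt)
  then show ?thesis by (simp add: real_sqrt_mult laplace_nonneg)
qed

section \<open>The recursion for the law of the count and its error terms\<close>

definition disturb_bound :: "nat \<Rightarrow> real" where
  "disturb_bound n = real n * mean_void (n - 1) + (real n)\<^sup>2 * (mean_void (n - 2) - mean_void (n - 1))"

lemma pr_disturbs_bound: "finite J \<Longrightarrow> a \<notin> J \<Longrightarrow> pr (insert a J) (disturbs A J a) \<le> disturb_bound (card J)"
  unfolding disturb_bound_def by (rule pr_disturbs_le)

lemma twin_pairs_upd: "a \<notin> J \<Longrightarrow> twin_pairs A J (x(a := y)) = twin_pairs A J x"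
  by (intro twin_pairs_cong) auto

lemma count_eq_measurable:
  assumes "finite J" "J \<subseteq> K"
  shows "Measurable.pred (P K) (\<lambda>x. card (twin_pairs A J x) = k)"
proof -
  note card_twin_pairs_measurable[OF assms, measurable]
  show ?thesis by measurable
qed

lemma pr_diff_le:
  assumes [measurable]: "Measurable.pred (P J) Q" "Measurable.pred (P J) R" "Measurable.pred (P J) S"
    and QR: "\<And>x. \<not> S x \<Longrightarrow> Q x \<longleftrightarrow> R x"
  shows "\<bar>pr J Q - pr J R\<bar> \<le> pr J S"
proof -
  interpret J: prob_space "P J" by (rule prob_space_P)
  have le: "pr J Q \<le> pr J R + pr J S"
    if "\<And>x. \<not> S x \<Longrightarrow> Q x \<Longrightarrow> R x" and [measurable]: "Measurable.pred (P J) Q" "Measurable.pred (P J) R" for Q R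
  proof -
    have "pr J Q \<le> J.prob ({x \<in> space (P J). R x} \<union> {x \<in> space (P J). S x})"
      using that by (intro J.finite_measure_mono) auto
    also have "\<dots> \<le> pr J R + pr J S" by (rule measure_Un_le) auto
    finally show ?thesis .
  qed
  show ?thesis using le[of Q R] le[of R Q] QR by (auto simp: abs_le_iff)
qed

text \<open>Used to return from the law over the points other than a twin pair to the law over all
  points.\<close>

lemma pr_add_point:
  assumes J: "finite J" "a \<notin> J"
  shows "\<bar>pr J (\<lambda>x. card (twin_pairs A J x) = k) - pr (insert a J) (\<lambda>x. card (twin_pairs A (insert a J) x) = k)\<bar>
    \<le> disturb_bound (card J)"
proof -
  have "pr J (\<lambda>x. card (twin_pairs A J x) = k) = pr (insert a J) (\<lambda>x. card (twin_pairs A J x) = k)"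
    using J by (intro pr_marginal[symmetric] count_eq_measurable) (auto simp: twin_pairs_upd)
  also have "\<bar>\<dots> - pr (insert a J) (\<lambda>x. card (twin_pairs A (insert a J) x) = k)\<bar> \<le> pr (insert a J) (disturbs A J a)"
    using J by (intro pr_diff_le count_eq_measurable disturbs_measurable) (auto simp: twin_pairs_undisturbed)
  also have "\<dots> \<le> disturb_bound (card J)" using J by (rule pr_disturbs_bound)
  finally show ?thesis .
qed

text \<open>The source of the recursion, a size-biasing identity: where the count equals
  \<open>k\<close>, the indicators of ordered twin pairs sum to \<open>2 * k\<close>. Expectations
  are then taken.\<close>

lemma pr_count_Suc:
  assumes J: "finite J"
  shows "2 * (real k * pr J (\<lambda>x. card (twin_pairs A J x) = k))
    = (\<Sum>a\<in>J. \<Sum>b\<in>J - {a}. pr J (\<lambda>x. closed_twins A J x a b \<and> card (twin_pairs A J x) = k))"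
proof -
  interpret J: prob_space "P J" by (rule prob_space_P)
  note count_eq_measurable[OF J order_refl, measurable]
  have ct: "Measurable.pred (P J) (\<lambda>x. closed_twins A J x a b)" if "a \<in> J" "b \<in> J" for a b
    using that J by (intro closed_twins_measurable) auto
  have m: "Measurable.pred (P J) (\<lambda>x. closed_twins A J x a b \<and> card (twin_pairs A J x) = k)" if "a \<in> J" "b \<in> J" for a b
    using ct[OF that] by measurable
  have "2 * (real k * pr J (\<lambda>x. card (twin_pairs A J x) = k))
      = (LINT x|P J. 2 * (real k * of_bool (card (twin_pairs A J x) = k)))"
    by (simp add: pr_expectation)
  also have "\<dots> = (LINT x|P J. (\<Sum>a\<in>J. \<Sum>b\<in>J - {a}. of_bool (closed_twins A J x a b \<and> card (twin_pairs A J x) = k)))"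
  proof (rule Bochner_Integration.integral_cong[OF refl])
    fix x
    have "2 * (real k * of_bool (card (twin_pairs A J x) = k)) = real (2 * card (twin_pairs A J x)) * of_bool (card (twin_pairs A J x) = k)"
      by auto
    also have "\<dots> = (\<Sum>a\<in>J. \<Sum>b\<in>J - {a}. of_bool (closed_twins A J x a b \<and> card (twin_pairs A J x) = k))"
      unfolding card_twin_pairs[OF J, of A x] by (simp add: sum_distrib_right of_bool_conj)
    finally show "2 * (real k * of_bool (card (twin_pairs A J x) = k)) =
      (\<Sum>a\<in>J. \<Sum>b\<in>J - {a}. of_bool (closed_twins A J x a b \<and> card (twin_pairs A J x) = k) :: real)" .
  qed
  also have "\<dots> = (\<Sum>a\<in>J. \<Sum>b\<in>J - {a}. LINT x|P J. of_bool (closed_twins A J x a b \<and> card (twin_pairs A J x) = k))"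
  proof -
    have int: "integrable (P J) (\<lambda>x. of_bool (closed_twins A J x a b \<and> card (twin_pairs A J x) = k) :: real)"
      if "a \<in> J" "b \<in> J" for a b
      using m[OF that] by (intro J.integrable_const_bound[where B = 1]) auto
    show ?thesis
      by (subst Bochner_Integration.integral_sum) (auto intro!: Bochner_Integration.integrable_sum int sum.cong Bochner_Integration.integral_sum)
  qed
  also have "\<dots> = (\<Sum>a\<in>J. \<Sum>b\<in>J - {a}. pr J (\<lambda>x. closed_twins A J x a b \<and> card (twin_pairs A J x) = k))"
    by (intro sum.cong refl pr_expectation[symmetric] m) auto
  finally show ?thesis .
qed

text \<open>Three replacements, one for each error term. Off disturbances, the count over
  \<open>J\<close> is one more than the count over the other points \<open>I\<close>; that count
  decouples from the twin event; and its law over \<open>I\<close> is replaced by the law over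
  \<open>J\<close>, restoring the two points.\<close>

lemma pr_pair_step:
  assumes J: "finite J" "card J = n + 2" "a \<in> J" "b \<in> J" "a \<noteq> b"
  shows "\<bar>pr J (\<lambda>x. closed_twins A J x a b \<and> card (twin_pairs A J x) = Suc k)
      - mean_void n * pr J (\<lambda>x. card (twin_pairs A J x) = k)\<bar>
    \<le> laplace (real n / 2) * sqrt (disturb_bound n) + sqrt (real n) * laplace1 (real (n - 1) / 2)
       + mean_void n * (disturb_bound n + disturb_bound (Suc n))"
proof -
  define I where "I = J - {a, b}"
  have JI: "J = insert b (insert a I)" and I: "finite I" "a \<notin> I" "b \<notin> I"
    using J by (auto simp: I_def)
  have cI: "card I = n" "card (insert a I) = Suc n"
    using J I by (auto simp: I_def card_Diff_subset)
  have [measurable]: "Measurable.pred (P J) (\<lambda>x. closed_twins A J x a b)"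
    using J by (intro closed_twins_measurable) auto
  have [measurable]: "Measurable.pred (P J) (disturbs A I a)"
    using I JI by (intro disturbs_measurable) auto
  have cm[measurable]: "Measurable.pred (P J) (\<lambda>x. card (twin_pairs A I x) = k)" "Measurable.pred (P J) (\<lambda>x. card (twin_pairs A J x) = Suc k)"
    "Measurable.pred (P I) (\<lambda>x. card (twin_pairs A I x) = k)"
    using I JI by (auto intro!: count_eq_measurable)
  have "\<bar>pr J (\<lambda>x. closed_twins A J x a b \<and> card (twin_pairs A J x) = Suc k)
      - pr J (\<lambda>x. closed_twins A J x a b \<and> card (twin_pairs A I x) = k)\<bar>
      \<le> pr J (\<lambda>x. closed_twins A J x a b \<and> disturbs A I a x)"
  proof (rule pr_diff_le)
    fix x assume x: "\<not> (closed_twins A J x a b \<and> disturbs A I a x)"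
    have "card (twin_pairs A J x) = Suc (card (twin_pairs A I x))" if "closed_twins A J x a b"
    proof -
      have "twin_pairs A J x = insert {a, b} (twin_pairs A I x)"
        unfolding JI using x that I J(5) sym_A JI by (intro twin_pairs_add_twins) auto
      moreover have "{a, b} \<notin> twin_pairs A I x" using I by (simp add: mem_twin_pairs_iff)
      ultimately show ?thesis using finite_twin_pairs[OF I(1), of A x] by simp
    qed
    then show "(closed_twins A J x a b \<and> card (twin_pairs A J x) = Suc k)
        \<longleftrightarrow> (closed_twins A J x a b \<and> card (twin_pairs A I x) = k)" by auto
  qed measurable
  also have "\<dots> \<le> laplace (real n / 2) * sqrt (pr (insert a I) (disturbs A I a))"
    using pr_twins_disturbs_le[OF I J(5)] unfolding JI[symmetric] cI .
  also have "\<dots> \<le> laplace (real n / 2) * sqrt (disturb_bound n)"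
    using pr_disturbs_bound[OF I(1,2)] by (intro mult_left_mono real_sqrt_le_mono laplace_nonneg) (simp add: cI)
  finally have 1: "\<bar>pr J (\<lambda>x. closed_twins A J x a b \<and> card (twin_pairs A J x) = Suc k)
      - pr J (\<lambda>x. closed_twins A J x a b \<and> card (twin_pairs A I x) = k)\<bar> \<le> laplace (real n / 2) * sqrt (disturb_bound n)" .
  have 2: "\<bar>pr J (\<lambda>x. closed_twins A J x a b \<and> card (twin_pairs A I x) = k) - mean_void n * pr I (\<lambda>x. card (twin_pairs A I x) = k)\<bar>
      \<le> sqrt (real n) * laplace1 (real (n - 1) / 2)"
    using pr_twins_decouple[OF I J(5), of "\<lambda>x. card (twin_pairs A I x) = k"] cm I
    unfolding JI[symmetric] cI by (simp add: twin_pairs_upd)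
  have "\<bar>pr I (\<lambda>x. card (twin_pairs A I x) = k) - pr J (\<lambda>x. card (twin_pairs A J x) = k)\<bar> \<le> disturb_bound n + disturb_bound (Suc n)"
    using pr_add_point[of I a k] pr_add_point[of "insert a I" b k] I J(5) unfolding cI JI[symmetric] by auto
  then have "\<bar>mean_void n * (pr I (\<lambda>x. card (twin_pairs A I x) = k) - pr J (\<lambda>x. card (twin_pairs A J x) = k))\<bar>
      \<le> mean_void n * (disturb_bound n + disturb_bound (Suc n))"
    unfolding abs_mult using mean_void_nonneg[of n] by (simp add: mult_left_mono)
  then have 3: "\<bar>mean_void n * pr I (\<lambda>x. card (twin_pairs A I x) = k) - mean_void n * pr J (\<lambda>x. card (twin_pairs A J x) = k)\<bar>
      \<le> mean_void n * (disturb_bound n + disturb_bound (Suc n))"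
    by (simp add: right_diff_distrib)
  show ?thesis using 1 2 3 by linarith
qed

lemma pr_twins_recursion:
  assumes J: "finite J" "card J = n + 2"
  shows "\<bar>real (Suc k) * pr J (\<lambda>x. card (twin_pairs A J x) = Suc k)
      - real (n + 2) * real (n + 1) / 2 * mean_void n * pr J (\<lambda>x. card (twin_pairs A J x) = k)\<bar>
    \<le> real (n + 2) * real (n + 1) / 2 *
      (laplace (real n / 2) * sqrt (disturb_bound n) + sqrt (real n) * laplace1 (real (n - 1) / 2)
       + mean_void n * (disturb_bound n + disturb_bound (Suc n)))" (is "_ \<le> ?c * ?B")
proof -
  let ?m = "mean_void n * pr J (\<lambda>x. card (twin_pairs A J x) = k)"
  let ?p = "\<lambda>a b. pr J (\<lambda>x. closed_twins A J x a b \<and> card (twin_pairs A J x) = Suc k)"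
  have const: "(\<Sum>a\<in>J. \<Sum>b\<in>J - {a}. y) = 2 * ?c * y" for y :: real
    using J by simp
  have "2 * (real (Suc k) * pr J (\<lambda>x. card (twin_pairs A J x) = Suc k)) - 2 * ?c * ?m
      = (\<Sum>a\<in>J. \<Sum>b\<in>J - {a}. ?p a b - ?m)"
    unfolding pr_count_Suc[OF J(1)] const[symmetric] by (simp only: sum_subtractf)
  also have "\<bar>\<dots>\<bar> \<le> (\<Sum>a\<in>J. \<Sum>b\<in>J - {a}. ?B)"
    by (intro sum_abs[THEN order_trans] sum_mono pr_pair_step[OF J]) auto
  also have "\<dots> = 2 * ?c * ?B" by (rule const)
  finally have *: "\<bar>2 * (real (Suc k) * pr J (\<lambda>x. card (twin_pairs A J x) = Suc k)) - 2 * ?c * ?m\<bar> \<le> 2 * ?c * ?B" .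
  have half: "\<bar>2 * x - 2 * c * m\<bar> \<le> 2 * c * B \<Longrightarrow> \<bar>x - c * m\<bar> \<le> c * B" for x c m B :: real
    unfolding mult.assoc by linarith
  show ?thesis using half[OF *] by (simp only: mult.assoc)
qed

text \<open>Bounds the first moment, from which tightness is derived by Markov's inequality.\<close>

lemma expectation_twin_pairs:
  assumes J: "finite J"
  shows "(LINT x|P J. real (card (twin_pairs A J x))) = real (card J) * (real (card J) - 1) / 2 * mean_void (card J - 2)"
    "integrable (P J) (\<lambda>x. real (card (twin_pairs A J x)))"
proof -
  interpret J: prob_space "P J" by (rule prob_space_P)
  have ct: "Measurable.pred (P J) (\<lambda>x. closed_twins A J x a b)" if "a \<in> J" "b \<in> J" for a b
    using that J by (intro closed_twins_measurable) auto
  have int: "integrable (P J) (\<lambda>x. of_bool (closed_twins A J x a b) :: real)" if "a \<in> J" "b \<in> J" for a b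
    using ct[OF that] by (intro J.integrable_const_bound[where B = 1]) auto
  have eq: "real (card (twin_pairs A J x)) = (\<Sum>a\<in>J. \<Sum>b\<in>J - {a}. of_bool (closed_twins A J x a b)) / 2" for x
  proof -
    have "real (2 * card (twin_pairs A J x)) = (\<Sum>a\<in>J. \<Sum>b\<in>J - {a}. of_bool (closed_twins A J x a b))"
      unfolding card_twin_pairs[OF J, of A x] by simp
    then show ?thesis by simp
  qed
  show "integrable (P J) (\<lambda>x. real (card (twin_pairs A J x)))"
    unfolding eq by (intro Bochner_Integration.integrable_divide Bochner_Integration.integrable_sum int) auto
  have "(LINT x|P J. (\<Sum>a\<in>J. \<Sum>b\<in>J - {a}. of_bool (closed_twins A J x a b) :: real))
      = (\<Sum>a\<in>J. \<Sum>b\<in>J - {a}. LINT x|P J. of_bool (closed_twins A J x a b))"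
    by (subst Bochner_Integration.integral_sum)
      (auto intro!: Bochner_Integration.integrable_sum int sum.cong Bochner_Integration.integral_sum)
  also have "\<dots> = (\<Sum>a\<in>J. \<Sum>b\<in>J - {a}. mean_void (card J - 2))"
    using J by (intro sum.cong refl) (auto simp: pr_expectation[OF ct, symmetric] intro!: pr_closed_twins)
  also have "\<dots> = real (card J) * (real (card J) - 1) * mean_void (card J - 2)"
    using J by (cases "J = {}") (auto simp: of_nat_diff Suc_le_eq card_gt_0_iff)
  finally show "(LINT x|P J. real (card (twin_pairs A J x))) = real (card J) * (real (card J) - 1) / 2 * mean_void (card J - 2)"
    unfolding eq by simp
qed

text \<open>By \<open>lap\<close>, \<open>mean_void n\<close> is O(n^-2),
  \<open>laplace1 \<alpha>\<close> is O(\<alpha>^-3) and \<open>disturb_bound n\<close> is O(1/n).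
  The error per pair in the recursion is therefore O(n^(-5/2)), and over the order of n^2 pairs it
  still vanishes. The factor 2 in \<open>lim\<close> compensates for counting unordered
  pairs.\<close>

lemma twin_pairs_poisson_limit:
  assumes rate: "0 \<le> rate"
    and lap: "\<And>\<alpha>. 0 < \<alpha> \<Longrightarrow> laplace \<alpha> \<le> C / \<alpha>\<^sup>2"
    and lim: "(\<lambda>n. (real n)\<^sup>2 * mean_void n) \<longlonglongrightarrow> 2 * rate"
  shows "(\<lambda>n. pr {1..n} (\<lambda>x. card (twin_pairs A {1..n} x) = k)) \<longlonglongrightarrow> rate ^ k / fact k * exp (- rate)"
proof -
  have C: "0 \<le> C" using lap[of 1] laplace_nonneg[of 1] by simp
  have mv: "mean_void n \<le> C / (real n)\<^sup>2" if "0 < n" for n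
    using mean_void_le_laplace[of n] lap[of "real n"] that by simp
  have lap1: "laplace1 \<alpha> \<le> C * (4 / \<alpha> ^ 3)" if "0 < \<alpha>" for \<alpha>
  proof -
    have "laplace1 \<alpha> \<le> laplace (\<alpha> / 2) / \<alpha>" using that by (rule laplace1_le)
    also have "\<dots> \<le> (C / (\<alpha> / 2)\<^sup>2) / \<alpha>" using that lap[of "\<alpha> / 2"] by (intro divide_right_mono) auto
    also have "\<dots> = C * (4 / \<alpha> ^ 3)" by (simp add: field_simps power2_eq_square power3_eq_cube)
    finally show ?thesis .
  qed
  have mvd: "mean_void (n - 2) - mean_void (n - 1) \<le> C * (4 / real (n - 2) ^ 3)" if "2 < n" for n
  proof -
    have "mean_void (n - 2) - mean_void (Suc (n - 2)) \<le> laplace1 (real (n - 2))" by (rule mean_void_diff_le)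
    moreover have "Suc (n - 2) = n - 1" using that by simp
    ultimately show ?thesis using lap1[of "real (n - 2)"] that by simp
  qed
  define \<delta> where "\<delta> n = real n / (real n - 1)\<^sup>2 + (real n)\<^sup>2 * (4 / (real n - 2) ^ 3)" for n
  have db: "disturb_bound n \<le> C * \<delta> n" if n: "2 < n" for n
  proof -
    have "real n * mean_void (n - 1) \<le> real n * (C / (real (n - 1))\<^sup>2)"
      using n by (intro mult_left_mono mv) auto
    moreover have "(real n)\<^sup>2 * (mean_void (n - 2) - mean_void (n - 1)) \<le> (real n)\<^sup>2 * (C * (4 / real (n - 2) ^ 3))"
      using n by (intro mult_left_mono mvd) auto
    ultimately show ?thesis
      using n unfolding disturb_bound_def \<delta>_def by (simp add: of_nat_diff algebra_simps)
  qed
  have db0: "0 \<le> disturb_bound n" for n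
    using order_trans[OF measure_nonneg pr_disturbs_bound[of "{1..n}" 0]] by simp
  define c where "c n = real (n + 2) * real (n + 1) / 2" for n
  \<comment> \<open>An explicit majorant of the error. The 32 is 4 * 2^3, from \<open>lap1\<close>
    at half of \<open>n - 1\<close>.\<close>
  define \<epsilon> where "\<epsilon> n = c n * (C * (4 / (real n)\<^sup>2) * sqrt (C * \<delta> n) + sqrt (real n) * (C * (32 / (real n - 1) ^ 3))
       + C / (real n)\<^sup>2 * (C * \<delta> n + C * \<delta> (Suc n)))" for n
  have err: "c n * (laplace (real n / 2) * sqrt (disturb_bound n) + sqrt (real n) * laplace1 (real (n - 1) / 2)
       + mean_void n * (disturb_bound n + disturb_bound (Suc n))) \<le> \<epsilon> n" if n: "2 < n" for n
    unfolding \<epsilon>_def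
  proof (intro mult_left_mono add_mono mult_mono)
    show "laplace (real n / 2) \<le> C * (4 / (real n)\<^sup>2)"
      using lap[of "real n / 2"] n by (simp add: power_divide)
    show "laplace1 (real (n - 1) / 2) \<le> C * (32 / (real n - 1) ^ 3)"
      using lap1[of "real (n - 1) / 2"] n by (simp add: power_divide of_nat_diff)
    show "disturb_bound (Suc n) \<le> C * \<delta> (Suc n)" "disturb_bound n \<le> C * \<delta> n" using n by (intro db; simp)+
    show "sqrt (disturb_bound n) \<le> sqrt (C * \<delta> n)" using n by (intro real_sqrt_le_mono db)
    show "mean_void n \<le> C / (real n)\<^sup>2" using n by (intro mv) auto
  qed (use C db0 n in \<open>auto simp: c_def laplace_nonneg laplace1_nonneg mean_void_nonneg\<close>)
  have \<delta>lim: "\<delta> \<longlonglongrightarrow> 0" unfolding \<delta>_def by real_asymp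
  have elim: "\<epsilon> \<longlonglongrightarrow> 0"
  proof -
    have 1: "(\<lambda>n. c n * (4 / (real n)\<^sup>2)) \<longlonglongrightarrow> 2" unfolding c_def by real_asymp
    have 2: "(\<lambda>n. c n * (sqrt (real n) * (32 / (real n - 1) ^ 3))) \<longlonglongrightarrow> 0" unfolding c_def by real_asymp
    have "(\<lambda>n. C * (c n * (4 / (real n)\<^sup>2)) * sqrt (C * \<delta> n) + C * (c n * (sqrt (real n) * (32 / (real n - 1) ^ 3)))
        + C / 4 * (c n * (4 / (real n)\<^sup>2)) * (C * \<delta> n + C * \<delta> (Suc n))) \<longlonglongrightarrow> C * 2 * sqrt (C * 0) + C * 0 + C / 4 * 2 * (C * 0 + C * 0)"
      by (intro tendsto_intros 1 2 \<delta>lim LIMSEQ_Suc)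
    moreover have "C * (c n * (4 / (real n)\<^sup>2)) * sqrt (C * \<delta> n) + C * (c n * (sqrt (real n) * (32 / (real n - 1) ^ 3)))
        + C / 4 * (c n * (4 / (real n)\<^sup>2)) * (C * \<delta> n + C * \<delta> (Suc n)) = \<epsilon> n" for n
      unfolding \<epsilon>_def by (simp add: distrib_left add_divide_distrib mult_ac)
    ultimately show ?thesis by simp
  qed
  have clim: "(\<lambda>n. c n * mean_void n) \<longlonglongrightarrow> rate"
  proof -
    have "(\<lambda>n. c n / (real n)\<^sup>2) \<longlonglongrightarrow> 1 / 2" unfolding c_def by real_asymp
    from tendsto_mult[OF this lim] have "(\<lambda>n. c n / (real n)\<^sup>2 * ((real n)\<^sup>2 * mean_void n)) \<longlonglongrightarrow> rate" by simp
    then show ?thesis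
      by (rule Lim_transform_eventually) (auto simp: eventually_sequentially intro!: exI[of _ 1])
  qed
  define p where "p n k = pr {1..n} (\<lambda>x. card (twin_pairs A {1..n} x) = k)" for n k :: nat
  have p01: "0 \<le> p n k" "p n k \<le> 1" for n k
    unfolding p_def using prob_space.prob_le_1[OF prob_space_P] by auto
  have psum: "(\<Sum>k<m. p n k) = pr {1..n} (\<lambda>x. card (twin_pairs A {1..n} x) < m)" for n m
  proof -
    interpret J: prob_space "P {1..n}" by (rule prob_space_P)
    have "pr {1..n} (\<lambda>x. card (twin_pairs A {1..n} x) < m)
        = J.prob (\<Union>k<m. {x \<in> space (P {1..n}). card (twin_pairs A {1..n} x) = k})"
      by (rule arg_cong[where f = "J.prob"]) auto
    also have "\<dots> = (\<Sum>k<m. p n k)"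
      unfolding p_def
    proof (rule J.finite_measure_finite_Union)
      have "Measurable.pred (P {1..n}) (\<lambda>x. card (twin_pairs A {1..n} x) = k)" for k
        by (rule count_eq_measurable) auto
      then show "(\<lambda>k. {x \<in> space (P {1..n}). card (twin_pairs A {1..n} x) = k}) ` {..<m} \<subseteq> sets (P {1..n})"
        by (auto simp: pred_def)
    qed (auto simp: disjoint_family_on_def)
    finally show ?thesis ..
  qed
  have "(\<lambda>n. p n k) \<longlonglongrightarrow> rate ^ k / fact k * exp (- rate)"
  proof (rule pmf_convergence_of_recursion[OF rate])
    fix k
    show "(\<lambda>n. real (Suc k) * p n (Suc k) - rate * p n k) \<longlonglongrightarrow> 0"
    proof (rule LIMSEQ_offset[where k = 2])
      have "eventually (\<lambda>n. norm (real (Suc k) * p (n + 2) (Suc k) - rate * p (n + 2) k) \<le> \<epsilon> n + \<bar>c n * mean_void n - rate\<bar>) sequentially"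
        using eventually_gt_at_top[of "2 :: nat"]
      proof eventually_elim
        case (elim n)
        have "\<bar>real (Suc k) * p (n + 2) (Suc k) - c n * mean_void n * p (n + 2) k\<bar> \<le> \<epsilon> n"
          using pr_twins_recursion[of "{1..n + 2}" n k] err[OF elim] unfolding p_def c_def by (simp del: of_nat_Suc of_nat_add)
        moreover have "\<bar>(c n * mean_void n - rate) * p (n + 2) k\<bar> \<le> \<bar>c n * mean_void n - rate\<bar>"
          unfolding abs_mult using p01[of "n + 2" k] by (intro mult_left_le) auto
        ultimately show ?case unfolding left_diff_distrib real_norm_def by linarith
      qed
      moreover have "(\<lambda>n. \<epsilon> n + \<bar>c n * mean_void n - rate\<bar>) \<longlonglongrightarrow> 0"
        using tendsto_add[OF elim tendsto_rabs[OF tendsto_diff[OF clim tendsto_const[of rate]]]] by simp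
      ultimately show "(\<lambda>n. real (Suc k) * p (n + 2) (Suc k) - rate * p (n + 2) k) \<longlonglongrightarrow> 0"
        by (rule Lim_null_comparison)
    qed
  next
    show "0 \<le> p n k" for n k by (rule p01)
    show "(\<Sum>k<m. p n k) \<le> 1" for n m
      unfolding psum using prob_space.prob_le_1[OF prob_space_P] by auto
    \<comment> \<open>The mean of the count converges to \<open>rate\<close>, so it is eventually
      below \<open>rate + 1\<close>; Markov's inequality turns this into a tail bound uniform in
      \<open>n\<close>.\<close>
    have "eventually (\<lambda>n. c n * mean_void n < rate + 1) sequentially"
      by (rule order_tendstoD[OF clim]) simp
    then have "eventually (\<lambda>n. \<forall>m>0. 1 - (rate + 1) / real m \<le> (\<Sum>k<m. p (n + 2) k)) sequentially"
    proof eventually_elim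
      case (elim n)
      let ?J = "{1..n + 2}"
      interpret J: prob_space "P ?J" by (rule prob_space_P)
      show ?case
      proof (intro allI impI)
        fix m :: nat assume m: "0 < m"
        have [measurable]: "(\<lambda>x. card (twin_pairs A ?J x)) \<in> measurable (P ?J) (count_space UNIV)"
          by (rule card_twin_pairs_measurable) auto
        have E: "(LINT x|P ?J. real (card (twin_pairs A ?J x))) \<le> rate + 1"
          using expectation_twin_pairs(1)[of ?J] elim by (simp add: c_def algebra_simps)
        have "J.prob {x \<in> space (P ?J). real m \<le> real (card (twin_pairs A ?J x))} \<le> (LINT x|P ?J. real (card (twin_pairs A ?J x))) / real m"
          using m expectation_twin_pairs(2)[of ?J] by (intro integral_Markov_inequality_measure[where A = "{}"]) auto
        also have "\<dots> \<le> (rate + 1) / real m" using E by (intro divide_right_mono) auto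
        finally have "J.prob {x \<in> space (P ?J). m \<le> card (twin_pairs A ?J x)} \<le> (rate + 1) / real m" by simp
        moreover have "pr ?J (\<lambda>x. card (twin_pairs A ?J x) < m) = 1 - J.prob {x \<in> space (P ?J). m \<le> card (twin_pairs A ?J x)}"
        proof -
          have "{x \<in> space (P ?J). m \<le> card (twin_pairs A ?J x)} \<in> sets (P ?J)" by measurable
          moreover have "{x \<in> space (P ?J). card (twin_pairs A ?J x) < m}
              = space (P ?J) - {x \<in> space (P ?J). m \<le> card (twin_pairs A ?J x)}" by auto
          ultimately show ?thesis by (simp only: J.prob_compl)
        qed
        ultimately show "1 - (rate + 1) / real m \<le> (\<Sum>k<m. p (n + 2) k)"
          unfolding psum by simp
      qed
    qed
    then show "eventually (\<lambda>n. \<forall>m>0. 1 - (rate + 1) / real m \<le> (\<Sum>k<m. p n k)) sequentially"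
      by (rule eventually_sequentially_seg[THEN iffD1, where k1 = 2])
  qed
  then show ?thesis by (simp add: p_def)
qed

end

section \<open>Area of the difference of a planar body and its translate\<close>

definition crossdet :: "real^2 \<Rightarrow> real^2 \<Rightarrow> real" where
  "crossdet u v = u $ 1 * v $ 2 - u $ 2 * v $ 1"

text \<open>Stated for any abelian group because it is applied both to the planar body and to its
  sections by lines, which are sets of reals.\<close>

definition shift_diff :: "'a::ab_group_add set \<Rightarrow> 'a \<Rightarrow> 'a set" where
  "shift_diff K h = {v. (v \<in> K) \<noteq> (v - h \<in> K)}"

text \<open>The support function of \<open>K\<close> at \<open>u\<close> turned by a right angle.
  For symmetric \<open>K\<close> the values of \<open>crossdet u\<close> on \<open>K\<close> fill
  the interval from minus this number to this number.\<close>

definition width_fun :: "(real^2) set \<Rightarrow> real^2 \<Rightarrow> real" where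
  "width_fun K u = Sup (crossdet u ` K)"

lemma vec2_measurable [measurable]: "(\<lambda>(x::real, y). vector [x, y] :: real^2) \<in> borel_measurable (lborel \<Otimes>\<^sub>M lborel)"
proof -
  have "(\<lambda>(x::real, y). vector [x, y] :: real^2) = (\<lambda>p. fst p *\<^sub>R axis 1 1 + snd p *\<^sub>R axis 2 1)"
    by (auto simp: vec_eq_iff forall_2 axis_def)
  moreover have "continuous_on UNIV (\<lambda>p::real \<times> real. fst p *\<^sub>R axis 1 1 + snd p *\<^sub>R axis 2 1 :: real^2)"
    by (intro continuous_intros)
  ultimately show ?thesis
    using borel_measurable_continuous_onI by (simp add: lborel_prod)
qed

lemma lborel_vec2: "distr (lborel \<Otimes>\<^sub>M lborel) borel (\<lambda>(x, y). vector [x, y] :: real^2) = lborel"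
proof (rule lborel_eqI[symmetric])
  fix l u :: "real^2"
  assume le: "\<And>b. b \<in> Basis \<Longrightarrow> l \<bullet> b \<le> u \<bullet> b"
  have le': "l $ i \<le> u $ i" for i using le[of "axis i 1"] by (simp add: inner_axis)
  have "emeasure (distr (lborel \<Otimes>\<^sub>M lborel) borel (\<lambda>(x, y). vector [x, y] :: real^2)) (box l u)
      = emeasure (lborel \<Otimes>\<^sub>M lborel) ({l $ 1<..<u $ 1} \<times> {l $ 2<..<u $ 2})"
    by (subst emeasure_distr) (auto simp: mem_box_cart forall_2 space_pair_measure intro!: arg_cong2[of _ _ _ _ emeasure])
  also have "\<dots> = ennreal (u $ 1 - l $ 1) * ennreal (u $ 2 - l $ 2)"
    using le' by (subst sigma_finite_measure.emeasure_pair_measure_Times) (auto intro: sigma_finite_lborel)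
  also have "\<dots> = (\<Prod>b\<in>Basis. (u - l) \<bullet> b)"
  proof -
    have B: "(Basis :: (real^2) set) = {axis 1 1, axis 2 1}" by (auto simp: Basis_vec_def UNIV_2)
    have "axis 1 1 \<noteq> axis (2::2) (1::real)" by (simp add: axis_eq_axis)
    then show ?thesis using le' unfolding B by (simp add: inner_axis ennreal_mult)
  qed
  finally show "emeasure (distr (lborel \<Otimes>\<^sub>M lborel) borel (\<lambda>(x, y). vector [x, y] :: real^2)) (box l u)
      = (\<Prod>b\<in>Basis. (u - l) \<bullet> b)" .
qed simp

lemma emeasure_vec2:
  assumes [measurable]: "S \<in> sets borel"
  shows "emeasure lborel (S :: (real^2) set) = (\<integral>\<^sup>+y. emeasure lborel {x. vector [x, y] \<in> S} \<partial>lborel)"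
proof -
  let ?V = "\<lambda>(x::real, y). vector [x, y] :: real^2"
  have "emeasure lborel S = emeasure (lborel \<Otimes>\<^sub>M lborel) (?V -` S \<inter> space (lborel \<Otimes>\<^sub>M lborel))"
    by (subst lborel_vec2[symmetric]) (rule emeasure_distr; simp)
  also have "\<dots> = (\<integral>\<^sup>+y. emeasure lborel ((\<lambda>x. (x, y)) -` (?V -` S \<inter> space (lborel \<Otimes>\<^sub>M lborel))) \<partial>lborel)"
    by (rule pair_sigma_finite.emeasure_pair_measure_alt2)
       (use measurable_sets[OF vec2_measurable assms] in \<open>auto simp: pair_sigma_finite_def sigma_finite_lborel\<close>)
  finally show ?thesis by (simp add: vimage_def space_pair_measure)
qed

text \<open>Integration along the lines parallel to \<open>u\<close>. The normalisation of
  \<open>w\<close> gives the change of frame determinant 1, so no Jacobian factor appears.\<close>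

lemma emeasure_linear_frame:
  assumes uw: "crossdet u w = 1" and S: "S \<in> sets borel" "bounded S"
  shows "emeasure lborel S = (\<integral>\<^sup>+y. emeasure lborel {x. x *\<^sub>R u + y *\<^sub>R w \<in> S} \<partial>lborel)"
proof -
  define g where "g v = (vector [crossdet v w, crossdet u v] :: real^2)" for v
  define f where "f v = v $ 1 *\<^sub>R u + v $ 2 *\<^sub>R w" for v :: "real^2"
  have lin: "linear g"
    by (rule linearI) (simp_all add: g_def vec_eq_iff forall_2 crossdet_def algebra_simps)
  have fg: "f (g v) = v" for v
  proof -
    have "f (g v) $ i = crossdet u w * v $ i" for i
      using exhaust_2[of i] by (auto simp: f_def g_def crossdet_def algebra_simps)
    then show ?thesis by (simp add: vec_eq_iff uw)
  qed
  have gf: "g (f v) = v" for v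
  proof -
    have "g (f v) $ i = crossdet u w * v $ i" for i
      using exhaust_2[of i] by (auto simp: f_def g_def crossdet_def algebra_simps)
    then show ?thesis by (simp add: vec_eq_iff uw)
  qed
  have det: "det (matrix g) = 1"
    using uw by (simp add: det_2 matrix_def g_def crossdet_def axis_def algebra_simps)
  have im: "g ` S = f -` S" using fg gf by (auto simp: image_iff) metis
  have contf: "continuous_on UNIV f" unfolding f_def by (intro continuous_intros)
  have Sl: "S \<in> lmeasurable"
    using S by (intro bounded_set_imp_lmeasurable) auto
  have fS: "f -` S \<in> sets borel"
    using measurable_sets[OF borel_measurable_continuous_onI[OF contf] S(1)] by simp
  have meq: "measure lebesgue (g ` S) = measure lebesgue S"
    using measure_linear_image[OF lin Sl] det by simp
  have gS: "g ` S \<in> lmeasurable" by (rule measurable_linear_image[OF lin Sl])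
  have "emeasure lebesgue (g ` S) = emeasure lebesgue S"
    unfolding emeasure_eq_measure2[OF gS] emeasure_eq_measure2[OF Sl] meq ..
  then have "emeasure lborel S = emeasure lborel (f -` S)"
    using S(1) fS by (simp add: im)
  also have "\<dots> = (\<integral>\<^sup>+y. emeasure lborel {x. vector [x, y] \<in> f -` S} \<partial>lborel)"
    by (rule emeasure_vec2[OF fS])
  finally show ?thesis by (simp add: f_def)
qed

text \<open>Overlapping translates leave two pieces of length \<open>t\<close>, disjoint ones leave
  both intervals entire; hence the minimum.\<close>

lemma emeasure_interval_shift_diff:
  fixes p q t :: real
  assumes "p \<le> q" "0 \<le> t"
  shows "emeasure lborel (shift_diff {p..q} t) = ennreal (2 * min t (q - p))"
proof -
  show ?thesis
  proof (cases "t \<le> q - p")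
    case True
    then have "shift_diff {p..q} t = {p..<p + t} \<union> {q<..q + t}"
      using assms by (auto simp: shift_diff_def)
    then have "emeasure lborel (shift_diff {p..q} t) = emeasure lborel {p..<p + t} + emeasure lborel {q<..q + t}"
      using True assms by (simp only:) (intro plus_emeasure[symmetric]; auto)
    then show ?thesis using True assms by (simp add: ennreal_plus[symmetric] del: ennreal_plus)
  next
    case False
    then have "shift_diff {p..q} t = {p..q} \<union> {p + t..q + t}"
      using assms by (auto simp: shift_diff_def)
    moreover have "emeasure lborel ({p..q} \<union> {p + t..q + t}) = emeasure lborel {p..q} + emeasure lborel {p + t..q + t}"
      using False assms by (intro plus_emeasure[symmetric]) auto
    ultimately show ?thesis using False assms by (simp add: ennreal_plus[symmetric] del: ennreal_plus)
  qed
qed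

lemma frame_exists: assumes "u \<noteq> 0" shows "\<exists>w. crossdet u w = 1"
proof -
  have "(u $ 1)\<^sup>2 + (u $ 2)\<^sup>2 \<noteq> 0" using assms by (auto simp: vec_eq_iff forall_2)
  \<comment> \<open>The vector \<open>u\<close> turned by a right angle and divided by its squared
    norm.\<close>
  then have "crossdet u (vector [- u $ 2 / ((u $ 1)\<^sup>2 + (u $ 2)\<^sup>2), u $ 1 / ((u $ 1)\<^sup>2 + (u $ 2)\<^sup>2)]) = 1"
    by (simp add: crossdet_def power2_eq_square divide_simps)
  then show ?thesis by blast
qed

lemma shift_diff_0 [simp]: "shift_diff K 0 = {}" by (simp add: shift_diff_def)

locale planar_body =
  fixes K :: "(real^2) set"
  assumes body: "convex_body K" and symm: "origin_symmetric K"
begin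

lemma compact_K: "compact K" and convex_K: "convex K" and closed_K: "closed K" and bounded_K: "bounded K"
  using body by (auto simp: convex_body_def compact_imp_closed compact_imp_bounded)

lemma minus_in: "v \<in> K \<Longrightarrow> - v \<in> K"
  using symm unfolding origin_symmetric_def by force

lemma zero_interior: "0 \<in> interior K"
proof -
  obtain a where a: "a \<in> interior K" using body by (auto simp: convex_body_def)
  then have "- a \<in> K" using minus_in interior_subset by blast
  \<comment> \<open>The origin is the midpoint of the interior point \<open>a\<close> and the point
    \<open>- a\<close> of \<open>K\<close>.\<close>
  from mem_interior_convex_shrink[OF convex_K a this, of "1/2"]
  moreover have "- a - (1/2) *\<^sub>R (- a - a) = 0" by (simp add: vec_eq_iff)
  ultimately show ?thesis by simp
qed

lemma zero_in: "0 \<in> K" using zero_interior interior_subset by blast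

lemma shrink_interior: "v \<in> K \<Longrightarrow> \<bar>t\<bar> < 1 \<Longrightarrow> t *\<^sub>R v \<in> interior K"
proof -
  assume v: "v \<in> K" and t: "\<bar>t\<bar> < 1"
  have *: "t *\<^sub>R v \<in> interior K" if "v \<in> K" "0 \<le> t" "t < 1" for v t
    using mem_interior_convex_shrink[OF convex_K zero_interior that(1), of "1 - t"] that
    by (simp add: algebra_simps)
  show ?thesis
    using *[OF v, of t] *[OF minus_in[OF v], of "- t"] t by (cases "0 \<le> t") auto
qed

lemma K_borel [measurable]: "K \<in> sets borel" using closed_K by simp

lemma shift_diff_borel: "shift_diff K h \<in> sets borel"
proof -
  have [measurable]: "(\<lambda>v::real^2. v - h) \<in> borel_measurable borel" by measurable
  have "Measurable.pred borel (\<lambda>v. (v \<in> K) \<noteq> (v - h \<in> K))" by measurable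
  then show ?thesis by (simp add: shift_diff_def pred_def)
qed

lemma bounded_shift_diff: "bounded (shift_diff K h)"
proof (rule bounded_subset)
  show "shift_diff K h \<subseteq> K \<union> (\<lambda>x. h + x) ` K"
    by (auto simp: shift_diff_def image_iff) (metis add_diff_cancel_left' diff_add_cancel add.commute)
qed (use bounded_K in \<open>simp add: bounded_translation\<close>)

lemma width_fun_attained: "\<exists>p\<in>K. crossdet u p = width_fun K u" and width_fun_upper: "p \<in> K \<Longrightarrow> crossdet u p \<le> width_fun K u"
proof -
  have "continuous_on K (crossdet u)" unfolding crossdet_def by (intro continuous_intros)
  then obtain p where p: "p \<in> K" "\<And>q. q \<in> K \<Longrightarrow> crossdet u q \<le> crossdet u p"
    using continuous_attains_sup[OF compact_K, of "crossdet u"] zero_in by blast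
  then have "width_fun K u = crossdet u p"
    unfolding width_fun_def by (intro cSup_eq_maximum) auto
  with p show "\<exists>p\<in>K. crossdet u p = width_fun K u" "q \<in> K \<Longrightarrow> crossdet u q \<le> width_fun K u" for q by auto
qed

lemma width_fun_nonneg: "0 \<le> width_fun K u"
  using width_fun_upper[OF zero_in, of u] by (simp add: crossdet_def)

lemma width_fun_abs: "p \<in> K \<Longrightarrow> \<bar>crossdet u p\<bar> \<le> width_fun K u"
  using width_fun_upper[of p u] width_fun_upper[OF minus_in, of p u] by (auto simp: crossdet_def)

section \<open>Sections of a body by the lines parallel to a fixed direction\<close>

context
  fixes u w :: "real^2"
  assumes uw: "crossdet u w = 1"
begin

definition line_sec :: "real \<Rightarrow> real set" where
  "line_sec y = {x. x *\<^sub>R u + y *\<^sub>R w \<in> K}"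

lemma crossdet_frame: "crossdet u (x *\<^sub>R u + y *\<^sub>R w) = y"
  using uw unfolding crossdet_def by (simp add: algebra_simps)

lemma line_sec_interval:
  assumes "line_sec y \<noteq> {}"
  obtains p q where "p \<le> q" "line_sec y = {p..q}"
proof -
  have cw: "crossdet (x *\<^sub>R u + y *\<^sub>R w) w = x" for x
    using uw unfolding crossdet_def by (simp add: algebra_simps)
  have "line_sec y \<subseteq> (\<lambda>v. crossdet v w) ` K"
    unfolding line_sec_def using cw by (auto simp: image_iff) metis
  moreover have "bounded ((\<lambda>v. crossdet v w) ` K)"
    unfolding crossdet_def by (intro compact_imp_bounded compact_continuous_image compact_K continuous_intros)
  ultimately have "bounded (line_sec y)" by (rule bounded_subset[rotated])
  moreover have "closed (line_sec y)"
  proof -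
    have "closed ((\<lambda>x. x *\<^sub>R u + y *\<^sub>R w) -` K)"
      by (intro continuous_closed_vimage closed_K continuous_intros)
    then show ?thesis by (simp add: line_sec_def vimage_def)
  qed
  moreover have "convex (line_sec y)"
  proof (rule convexI)
    fix a b s t :: real
    assume "a \<in> line_sec y" "b \<in> line_sec y" "0 \<le> s" "0 \<le> t" "s + t = 1"
    then have "s *\<^sub>R (a *\<^sub>R u + y *\<^sub>R w) + t *\<^sub>R (b *\<^sub>R u + y *\<^sub>R w) \<in> K"
      using convexD[OF convex_K] by (auto simp: line_sec_def)
    moreover have "s *\<^sub>R (a *\<^sub>R u + y *\<^sub>R w) + t *\<^sub>R (b *\<^sub>R u + y *\<^sub>R w)
        = (s * a + t * b) *\<^sub>R u + ((s + t) * y) *\<^sub>R w" by (simp add: algebra_simps)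
    ultimately show "s *\<^sub>R a + t *\<^sub>R b \<in> line_sec y"
      using \<open>s + t = 1\<close> by (simp add: line_sec_def)
  qed
  ultimately have "connected (line_sec y) \<and> compact (line_sec y)"
    by (simp add: compact_eq_bounded_closed convex_connected)
  then obtain p q where "line_sec y = {p..q}" using connected_compact_interval_1 by blast
  then show thesis using that assms by auto
qed

lemma line_sec_bounds: "line_sec y \<noteq> {} \<Longrightarrow> \<bar>y\<bar> \<le> width_fun K u"
  using width_fun_abs[of _ u] crossdet_frame unfolding line_sec_def by fastforce

lemma shift_diff_sec: "{x. x *\<^sub>R u + y *\<^sub>R w \<in> shift_diff K (t *\<^sub>R u)} = shift_diff (line_sec y) t"
  by (auto simp: shift_diff_def line_sec_def algebra_simps)

text \<open>After division by \<open>t\<close> the bound is an integrable function of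
  \<open>y\<close> independent of \<open>t\<close>; it serves as the majorant for dominated
  convergence.\<close>

lemma emeasure_sec_le:
  assumes "0 \<le> t"
  shows "emeasure lborel (shift_diff (line_sec y) t) \<le> ennreal (2 * t) * indicator {- width_fun K u..width_fun K u} y"
proof (cases "line_sec y = {}")
  case True then show ?thesis by (simp add: shift_diff_def)
next
  case False
  then obtain p q where "p \<le> q" "line_sec y = {p..q}" by (rule line_sec_interval)
  then show ?thesis
    using line_sec_bounds[OF False] assms by (auto simp: emeasure_interval_shift_diff abs_le_iff intro!: ennreal_leI)
qed

text \<open>A maximiser of \<open>crossdet u\<close> on \<open>K\<close>, scaled down to the level
  \<open>y\<close>, is an interior point of \<open>K\<close>. So the section at this level has
  positive length, and every shift shorter than it uncovers its own length at either end.\<close>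

lemma eventually_emeasure_sec:
  assumes "\<bar>y\<bar> < width_fun K u"
  shows "eventually (\<lambda>n. emeasure lborel (shift_diff (line_sec y) (1 / real n)) = ennreal (2 * (1 / real n))) sequentially"
proof -
  obtain v where v: "v \<in> K" "crossdet u v = width_fun K u" using width_fun_attained by blast
  define t where "t = y / width_fun K u"
  have t: "\<bar>t\<bar> < 1" using assms by (auto simp: t_def)
  have "t *\<^sub>R v \<in> interior K" using shrink_interior[OF v(1) t] .
  then obtain e where e: "0 < e" "ball (t *\<^sub>R v) e \<subseteq> K" by (auto simp: mem_interior)
  define x0 where "x0 = crossdet (t *\<^sub>R v) w"
  have tv: "t *\<^sub>R v = x0 *\<^sub>R u + y *\<^sub>R w"
  proof -
    have cy: "crossdet u (t *\<^sub>R v) = y"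
      using v(2) assms by (simp add: crossdet_def t_def field_simps)
    have "(crossdet z w *\<^sub>R u + crossdet u z *\<^sub>R w) $ i = crossdet u w * z $ i" for z i
      using exhaust_2[of i] by (auto simp: crossdet_def algebra_simps)
    then have "crossdet (t *\<^sub>R v) w *\<^sub>R u + crossdet u (t *\<^sub>R v) *\<^sub>R w = t *\<^sub>R v"
      unfolding vec_eq_iff uw by simp
    then show ?thesis by (simp only: cy x0_def)
  qed
  have u0: "0 < norm u" using uw by (auto simp: crossdet_def)
  define d where "d = e / (2 * norm u)"
  have d: "0 < d" using e u0 by (simp add: d_def)
  have in_sec: "x \<in> line_sec y" if "\<bar>x - x0\<bar> \<le> d" for x
  proof -
    have "dist (t *\<^sub>R v) (x *\<^sub>R u + y *\<^sub>R w) = norm ((x0 - x) *\<^sub>R u)"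
      unfolding tv dist_norm by (simp add: algebra_simps)
    also have "\<dots> \<le> d * norm u" using that by (simp add: mult_right_mono abs_minus_commute)
    also have "\<dots> < e" using e u0 by (simp add: d_def)
    finally show ?thesis using e(2) by (auto simp: line_sec_def)
  qed
  then have "line_sec y \<noteq> {}" using d by (metis abs_zero diff_self empty_iff less_imp_le)
  then obtain p q where pq: "p \<le> q" "line_sec y = {p..q}" by (rule line_sec_interval)
  have "x0 + d \<le> q" "p \<le> x0" using in_sec[of "x0 + d"] in_sec[of x0] d pq by auto
  then have "d \<le> q - p" by simp
  have "eventually (\<lambda>n. 1 / real n < d) sequentially"
    using d by (intro order_tendstoD[OF lim_1_over_n]) auto
  then show ?thesis
  proof eventually_elim
    case (elim n)
    then have "min (1 / real n) (q - p) = 1 / real n" using \<open>d \<le> q - p\<close> by simp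
    then show ?case using pq by (simp add: emeasure_interval_shift_diff)
  qed
qed

lemma emeasure_shift_diff_frame:
  "emeasure lborel (shift_diff K (t *\<^sub>R u)) = (\<integral>\<^sup>+y. emeasure lborel (shift_diff (line_sec y) t) \<partial>lborel)"
proof -
  have "emeasure lborel (shift_diff K (t *\<^sub>R u))
      = (\<integral>\<^sup>+y. emeasure lborel {x. x *\<^sub>R u + y *\<^sub>R w \<in> shift_diff K (t *\<^sub>R u)} \<partial>lborel)"
    by (rule emeasure_linear_frame[OF uw shift_diff_borel bounded_shift_diff])
  then show ?thesis by (simp only: shift_diff_sec)
qed

lemma emeasure_sec_measurable [measurable]: "(\<lambda>y. emeasure lborel (shift_diff (line_sec y) t)) \<in> borel_measurable borel"
proof -
  let ?Q = "{p \<in> space (lborel \<Otimes>\<^sub>M lborel). snd p *\<^sub>R u + fst p *\<^sub>R w \<in> shift_diff K (t *\<^sub>R u)}"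
  note shift_diff_borel[measurable]
  have "?Q \<in> sets (lborel \<Otimes>\<^sub>M lborel)" by measurable
  then have "(\<lambda>y. emeasure lborel (Pair y -` ?Q)) \<in> borel_measurable lborel"
    by (rule sigma_finite_measure.measurable_emeasure_Pair[OF sigma_finite_lborel])
  moreover have eq: "Pair y -` ?Q = shift_diff (line_sec y) t" for y
    by (simp only: shift_diff_sec[symmetric]) (auto simp: space_pair_measure)
  ultimately have "(\<lambda>y. emeasure lborel (shift_diff (line_sec y) t)) \<in> borel_measurable lborel" by (simp only: eq)
  then show ?thesis by (simp only: measurable_lborel2)
qed

text \<open>The factor 4 is 2 times 2: each line contributes at most \<open>2 * t\<close>, and the
  levels of the lines that meet \<open>K\<close> lie in an interval of length
  \<open>2 * width_fun K u\<close>.\<close>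

lemma emeasure_shift_diff_frame_le: "0 \<le> t \<Longrightarrow> emeasure lborel (shift_diff K (t *\<^sub>R u)) \<le> ennreal (4 * t * width_fun K u)"
proof -
  assume t: "0 \<le> t"
  have "emeasure lborel (shift_diff K (t *\<^sub>R u)) \<le> (\<integral>\<^sup>+y. ennreal (2 * t) * indicator {- width_fun K u..width_fun K u} y \<partial>lborel)"
    unfolding emeasure_shift_diff_frame using t by (intro nn_integral_mono emeasure_sec_le)
  also have "\<dots> = ennreal (4 * t * width_fun K u)"
    using t width_fun_nonneg[of u]
    by (subst nn_integral_cmult_indicator) (auto simp: ennreal_mult[symmetric] mult_ac)
  finally show ?thesis .
qed

text \<open>Dominated convergence over the levels. Only at the two extreme levels may the section
  degenerate to a point, and these form a null set.\<close>

lemma tendsto_shift_diff_frame: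
  "(\<lambda>n. ennreal (real n) * emeasure lborel (shift_diff K ((1 / real n) *\<^sub>R u))) \<longlonglongrightarrow> ennreal (4 * width_fun K u)"
proof -
  let ?b = "width_fun K u"
  have "(\<lambda>n. \<integral>\<^sup>+y. ennreal (real n) * emeasure lborel (shift_diff (line_sec y) (1 / real n)) \<partial>lborel)
      \<longlonglongrightarrow> (\<integral>\<^sup>+y. 2 * indicator {- ?b..?b} y \<partial>lborel)"
  proof (rule nn_integral_dominated_convergence[where w = "\<lambda>y. 2 * indicator {- ?b..?b} y"])
    show "(\<integral>\<^sup>+y. 2 * indicator {- ?b..?b} y \<partial>lborel) < \<infinity>"
      using width_fun_nonneg[of u] by (subst nn_integral_cmult_indicator) (auto simp: ennreal_mult_less_top)
    fix n
    show "AE y in lborel. ennreal (real n) * emeasure lborel (shift_diff (line_sec y) (1 / real n)) \<le> 2 * indicator {- ?b..?b} y"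
    proof (rule AE_I2)
      fix y
      have "ennreal (real n) * emeasure lborel (shift_diff (line_sec y) (1 / real n))
          \<le> ennreal (real n) * (ennreal (2 * (1 / real n)) * indicator {- ?b..?b} y)"
        by (intro mult_left_mono emeasure_sec_le) auto
      also have "\<dots> \<le> 2 * indicator {- ?b..?b} y"
        by (cases "n = 0") (auto simp: ennreal_mult[symmetric] split: split_indicator)
      finally show "ennreal (real n) * emeasure lborel (shift_diff (line_sec y) (1 / real n)) \<le> 2 * indicator {- ?b..?b} y" .
    qed
  next
    have "AE y in lborel. y \<noteq> ?b \<and> y \<noteq> - ?b"
      by (intro AE_conjI AE_lborel_singleton)
    then show "AE y in lborel. (\<lambda>n. ennreal (real n) * emeasure lborel (shift_diff (line_sec y) (1 / real n))) \<longlonglongrightarrow> 2 * indicator {- ?b..?b} y"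
    proof eventually_elim
      case (elim y)
      show ?case
      proof (cases "\<bar>y\<bar> < ?b")
        case True
        have "eventually (\<lambda>n. ennreal (real n) * emeasure lborel (shift_diff (line_sec y) (1 / real n)) = 2) sequentially"
          using eventually_emeasure_sec[OF True] eventually_gt_at_top[of "0::nat"]
          by eventually_elim (simp add: ennreal_mult[symmetric])
        then have "(\<lambda>n. ennreal (real n) * emeasure lborel (shift_diff (line_sec y) (1 / real n))) \<longlonglongrightarrow> 2"
          by (rule tendsto_eventually)
        then show ?thesis using True by (simp add: indicator_def abs_less_iff)
      next
        case False
        then have "\<not> \<bar>y\<bar> \<le> ?b" using elim by linarith
        then have "line_sec y = {}" using line_sec_bounds by blast
        then show ?thesis using False elim by (auto simp: shift_diff_def indicator_def)
      qed
    qed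
  qed measurable
  moreover have i2: "(\<integral>\<^sup>+y. 2 * indicator {- ?b..?b} y \<partial>lborel) = ennreal (4 * ?b)"
  proof -
    have "(\<integral>\<^sup>+y. 2 * indicator {- ?b..?b} y \<partial>lborel) = 2 * emeasure lborel {- ?b..?b}"
      by (rule nn_integral_cmult_indicator) simp
    also have "emeasure lborel {- ?b..?b} = ennreal (2 * ?b)"
      using width_fun_nonneg[of u] by simp
    also have "2 * ennreal (2 * ?b) = ennreal (4 * ?b)"
      using width_fun_nonneg[of u] ennreal_mult[of 2 "2 * ?b"] by simp
    finally show ?thesis .
  qed
  moreover have eq: "(\<integral>\<^sup>+y. ennreal (real n) * emeasure lborel (shift_diff (line_sec y) (1 / real n)) \<partial>lborel)
      = ennreal (real n) * emeasure lborel (shift_diff K ((1 / real n) *\<^sub>R u))" for n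
  proof -
    have m: "(\<lambda>y. emeasure lborel (shift_diff (line_sec y) (1 / real n))) \<in> borel_measurable lborel"
      using emeasure_sec_measurable[of "1 / real n"] by (simp only: measurable_lborel2)
    show ?thesis
      using nn_integral_cmult[OF m, of "ennreal (real n)"]
      by (simp only: emeasure_shift_diff_frame[of "1 / real n"])
  qed
  ultimately show ?thesis by (simp only: i2 eq)
qed

end

lemma emeasure_shift_diff_le: "emeasure lborel (shift_diff K h) \<le> ennreal (4 * width_fun K h)"
proof (cases "h = 0")
  case False
  then obtain w where "crossdet h w = 1" using frame_exists by blast
  from emeasure_shift_diff_frame_le[OF this, of 1] show ?thesis by simp
qed simp

lemma measure_shift_diff_le: "measure lborel (shift_diff K h) \<le> 4 * width_fun K h"
  using emeasure_shift_diff_le[of h] width_fun_nonneg[of h]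
  by (simp add: measure_def enn2real_leI)

lemma width_fun_0 [simp]: "width_fun K 0 = 0"
  using zero_in by (auto simp: width_fun_def crossdet_def image_constant_conv)

lemma tendsto_measure_shift_diff:
  "(\<lambda>n. real n * measure lborel (shift_diff K ((1 / real n) *\<^sub>R u))) \<longlonglongrightarrow> 4 * width_fun K u"
proof (cases "u = 0")
  case False
  then obtain w where "crossdet u w = 1" using frame_exists by blast
  from tendsto_shift_diff_frame[OF this]
  have "(\<lambda>n. ennreal (real n * measure lborel (shift_diff K ((1 / real n) *\<^sub>R u)))) \<longlonglongrightarrow> ennreal (4 * width_fun K u)"
  proof (rule filterlim_cong[OF refl refl, THEN iffD1, rotated], intro always_eventually allI)
    fix n
    have "emeasure lborel (shift_diff K ((1 / real n) *\<^sub>R u)) \<noteq> \<infinity>"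
      using emeasure_shift_diff_le[of "(1 / real n) *\<^sub>R u"] by (auto simp: top_unique)
    then show "ennreal (real n) * emeasure lborel (shift_diff K ((1 / real n) *\<^sub>R u))
        = ennreal (real n * measure lborel (shift_diff K ((1 / real n) *\<^sub>R u)))"
      by (simp add: emeasure_eq_ennreal_measure ennreal_mult)
  qed
  then show ?thesis
    by (rule tendsto_ennrealD) (use width_fun_nonneg in auto)
qed simp

lemma width_fun_scale: "0 \<le> t \<Longrightarrow> width_fun K (t *\<^sub>R u) = t * width_fun K u"
proof (rule antisym)
  assume t: "0 \<le> t"
  obtain p where p: "p \<in> K" "crossdet (t *\<^sub>R u) p = width_fun K (t *\<^sub>R u)" using width_fun_attained by blast
  have s: "crossdet (t *\<^sub>R u) q = t * crossdet u q" for q by (simp add: crossdet_def algebra_simps)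
  show "width_fun K (t *\<^sub>R u) \<le> t * width_fun K u"
    using p t width_fun_upper[OF p(1), of u] by (simp add: s flip: p(2)) (simp add: mult_left_mono)
  obtain q where q: "q \<in> K" "crossdet u q = width_fun K u" using width_fun_attained by blast
  show "t * width_fun K u \<le> width_fun K (t *\<^sub>R u)"
    using width_fun_upper[OF q(1), of "t *\<^sub>R u"] by (simp add: s q)
qed

lemma width_fun_le_norm: "\<exists>c>0. \<forall>u. width_fun K u \<le> c * norm u"
proof -
  obtain B where B: "B > 0" "\<And>p. p \<in> K \<Longrightarrow> norm p \<le> B" using bounded_K bounded_pos by metis
  have "width_fun K u \<le> (2 * B) * norm u" for u
  proof -
    obtain p where p: "p \<in> K" "crossdet u p = width_fun K u" using width_fun_attained by blast
    have "\<bar>crossdet u p\<bar> \<le> \<bar>u $ 1\<bar> * \<bar>p $ 2\<bar> + \<bar>u $ 2\<bar> * \<bar>p $ 1\<bar>"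
      unfolding crossdet_def by (metis abs_mult abs_triangle_ineq4)
    also have "\<dots> \<le> norm u * B + norm u * B"
      using component_le_norm_cart[of u] component_le_norm_cart[of p] B(2)[OF p(1)]
      by (intro add_mono mult_mono) (auto intro: order_trans)
    finally show ?thesis using p(2) by (simp add: algebra_simps)
  qed
  then show ?thesis using B(1) by (intro exI[of _ "2 * B"]) auto
qed

lemma width_fun_measurable [measurable]: "width_fun K \<in> borel_measurable borel"
proof (rule borel_measurable_continuous_onI)
  obtain c where c: "c > 0" "\<And>u. width_fun K u \<le> c * norm u" using width_fun_le_norm by blast
  have le: "width_fun K u \<le> width_fun K v + c * norm (u - v)" for u v
  proof -
    obtain p where p: "p \<in> K" "crossdet u p = width_fun K u" using width_fun_attained by blast
    have "crossdet u p = crossdet v p + crossdet (u - v) p" by (simp add: crossdet_def algebra_simps)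
    then show ?thesis using width_fun_upper[OF p(1), of v] width_fun_upper[OF p(1), of "u - v"] c(2)[of "u - v"] p(2) by linarith
  qed
  have "\<bar>width_fun K u - width_fun K v\<bar> \<le> c * norm (u - v)" for u v
    using le[of u v] le[of v u] by (simp add: norm_minus_commute abs_le_iff)
  then have "c-lipschitz_on UNIV (width_fun K)"
    using c(1) by (intro lipschitz_onI) (auto simp: dist_norm)
  then show "continuous_on UNIV (width_fun K)" by (rule lipschitz_on_continuous_on)
qed

end

section \<open>Symmetric bodies on the torus\<close>

context invariant_prob_space
begin

lemma sd_0 [simp]: "sd 0 = 0" by (simp add: sd_def)

lemma sd_measurable_set: "{w. (w \<in> A) \<noteq> (w - h \<in> A)} \<in> sets \<mu>"
proof -
  have "Measurable.pred \<mu> (\<lambda>w. (w \<in> A) \<noteq> (w - h \<in> A))" by measurable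
  then show ?thesis by (simp add: pred_def)
qed

lemma sd_add_le: "sd (h + k) \<le> sd h + sd k"
proof -
  have "sd (h + k) \<le> prob ({w. (w \<in> A) \<noteq> (w - h \<in> A)} \<union> shell h k)"
    unfolding sd_def using sd_measurable_set[of h] shell_sets[of h k]
    by (intro finite_measure_mono sets.Un) (auto simp: shell_def diff_diff_eq)
  also have "\<dots> \<le> prob {w. (w \<in> A) \<noteq> (w - h \<in> A)} + prob (shell h k)"
    using sd_measurable_set by (intro measure_Un_le) auto
  finally show ?thesis by (simp add: prob_shell sd_def)
qed

lemma sd_uminus [simp]: "sd (- h) = sd h"
proof -
  have "prob {w. ((w - h) \<in> A) \<noteq> ((w - h) + h \<in> A)} = prob {w. (w \<in> A) \<noteq> (w + h \<in> A)}"
    using measure_translate[of "\<lambda>w. (w \<in> A) \<noteq> (w + h \<in> A)" "- h"] by simp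
  moreover have "{w. ((w - h) \<in> A) \<noteq> ((w - h) + h \<in> A)} = {w. (w \<in> A) \<noteq> (w - h \<in> A)}" by auto
  ultimately show ?thesis by (simp add: sd_def)
qed

text \<open>Subadditivity and evenness make \<open>sd\<close> behave like a seminorm on the group,
  so its continuity follows from continuity at 0.\<close>

lemma sd_diff_le: "\<bar>sd h - sd k\<bar> \<le> sd (h - k)"
  using sd_add_le[of "h - k" k] sd_add_le[of "k - h" h] sd_uminus[of "h - k"] by (simp add: abs_le_iff)

end

section \<open>Integrals of exponentials of homogeneous functions\<close>

lemma nn_integral_lborel_scale:
  fixes f :: "'a::euclidean_space \<Rightarrow> ennreal"
  assumes [measurable]: "f \<in> borel_measurable borel" and c: "0 < c"
  shows "(\<integral>\<^sup>+x. f x \<partial>lborel) = ennreal (c ^ DIM('a)) * (\<integral>\<^sup>+x. f (c *\<^sub>R x) \<partial>lborel)"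
proof -
  have m[measurable]: "(\<lambda>x::'a. c *\<^sub>R x) \<in> borel_measurable borel" by measurable
  have "(\<integral>\<^sup>+x. f x \<partial>lborel) = (\<integral>\<^sup>+x. f x \<partial>density (distr lborel borel (\<lambda>x. 0 + c *\<^sub>R x)) (\<lambda>_. ennreal (\<bar>c\<bar> ^ DIM('a))))"
    using c by (subst lborel_affine[of c 0]) auto
  also have "\<dots> = ennreal (c ^ DIM('a)) * (\<integral>\<^sup>+x. f (c *\<^sub>R x) \<partial>lborel)"
    using c by (subst nn_integral_density) (auto simp: nn_integral_distr nn_integral_cmult)
  finally show ?thesis .
qed

lemma nn_integral_exp_tail: "(\<integral>\<^sup>+r. ennreal (exp (- r)) * indicator {a..} r \<partial>lborel) = ennreal (exp (- a))"
proof -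
  have "((\<lambda>r::real. - exp (- r)) \<longlongrightarrow> - 0) at_top"
    by (intro tendsto_minus filterlim_compose[OF exp_at_bot filterlim_uminus_at_bot_at_top])
  then have "(\<integral>\<^sup>+r. ennreal (exp (- r)) * indicator {a..} r \<partial>lborel) = ennreal (- 0 - (- exp (- a)))"
    by (intro nn_integral_FTC_atLeast) (auto intro!: derivative_eq_intros)
  then show ?thesis by simp
qed

text \<open>Layer-cake argument: exp (- N u) is the integral of exp (- r) over r \<ge> N u. The
  sublevel sets have area r^2 times that of the unit one, and the integral of r^2 exp (- r) over the
  half line is 2. Rescaling by \<open>s\<close> gives the denominator.\<close>

lemma nn_integral_exp_gauge:
  fixes N :: "real^2 \<Rightarrow> real"
  assumes [measurable]: "N \<in> borel_measurable borel"
    and nonneg: "\<And>u. 0 \<le> N u" and hom: "\<And>t u. 0 \<le> t \<Longrightarrow> N (t *\<^sub>R u) = t * N u" and s: "0 < s"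
  shows "(\<integral>\<^sup>+u. ennreal (exp (- (s * N u))) \<partial>lborel) = 2 * emeasure lborel {u. N u \<le> 1} / ennreal (s\<^sup>2)"
proof -
  let ?a = "emeasure lborel {u. N u \<le> 1}"
  have "(\<integral>\<^sup>+u. ennreal (exp (- N u)) \<partial>lborel) = (\<integral>\<^sup>+u. \<integral>\<^sup>+r. ennreal (exp (- r)) * indicator {N u..} r \<partial>lborel \<partial>lborel)"
    by (simp add: nn_integral_exp_tail)
  also have "\<dots> = (\<integral>\<^sup>+r. \<integral>\<^sup>+u. ennreal (exp (- r)) * indicator {u. N u \<le> r} u \<partial>lborel \<partial>lborel)"
  proof -
    have "(\<integral>\<^sup>+u. \<integral>\<^sup>+r. ennreal (exp (- r)) * indicator {N u..} r \<partial>lborel \<partial>lborel)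
        = (\<integral>\<^sup>+u. \<integral>\<^sup>+r. ennreal (exp (- r)) * (if N u \<le> r then 1 else 0) \<partial>lborel \<partial>lborel)"
      by (intro nn_integral_cong) (auto split: split_indicator)
    also have "\<dots> = (\<integral>\<^sup>+r. \<integral>\<^sup>+u. ennreal (exp (- r)) * (if N u \<le> r then 1 else 0) \<partial>lborel \<partial>lborel)"
      by (rule pair_sigma_finite.Fubini')
        (auto simp: pair_sigma_finite_def sigma_finite_lborel split_beta')
    also have "\<dots> = (\<integral>\<^sup>+r. \<integral>\<^sup>+u. ennreal (exp (- r)) * indicator {u. N u \<le> r} u \<partial>lborel \<partial>lborel)"
      by (intro nn_integral_cong) (auto split: split_indicator)
    finally show ?thesis .
  qed
  also have "\<dots> = (\<integral>\<^sup>+r. ennreal (exp (- r)) * emeasure lborel {u. N u \<le> r} \<partial>lborel)"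
    by (intro nn_integral_cong nn_integral_cmult_indicator) measurable
  also have "\<dots> = (\<integral>\<^sup>+r. (ennreal (r ^ 2 * exp (- r)) * indicator {0..} r) * ?a \<partial>lborel)"
  proof (rule nn_integral_cong_AE)
    \<comment> \<open>The scaling of sublevel sets needs \<open>r > 0\<close>, and for
      \<open>r < 0\<close> they are empty; the single value 0 is discarded.\<close>
    have "AE r in lborel. r \<noteq> (0::real)" by (rule AE_lborel_singleton)
    then show "AE r in lborel. ennreal (exp (- r)) * emeasure lborel {u. N u \<le> r}
        = (ennreal (r ^ 2 * exp (- r)) * indicator {0..} r) * ?a"
    proof eventually_elim
      case (elim r)
      show ?case
      proof (cases "0 < r")
        case True
        have [measurable]: "{u. N u \<le> r} \<in> sets borel" by measurable
        have "emeasure lborel {u. N u \<le> r} = (\<integral>\<^sup>+u. indicator {u. N u \<le> r} u \<partial>lborel)" by simp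
        also have "\<dots> = ennreal (r ^ DIM(real^2)) * (\<integral>\<^sup>+u. indicator {u. N u \<le> r} (r *\<^sub>R u) \<partial>lborel)"
          using True by (intro nn_integral_lborel_scale) auto
        also have "(\<integral>\<^sup>+u. indicator {u. N u \<le> r} (r *\<^sub>R u) \<partial>lborel) = (\<integral>\<^sup>+u. indicator {u. N u \<le> 1} u \<partial>lborel)"
          using True by (intro nn_integral_cong) (auto simp: hom split: split_indicator)
        also have "\<dots> = ?a" by simp
        finally show ?thesis using True by (simp add: ennreal_mult mult_ac)
      next
        case False
        then have "{u. N u \<le> r} = {}" using nonneg elim by (auto simp: not_le) (meson less_le_trans not_less_iff_gr_or_eq order.strict_trans2)
        then show ?thesis using False elim by simp
      qed
    qed
  qed
  also have "\<dots> = 2 * ?a"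
    using nn_intergal_power_times_exp_Ici[of 2] by (subst nn_integral_multc) (auto simp: numeral_2_eq_2)
  finally have 1: "(\<integral>\<^sup>+u. ennreal (exp (- N u)) \<partial>lborel) = 2 * ?a" .
  have "(\<integral>\<^sup>+u. ennreal (exp (- N u)) \<partial>lborel) = ennreal (s ^ DIM(real^2)) * (\<integral>\<^sup>+u. ennreal (exp (- N (s *\<^sub>R u))) \<partial>lborel)"
    using s by (intro nn_integral_lborel_scale) auto
  then have "2 * ?a = ennreal (s\<^sup>2) * (\<integral>\<^sup>+u. ennreal (exp (- (s * N u))) \<partial>lborel)"
    using s by (simp add: 1 hom)
  then have "2 * ?a / ennreal (s\<^sup>2) = (\<integral>\<^sup>+u. ennreal (exp (- (s * N u))) \<partial>lborel) * ennreal (s\<^sup>2) / ennreal (s\<^sup>2)"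
    by (simp only: mult.commute)
  also have "\<dots> = (\<integral>\<^sup>+u. ennreal (exp (- (s * N u))) \<partial>lborel)"
    using s by (intro mult_divide_eq_ennreal) auto
  finally show ?thesis ..
qed

text \<open>The connection set on the torus: the adjacency test of \<open>geom_graph\<close> says
  that \<open>x j - x i\<close> lies in it.\<close>

definition nbhd :: "(real^2) set \<Rightarrow> torus set" where
  "nbhd K = {t. torus_rep t \<in> K}"

abbreviation centre_cell :: "(real^2) set" where
  "centre_cell \<equiv> cell (\<chi> i. - 1 / 2)"

lemma torus_rep_cell: "v \<in> centre_cell \<Longrightarrow> torus_rep (torus_of v) = v"
proof -
  assume "v \<in> centre_cell"
  then have "- 1/2 \<le> v $ i" "v $ i < - 1/2 + 1" for i by (auto simp: cell_def)
  then have "\<lfloor>v $ i + 1/2\<rfloor> = 0" for i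
    unfolding floor_eq_iff by (smt (verit) field_sum_of_halves of_int_0)
  then show ?thesis by (simp add: torus_rep_torus_of vec_eq_iff)
qed

lemma mem_nbhd_cell: "v \<in> centre_cell \<Longrightarrow> torus_of v \<in> nbhd K \<longleftrightarrow> v \<in> K"
  by (simp add: nbhd_def torus_rep_cell)

lemma lattice_pt_uminus: "lattice_pt (- fst z, - snd z) = - lattice_pt z"
  by (simp add: vec_eq_iff forall_2)

lemma torus_of_0: "torus_of 0 = 0"
  using torus_of_diff[of 0 0] by simp

lemma torus_uniform_cell: "torus_uniform = distr (uniform_measure lborel (cell c)) torus_borel torus_of"
proof (rule measure_eqI)
  fix A assume "A \<in> sets torus_uniform"
  then have A: "A \<in> sets torus_borel" by simp
  have B: "torus_of -` A \<in> sets borel" using A by (simp add: sets_torus_borel)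
  show "emeasure torus_uniform A = emeasure (distr (uniform_measure lborel (cell c)) torus_borel torus_of) A"
    unfolding emeasure_torus_uniform_cell[OF A, of c] using A B
    by (subst emeasure_distr)
      (auto simp: emeasure_cell measurable_torus_of measurable_cong_sets[OF sets_uniform_measure refl]
        divide_ennreal_def Int_commute)
qed simp

lemma nn_integral_exp_norm:
  assumes "0 < s"
  shows "(\<integral>\<^sup>+u. ennreal (exp (- (s * norm (u :: real^2)))) \<partial>lborel) = ennreal (2 * pi / s\<^sup>2)"
proof -
  have "(\<integral>\<^sup>+u. ennreal (exp (- (s * norm (u :: real^2)))) \<partial>lborel)
      = 2 * emeasure lborel {u::real^2. norm u \<le> 1} / ennreal (s\<^sup>2)"
    using assms by (intro nn_integral_exp_gauge) auto
  also have "{u::real^2. norm u \<le> 1} = cball 0 1" by (auto simp: dist_norm)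
  also have "emeasure lborel (cball (0::real^2) 1) = ennreal pi"
    using emeasure_cball[of 1 "0 :: real^2"] by (simp add: unit_ball_vol_2)
  also have "2 * ennreal pi / ennreal (s\<^sup>2) = ennreal (2 * pi / s\<^sup>2)"
  proof -
    have "2 * ennreal pi = ennreal (2 * pi)" using ennreal_mult[of 2 pi] by simp
    then show ?thesis using assms by (simp only:) (rule divide_ennreal; simp)
  qed
  finally show ?thesis .
qed

locale torus_body = planar_body +
  assumes small: "K \<subseteq> {v. \<forall>i. - 1/2 < v $ i \<and> v $ i < 1/2}"
begin

lemma K_cell: "K \<subseteq> centre_cell"
  using small by (force simp: cell_def less_imp_le)

text \<open>Seen in the plane, \<open>nbhd K\<close> is the union of the lattice translates of
  \<open>K\<close>. This form is free of floors and visibly symmetric, although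
  \<open>torus_rep\<close> does not commute with negation everywhere.\<close>

lemma mem_nbhd_iff: "torus_of v \<in> nbhd K \<longleftrightarrow> (\<exists>z. v + lattice_pt z \<in> K)"
proof
  assume "torus_of v \<in> nbhd K"
  then have in_K: "torus_rep (torus_of v) \<in> K" by (simp add: nbhd_def)
  have "torus_rep (torus_of v) = v + lattice_pt (- \<lfloor>v $ 1 + 1/2\<rfloor>, - \<lfloor>v $ 2 + 1/2\<rfloor>)"
    by (simp add: torus_rep_torus_of vec_eq_iff forall_2)
  with in_K show "\<exists>z. v + lattice_pt z \<in> K" by metis
next
  assume "\<exists>z. v + lattice_pt z \<in> K"
  then obtain z where z: "v + lattice_pt z \<in> K" by blast
  have "torus_rep (torus_of v) = torus_rep (torus_of (v + lattice_pt z))" by (simp add: torus_of_lattice_add)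
  also have "\<dots> = v + lattice_pt z" using z K_cell by (intro torus_rep_cell) auto
  finally show "torus_of v \<in> nbhd K" using z by (simp add: nbhd_def)
qed

lemma nbhd_uminus: "t \<in> nbhd K \<Longrightarrow> - t \<in> nbhd K"
proof -
  assume t: "t \<in> nbhd K"
  obtain v where v: "t = torus_of v" using surj_torus_of by blast
  obtain z where "v + lattice_pt z \<in> K" using t unfolding v mem_nbhd_iff by blast
  then have "- v + lattice_pt (- fst z, - snd z) \<in> K"
    using minus_in by (force simp: lattice_pt_uminus)
  then show ?thesis unfolding v torus_of_uminus[symmetric] mem_nbhd_iff by blast
qed

sublocale invariant_prob_space torus_uniform "nbhd K"
proof -
  interpret prob_space torus_uniform by (rule prob_space_torus_uniform)
  show "invariant_prob_space torus_uniform (nbhd K)"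
  proof
    show "(\<lambda>p. fst p + snd p) \<in> measurable (torus_uniform \<Otimes>\<^sub>M torus_uniform) torus_uniform"
      using measurable_torus_add by (simp cong: measurable_cong_sets sets_pair_measure_cong)
    show "uminus \<in> measurable torus_uniform torus_uniform"
      using measurable_torus_uminus by (simp cong: measurable_cong_sets)
    show "distr torus_uniform torus_uniform (\<lambda>x. x + c) = torus_uniform" for c
      by (rule torus_uniform_translate)
    have "torus_rep -` K \<inter> space torus_borel \<in> sets torus_borel"
      by (rule measurable_sets[OF measurable_torus_rep K_borel])
    then show "nbhd K \<in> sets torus_uniform"
      by (simp add: nbhd_def vimage_def space_torus_borel)
    have "torus_of 0 \<in> nbhd K" using zero_in by (subst mem_nbhd_cell) (auto simp: cell_def)
    then show "0 \<in> nbhd K" using torus_of_diff[of 0 0] by simp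
    show "w \<in> nbhd K \<longleftrightarrow> - w \<in> nbhd K" for w
      using nbhd_uminus[of w] nbhd_uminus[of "- w"] by auto
  qed simp
qed

lemma nn_integral_nbhd:
  assumes [measurable]: "f \<in> borel_measurable torus_uniform"
  shows "(\<integral>\<^sup>+h. of_bool (h \<in> nbhd K) * f h \<partial>torus_uniform) = (\<integral>\<^sup>+v. of_bool (v \<in> K) * f (torus_of v) \<partial>lborel)"
proof -
  let ?U = "uniform_measure lborel centre_cell"
  have [measurable]: "f \<in> borel_measurable torus_borel"
    using assms by (simp cong: measurable_cong_sets)
  have nb: "nbhd K \<in> sets torus_borel" using A_sets by simp
  have [measurable]: "torus_of \<in> measurable borel torus_borel" by (rule measurable_torus_of)
  have "(\<integral>\<^sup>+h. of_bool (h \<in> nbhd K) * f h \<partial>torus_uniform) = (\<integral>\<^sup>+v. of_bool (torus_of v \<in> nbhd K) * f (torus_of v) \<partial>?U)"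
    using nb by (subst torus_uniform_cell[of "\<chi> i. - 1 / 2"], subst nn_integral_distr)
      (auto simp: measurable_cong_sets[OF sets_uniform_measure refl])
  also have "\<dots> = (\<integral>\<^sup>+v. (of_bool (torus_of v \<in> nbhd K) * f (torus_of v)) * indicator centre_cell v \<partial>lborel) / emeasure lborel centre_cell"
    using nb by (subst nn_integral_uniform_measure) auto
  also have "\<dots> = (\<integral>\<^sup>+v. of_bool (v \<in> K) * f (torus_of v) \<partial>lborel)"
    using K_cell by (auto simp: emeasure_cell divide_ennreal_def mem_nbhd_cell split: split_indicator intro!: nn_integral_cong)
  finally show ?thesis .
qed

text \<open>Compactness keeps \<open>K\<close> at a positive distance from the boundary of the
  square. This gap is what prevents small shifts from wrapping around.\<close>

lemma coord_bound: obtains m where "0 \<le> m" "m < 1/2" "\<And>v i. v \<in> K \<Longrightarrow> \<bar>v $ i\<bar> \<le> m"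
proof -
  have "\<exists>v\<in>K. \<forall>w\<in>K. \<bar>w $ i\<bar> \<le> \<bar>v $ i\<bar>" for i
    using zero_in by (intro continuous_attains_sup compact_K continuous_intros) auto
  then obtain v1 v2 where v: "v1 \<in> K" "\<And>w. w \<in> K \<Longrightarrow> \<bar>w $ 1\<bar> \<le> \<bar>v1 $ 1\<bar>"
    "v2 \<in> K" "\<And>w. w \<in> K \<Longrightarrow> \<bar>w $ 2\<bar> \<le> \<bar>v2 $ 2\<bar>" by metis
  have lt: "\<bar>v $ i\<bar> < 1/2" if "v \<in> K" for v i
  proof -
    have "- 1/2 < v $ i \<and> v $ i < 1/2" using small that by blast
    then show ?thesis by linarith
  qed
  show thesis
  proof (rule that[of "max \<bar>v1 $ 1\<bar> \<bar>v2 $ 2\<bar>"])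
    show "\<bar>v $ i\<bar> \<le> max \<bar>v1 $ 1\<bar> \<bar>v2 $ 2\<bar>" if "v \<in> K" for v i
      using exhaust_2[of i] v(2)[OF that] v(4)[OF that] by auto
    show "max \<bar>v1 $ 1\<bar> \<bar>v2 $ 2\<bar> < 1 / 2" using lt[OF v(1), of 1] lt[OF v(3), of 2] by simp
  qed simp
qed

text \<open>A shift shorter than the gap \<open>1/2 - m\<close> carries no part of \<open>K\<close>
  across the boundary of the centred cell, so the symmetric difference on the torus is the planar
  one.\<close>

lemma sd_torus_of_small: "\<exists>\<delta>>0. \<forall>h. norm h < \<delta> \<longrightarrow> sd (torus_of h) = measure lborel (shift_diff K h)"
proof -
  obtain m where m: "0 \<le> m" "m < 1/2" "\<And>v i. v \<in> K \<Longrightarrow> \<bar>v $ i\<bar> \<le> m" using coord_bound by blast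
  have "sd (torus_of h) = measure lborel (shift_diff K h)" if h: "norm h < 1/2 - m" for h
  proof -
    have hi: "\<bar>h $ i\<bar> < 1/2 - m" for i using component_le_norm_cart[of h i] h by linarith
    let ?S = "{w. (w \<in> nbhd K) \<noteq> (w - torus_of h \<in> nbhd K)}"
    have "?S \<in> sets torus_borel" using sd_measurable_set by simp
    from emeasure_torus_uniform_cell[OF this, of "\<chi> i. - 1 / 2"]
    have "emeasure torus_uniform ?S = emeasure lborel (torus_of -` ?S \<inter> centre_cell)" .
    also have "torus_of -` ?S \<inter> centre_cell = shift_diff K h"
    proof -
      have cc: "v \<in> centre_cell \<longleftrightarrow> (\<forall>i. - 1/2 \<le> v $ i \<and> v $ i < 1/2)" for v
        by (simp add: cell_def)
      have shift: "torus_of (v - h) \<in> nbhd K \<longleftrightarrow> v - h \<in> K" if v: "v \<in> centre_cell" for v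
      proof
        assume "torus_of (v - h) \<in> nbhd K"
        then obtain z where z: "v - h + lattice_pt z \<in> K" unfolding mem_nbhd_iff by blast
        \<comment> \<open>Here |k| < m + (1/2 - m) + 1/2 = 1, by the bounds on the shifted point, on
          \<open>h\<close> and on the cell.\<close>
        have z0: "k = 0" if "\<bar>v $ i - h $ i + real_of_int k\<bar> \<le> m" for i k
        proof -
          have "\<bar>real_of_int k\<bar> < 1"
            using that hi[of i] v[unfolded cc, rule_format, of i] by linarith
          then show ?thesis by linarith
        qed
        have "fst z = 0" using z0[of 1 "fst z"] m(3)[OF z, of 1] by simp
        moreover have "snd z = 0" using z0[of 2 "snd z"] m(3)[OF z, of 2] by simp
        ultimately have "lattice_pt z = 0" by (simp add: vec_eq_iff forall_2)
        then show "v - h \<in> K" using z by simp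
      next
        assume "v - h \<in> K"
        then show "torus_of (v - h) \<in> nbhd K" using K_cell by (subst mem_nbhd_cell) auto
      qed
      have "v \<in> centre_cell" if "v \<in> shift_diff K h" for v
      proof -
        have "v \<in> K \<or> v - h \<in> K" using that by (auto simp: shift_diff_def)
        then show ?thesis
        proof
          assume "v - h \<in> K"
          then have "\<bar>v $ i - h $ i\<bar> \<le> m" for i using m(3)[of "v - h" i] by simp
          then have "- 1/2 \<le> v $ i \<and> v $ i < 1/2" for i
            using hi[of i] by (smt (verit, best) field_sum_of_halves)
          then show ?thesis using cc by blast
        qed (use K_cell in auto)
      qed
      then show ?thesis
        using shift mem_nbhd_cell by (auto simp: shift_diff_def torus_of_diff[symmetric])
    qed
    finally show ?thesis by (simp add: sd_def measure_def)
  qed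
  then show ?thesis using m(2) by (intro exI[of _ "1/2 - m"]) auto
qed

lemma sd_scale_nat: "sd (torus_of (real k *\<^sub>R v)) \<le> real k * sd (torus_of v)"
proof (induction k)
  case (Suc k)
  have "torus_of (real (Suc k) *\<^sub>R v) = torus_of v + torus_of (real k *\<^sub>R v)"
    by (simp add: scaleR_left_distrib torus_of_add)
  then have "sd (torus_of (real (Suc k) *\<^sub>R v)) \<le> sd (torus_of v) + sd (torus_of (real k *\<^sub>R v))"
    by (simp only: sd_add_le)
  with Suc show ?case by (simp add: algebra_simps)
qed (simp add: torus_of_0)

lemma continuous_sd: "continuous_on UNIV (\<lambda>v. sd (torus_of v))"
proof (rule continuous_onI)
  fix v :: "real^2" and e :: real
  assume e: "0 < e"
  obtain \<delta> where d: "0 < \<delta>" "\<And>h. norm h < \<delta> \<Longrightarrow> sd (torus_of h) = measure lborel (shift_diff K h)"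
    using sd_torus_of_small by blast
  obtain c where c: "0 < c" "\<And>u. width_fun K u \<le> c * norm u" using width_fun_le_norm by blast
  show "\<exists>d>0. \<forall>v'\<in>UNIV. dist v' v < d \<longrightarrow> dist (sd (torus_of v')) (sd (torus_of v)) \<le> e"
  proof (intro exI[of _ "min \<delta> (e / (4 * c))"] conjI ballI impI)
    fix v' assume v': "dist v' v < min \<delta> (e / (4 * c))"
    have "dist (sd (torus_of v')) (sd (torus_of v)) \<le> sd (torus_of (v' - v))"
      using sd_diff_le by (simp add: dist_real_def torus_of_diff)
    also have "\<dots> = measure lborel (shift_diff K (v' - v))" using v' by (intro d) (simp add: dist_norm)
    also have "\<dots> \<le> 4 * (c * norm (v' - v))"
      using measure_shift_diff_le[of "v' - v"] c(2)[of "v' - v"] by linarith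
    also have "\<dots> \<le> e" using v' c(1) by (simp add: dist_norm field_simps)
    finally show "dist (sd (torus_of v')) (sd (torus_of v)) \<le> e" .
  qed (use d c e in auto)
qed

text \<open>
  With \<open>a\<close> the maximum of the \<open>i\<close>-th coordinate on \<open>K\<close>, shifting by \<open>v\<close> moves a piece of \<open>K\<close> into the
  strip between \<open>a\<close> and \<open>1 - a\<close>, which misses all integer translates of \<open>K\<close>.
\<close>

lemma sd_pos_coord:
  assumes v: "v \<in> K" "0 < v $ i"
  shows "0 < sd (torus_of v)"
proof -
  obtain p where p: "p \<in> K" "\<And>w. w \<in> K \<Longrightarrow> w $ i \<le> p $ i"
  proof -
    have "continuous_on K (\<lambda>w. w $ i)" by (intro continuous_intros)
    from continuous_attains_sup[OF compact_K _ this] zero_in that show thesis by blast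
  qed
  define a where "a = p $ i"
  have a: "v $ i \<le> a" "a < 1/2" "\<And>w. w \<in> K \<Longrightarrow> - a \<le> w $ i \<and> w $ i \<le> a"
    using p v small minus_in by (force simp: a_def)+
  \<comment> \<open>A level of the \<open>i\<close>-th coordinate inside \<open>K\<close> that
    \<open>v\<close> carries into the strip: \<open>s + v $ i\<close> exceeds \<open>a\<close> by
    half of the minimum, so it stays below \<open>1 - a\<close>, while \<open>s\<close> itself stays
    below \<open>a\<close>.\<close>
  define s where "s = a - v $ i + min (v $ i) (1 - 2 * a) / 2"
  have s: "a - v $ i < s" "s < a" "s + v $ i < 1 - a" "0 \<le> s"
  proof -
    define r where "r = min (v $ i) (1 - 2 * a)"
    have "r \<le> v $ i" "r \<le> 1 - 2 * a" "0 < r" using a v by (auto simp: r_def)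
    then show "a - v $ i < s" "s < a" "s + v $ i < 1 - a" "0 \<le> s"
      using a(1,2) unfolding s_def r_def[symmetric] by linarith+
  qed
  define w where "w = (s / a) *\<^sub>R p"
  have a0: "0 < a" using a(1) v(2) by linarith
  have wi: "w $ i = s" using a0 by (simp add: w_def a_def)
  have "w \<in> interior K"
  proof -
    have "0 \<le> s / a" "s / a < 1" using s a0 by simp_all
    then show ?thesis unfolding w_def by (intro shrink_interior p) simp
  qed
  define G where "G = interior K \<inter> {x. a - v $ i < x $ i} \<inter> {x. x $ i < 1 - a - v $ i}"
  have "open G" unfolding G_def by (intro open_Int open_interior open_Collect_less continuous_intros)
  moreover have "w \<in> G" using \<open>w \<in> interior K\<close> s by (auto simp: G_def wi)
  ultimately obtain e where e: "0 < e" "ball w e \<subseteq> G" by (auto simp: open_contains_ball)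
  \<comment> \<open>The shift is taken with the opposite sign so that the translated points are
    \<open>x + v\<close>; \<open>sd\<close> is even.\<close>
  let ?S = "{x. (x \<in> nbhd K) \<noteq> (x - torus_of (- v) \<in> nbhd K)}"
  have out: "torus_of (x + v) \<notin> nbhd K" if "x \<in> G" for x
  proof
    assume "torus_of (x + v) \<in> nbhd K"
    then obtain z where z: "x + v + lattice_pt z \<in> K" unfolding mem_nbhd_iff by blast
    define k where "k = (if i = 1 then fst z else snd z)"
    have "(x + v + lattice_pt z) $ i = x $ i + v $ i + real_of_int k"
      using exhaust_2[of i] by (auto simp: k_def)
    then have "- a \<le> x $ i + v $ i + real_of_int k" "x $ i + v $ i + real_of_int k \<le> a"
      using a(3)[OF z] by auto
    moreover have "a < x $ i + v $ i" "x $ i + v $ i < 1 - a" using that by (auto simp: G_def)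
    ultimately have "real_of_int (- 1) < real_of_int k" "real_of_int k < real_of_int 0" by simp_all
    then have "- 1 < k" "k < 0" by (simp_all only: of_int_less_iff)
    then show False by linarith
  qed
  have "?S \<in> sets torus_borel" using sd_measurable_set by simp
  from emeasure_torus_uniform_cell[OF this, of "\<chi> i. - 1 / 2"]
  have "emeasure torus_uniform ?S = emeasure lborel (torus_of -` ?S \<inter> centre_cell)" .
  moreover have "emeasure lborel (ball w e) \<le> emeasure lborel (torus_of -` ?S \<inter> centre_cell)"
  proof (rule emeasure_mono)
    have "x \<in> K" if "x \<in> ball w e" for x using that e(2) interior_subset[of K] by (auto simp: G_def)
    then show "ball w e \<subseteq> torus_of -` ?S \<inter> centre_cell"
      using e(2) out K_cell mem_nbhd_cell by (auto simp: torus_of_diff[symmetric]) blast+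
    have "torus_of -` ?S \<in> sets borel" using \<open>?S \<in> sets torus_borel\<close> by (simp add: sets_torus_borel)
    then show "torus_of -` ?S \<inter> centre_cell \<in> sets lborel" by simp
  qed
  moreover have "0 < emeasure lborel (ball w e)" using e(1) by (simp add: emeasure_ball zero_less_power)
  ultimately have "0 < emeasure torus_uniform ?S" by (simp add: less_le_trans)
  then have "0 < sd (torus_of (- v))"
    by (simp add: sd_def emeasure_eq_measure)
  then show ?thesis by (simp add: torus_of_uminus)
qed

lemma sd_pos: assumes v: "v \<in> K" "v \<noteq> 0" shows "0 < sd (torus_of v)"
proof -
  obtain i where i: "v $ i \<noteq> 0" using v(2) by (auto simp: vec_eq_iff)
  show ?thesis
    using sd_pos_coord[OF v(1), of i] sd_pos_coord[OF minus_in[OF v(1)], of i] i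
    by (cases "0 < v $ i") (auto simp: torus_of_uminus)
qed

text \<open>
  Near \<open>0\<close>, some multiple \<open>k v\<close> lies in a compact part of \<open>K\<close> away from \<open>0\<close>, and \<open>sd\<close> is subadditive.
\<close>

lemma sd_lower: "\<exists>c>0. \<forall>v\<in>K. c * norm v \<le> sd (torus_of v)"
proof -
  obtain r where r: "0 < r" "cball 0 r \<subseteq> K" using zero_interior by (auto simp: mem_interior_cball)
  \<comment> \<open>Half of the radius leaves room for rounding up: the chosen multiple of
    \<open>v\<close> has norm between \<open>\<rho>\<close> and \<open>2 * \<rho> = r\<close>, hence
    stays in \<open>K\<close>.\<close>
  define \<rho> where "\<rho> = r / 2"
  have rho: "0 < \<rho>" using r by (simp add: \<rho>_def)
  let ?C = "K - ball 0 \<rho>"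
  have "compact ?C" by (intro compact_diff compact_K) simp
  have "\<exists>c0>0. \<forall>v\<in>?C. c0 \<le> sd (torus_of v)"
  proof (cases "?C = {}")
    case False
    then obtain v where v: "v \<in> ?C" "\<And>w. w \<in> ?C \<Longrightarrow> sd (torus_of v) \<le> sd (torus_of w)"
      using continuous_attains_inf[OF \<open>compact ?C\<close> False continuous_on_subset[OF continuous_sd subset_UNIV]] by blast
    then have "v \<in> K" "v \<noteq> 0" using rho by auto
    then show ?thesis using v(2) sd_pos[of v] by (intro exI[of _ "sd (torus_of v)"]) auto
  qed (auto intro: exI[of _ 1])
  then obtain c0 where c0: "0 < c0" "\<And>v. v \<in> K \<Longrightarrow> \<rho> \<le> norm v \<Longrightarrow> c0 \<le> sd (torus_of v)" by (auto simp: dist_norm)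
  obtain B where B: "0 < B" "\<And>v. v \<in> K \<Longrightarrow> norm v \<le> B" using bounded_K bounded_pos by metis
  \<comment> \<open>The second entry serves the vectors of norm at least \<open>\<rho>\<close>, the
    first one the shorter vectors.\<close>
  define c where "c = min (c0 / (2 * \<rho>)) (c0 / B)"
  have "c * norm v \<le> sd (torus_of v)" if v: "v \<in> K" for v
  proof (cases "\<rho> \<le> norm v")
    case True
    have "c * norm v \<le> (c0 / B) * B" using B(1) B(2)[OF v] c0 rho
      by (intro mult_mono) (auto simp: c_def)
    also have "\<dots> = c0" using B by simp
    also have "\<dots> \<le> sd (torus_of v)" by (rule c0(2)[OF v True])
    finally show ?thesis .
  next
    case False
    show ?thesis
    proof (cases "v = 0")
      case nz: False
      define k where "k = nat \<lceil>\<rho> / norm v\<rceil>"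
      have k: "\<rho> / norm v \<le> real k" "real k < \<rho> / norm v + 1"
        using rho nz by (auto simp: k_def) linarith+
      have n0: "0 < norm v" using nz by simp
      have kv: "\<rho> \<le> real k * norm v" "real k * norm v \<le> 2 * \<rho>"
      proof -
        show "\<rho> \<le> real k * norm v" using k(1) n0 by (simp add: divide_le_eq)
        have "real k * norm v \<le> (\<rho> / norm v + 1) * norm v" using k(2) n0 by (intro mult_right_mono) auto
        also have "\<dots> = \<rho> + norm v" using n0 by (simp add: field_simps)
        finally show "real k * norm v \<le> 2 * \<rho>" using False by simp
      qed
      have k0: "0 < real k" using kv(1) rho n0 by (metis mult_zero_left not_less of_nat_0_less_iff of_nat_0 neq0_conv)
      have "real k *\<^sub>R v \<in> K" using kv(2) r(2) by (auto simp: \<rho>_def)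
      moreover have "\<rho> \<le> norm (real k *\<^sub>R v)" using kv(1) by simp
      ultimately have "c0 \<le> sd (torus_of (real k *\<^sub>R v))" by (rule c0(2))
      also have "\<dots> \<le> real k * sd (torus_of v)" by (rule sd_scale_nat)
      finally have "c0 \<le> real k * sd (torus_of v)" .
      moreover have "real k * (c * norm v) \<le> c0"
      proof -
        have "real k * (c * norm v) = c * (real k * norm v)" by simp
        also have "\<dots> \<le> (c0 / (2 * \<rho>)) * (2 * \<rho>)"
          using kv(2) c0(1) rho n0 by (intro mult_mono[of c "c0 / (2 * \<rho>)" "real k * norm v" "2 * \<rho>"]) (auto simp: c_def)
        also have "\<dots> = c0" using rho by simp
        finally show ?thesis .
      qed
      ultimately have "real k * (c * norm v) \<le> real k * sd (torus_of v)" by linarith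
      then show ?thesis using k0 by (simp only: mult_le_cancel_left_pos)
    qed (simp)
  qed
  moreover have "0 < c" using c0 rho B by (simp add: c_def)
  ultimately show ?thesis by blast
qed

section \<open>Asymptotics of the mean twin probability on the torus\<close>

lemma laplace_le: "\<exists>C. \<forall>\<alpha>>0. laplace \<alpha> \<le> C / \<alpha>\<^sup>2"
proof -
  obtain c where c: "0 < c" "\<And>v. v \<in> K \<Longrightarrow> c * norm v \<le> sd (torus_of v)" using sd_lower by blast
  have "laplace \<alpha> \<le> (2 * pi / c\<^sup>2) / \<alpha>\<^sup>2" if \<alpha>: "0 < \<alpha>" for \<alpha>
  proof -
    have "ennreal (laplace \<alpha>) = (\<integral>\<^sup>+h. of_bool (h \<in> nbhd K) * ennreal (exp (- (\<alpha> * sd h))) \<partial>torus_uniform)"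
      using \<alpha> by (intro nn_laplace[symmetric]) auto
    also have "\<dots> = (\<integral>\<^sup>+v. of_bool (v \<in> K) * ennreal (exp (- (\<alpha> * sd (torus_of v)))) \<partial>lborel)"
      by (intro nn_integral_nbhd) measurable
    also have "\<dots> \<le> (\<integral>\<^sup>+v. ennreal (exp (- ((\<alpha> * c) * norm (v :: real^2)))) \<partial>lborel)"
    proof (rule nn_integral_mono)
      fix v
      show "of_bool (v \<in> K) * ennreal (exp (- (\<alpha> * sd (torus_of v)))) \<le> ennreal (exp (- ((\<alpha> * c) * norm v)))"
        using c(2)[of v] \<alpha> by (cases "v \<in> K") (auto intro!: ennreal_leI simp: mult.assoc)
    qed
    also have "\<dots> = ennreal (2 * pi / (\<alpha> * c)\<^sup>2)" using \<alpha> c by (intro nn_integral_exp_norm) simp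
    finally show ?thesis by (subst (asm) ennreal_le_iff) (auto simp: power_mult_distrib mult_ac)
  qed
  then show ?thesis by blast
qed

definition width_area :: real where
  "width_area = measure lborel {u. width_fun K u \<le> 1}"

lemma emeasure_width_le_1: "emeasure lborel {u. width_fun K u \<le> 1} = ennreal width_area"
proof -
  obtain r where r: "0 < r" "cball 0 r \<subseteq> K" using zero_interior by (auto simp: mem_interior_cball)
  have "bounded {u. width_fun K u \<le> 1}"
  proof (rule boundedI)
    fix u assume u: "u \<in> {u. width_fun K u \<le> 1}"
    show "norm u \<le> 1 / r"
    proof (cases "u = 0")
      case False
      \<comment> \<open>The vector of length \<open>r\<close> orthogonal to \<open>u\<close> lies in
        \<open>K\<close> and gives \<open>crossdet u p = r * norm u\<close>, so the sublevel set is
        contained in a disk.\<close>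
      define p where "p = (r / norm u) *\<^sub>R (vector [- u $ 2, u $ 1] :: real^2)"
      have nu: "norm u ^ 2 = (u $ 1)\<^sup>2 + (u $ 2)\<^sup>2"
        by (simp add: norm_vec_def L2_set_def UNIV_2 real_sqrt_pow2)
      have "norm (vector [- u $ 2, u $ 1] :: real^2) = norm u"
        by (simp add: norm_vec_def L2_set_def UNIV_2 add.commute)
      then have "p \<in> K" using r False by (intro subsetD[OF r(2)]) (simp add: p_def)
      then have "crossdet u p \<le> 1" using width_fun_upper[of p u] u by simp
      moreover have "crossdet u p = (r / norm u) * norm u ^ 2"
        unfolding nu by (simp add: crossdet_def p_def power2_eq_square algebra_simps)
      ultimately have "r * norm u \<le> 1" using False by (simp add: power2_eq_square)
      then show ?thesis using r(1) by (simp add: field_simps)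
    qed (use r in simp)
  qed
  then have "emeasure lborel {u. width_fun K u \<le> 1} < \<infinity>"
    by (rule emeasure_bounded_finite)
  then show ?thesis by (simp add: width_area_def emeasure_eq_ennreal_measure)
qed

lemma nn_integral_exp_width: "(\<integral>\<^sup>+u. ennreal (exp (- (4 * width_fun K u))) \<partial>lborel) = ennreal (width_area / 8)"
proof -
  have "(\<integral>\<^sup>+u. ennreal (exp (- (4 * width_fun K u))) \<partial>lborel) = 2 * ennreal width_area / ennreal (4\<^sup>2)"
    unfolding emeasure_width_le_1[symmetric]
    by (intro nn_integral_exp_gauge width_fun_nonneg width_fun_scale) auto
  also have "\<dots> = ennreal (width_area / 8)"
  proof -
    have nonneg: "0 \<le> width_area" by (simp add: width_area_def)
    then have "2 * ennreal width_area = ennreal (2 * width_area)" using ennreal_mult[of 2 width_area] by simp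
    also have "\<dots> / ennreal (4\<^sup>2) = ennreal (2 * width_area / 4\<^sup>2)"
      using nonneg by (intro divide_ennreal) auto
    finally show ?thesis by simp
  qed
  finally show ?thesis .
qed

text \<open>Substituting v = u / n absorbs the factor n^2 and turns the integrand into (1 -
  \<sigma>(u / n))^n, which tends to exp (- 4 w(u)); the linear lower bound for \<open>sd\<close>
  supplies an exponential majorant. The limit is twice the Poisson rate.\<close>

lemma tendsto_mean_void: "(\<lambda>n. (real n)\<^sup>2 * mean_void n) \<longlonglongrightarrow> width_area / 8"
proof -
  obtain c where c: "0 < c" "\<And>v. v \<in> K \<Longrightarrow> c * norm v \<le> sd (torus_of v)" using sd_lower by blast
  obtain \<delta> where d: "0 < \<delta>" "\<And>h. norm h < \<delta> \<Longrightarrow> sd (torus_of h) = measure lborel (shift_diff K h)"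
    using sd_torus_of_small by blast
  obtain r where r: "0 < r" "cball 0 r \<subseteq> K" using zero_interior by (auto simp: mem_interior_cball)
  have [measurable]: "torus_of \<in> measurable borel torus_uniform"
    using measurable_torus_of by (simp cong: measurable_cong_sets)
  define F where "F n u = of_bool ((1 / real n) *\<^sub>R u \<in> K) * ennreal ((1 - sd (torus_of ((1 / real n) *\<^sub>R u))) ^ n)" for n and u :: "real^2"
  have [measurable]: "F n \<in> borel_measurable borel" for n
    unfolding F_def by measurable
  have scaled: "ennreal ((real n)\<^sup>2 * mean_void n) = (\<integral>\<^sup>+u. F n u \<partial>lborel)" if n: "0 < n" for n
  proof -
    have "ennreal (mean_void n) = (\<integral>\<^sup>+h. of_bool (h \<in> nbhd K) * ennreal ((1 - sd h) ^ n) \<partial>torus_uniform)"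
      by (rule nn_mean_void[symmetric])
    also have "\<dots> = (\<integral>\<^sup>+v. of_bool (v \<in> K) * ennreal ((1 - sd (torus_of v)) ^ n) \<partial>lborel)"
      by (intro nn_integral_nbhd) measurable
    also have "\<dots> = ennreal ((1 / real n) ^ DIM(real^2)) * (\<integral>\<^sup>+u. F n u \<partial>lborel)"
      unfolding F_def using n by (intro nn_integral_lborel_scale) auto
    finally have "ennreal ((real n)\<^sup>2) * ennreal (mean_void n) = ennreal ((real n)\<^sup>2) * (ennreal ((1 / real n)\<^sup>2) * (\<integral>\<^sup>+u. F n u \<partial>lborel))"
      by simp
    also have "\<dots> = (\<integral>\<^sup>+u. F n u \<partial>lborel)"
      unfolding mult.assoc[symmetric] using n by (simp add: ennreal_mult[symmetric] power_divide)
    finally show ?thesis by (simp add: ennreal_mult mean_void_nonneg)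
  qed
  \<comment> \<open>The index is shifted because \<open>1 / real 0\<close> is 0: the function
    \<open>F 0\<close> is constantly 1 and has no integrable majorant.\<close>
  have "(\<lambda>n. \<integral>\<^sup>+u. F (Suc n) u \<partial>lborel) \<longlonglongrightarrow> (\<integral>\<^sup>+u. ennreal (exp (- (4 * width_fun K u))) \<partial>lborel)"
  proof (rule nn_integral_dominated_convergence[where w = "\<lambda>u. ennreal (exp (- (c * norm u)))"])
    show "(\<integral>\<^sup>+u. ennreal (exp (- (c * norm (u::real^2)))) \<partial>lborel) < \<infinity>"
      using nn_integral_exp_norm[OF c(1)] by simp
    fix n
    show "AE u in lborel. F (Suc n) u \<le> ennreal (exp (- (c * norm u)))"
    proof (rule AE_I2)
      fix u :: "real^2"
      let ?v = "(1 / real (Suc n)) *\<^sub>R u"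
      show "F (Suc n) u \<le> ennreal (exp (- (c * norm u)))"
      proof (cases "?v \<in> K")
        case True
        have "(1 - sd (torus_of ?v)) ^ Suc n \<le> exp (- (real (Suc n) * sd (torus_of ?v)))"
          by (rule one_minus_power_le_exp) auto
        also have "\<dots> \<le> exp (- (real (Suc n) * (c * norm ?v)))"
          using mult_left_mono[OF c(2)[OF True], of "real (Suc n)"] by (simp del: of_nat_Suc)
        also have "real (Suc n) * (c * norm ?v) = c * norm u" by (simp del: of_nat_Suc)
        finally show ?thesis using True by (simp add: F_def ennreal_leI del: of_nat_Suc power_Suc)
      qed (simp add: F_def)
    qed
  next
    show "AE u in lborel. (\<lambda>n. F (Suc n) u) \<longlonglongrightarrow> ennreal (exp (- (4 * width_fun K u)))"
    proof (rule AE_I2)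
      fix u :: "real^2"
      have small: "(\<lambda>n. norm ((1 / real n) *\<^sub>R u)) \<longlonglongrightarrow> 0"
        using tendsto_mult[OF lim_1_over_n tendsto_const[of "norm u"]] by simp
      have ev: "eventually (\<lambda>n. F n u = ennreal ((1 - measure lborel (shift_diff K ((1 / real n) *\<^sub>R u))) ^ n)) sequentially"
        using order_tendstoD(2)[OF small d(1)] order_tendstoD(2)[OF small r(1)]
      proof eventually_elim
        case (elim n)
        then have "(1 / real n) *\<^sub>R u \<in> K" using r(2) by auto
        then show ?case using elim(1) by (simp add: F_def d(2))
      qed
      define W where "W = 4 * width_fun K u"
      define s where "s n = measure lborel (shift_diff K ((1 / real n) *\<^sub>R u))" for n
      have W: "0 \<le> W" using width_fun_nonneg by (simp add: W_def)
      have s: "(\<lambda>n. real n * s n) \<longlonglongrightarrow> W" unfolding s_def W_def by (rule tendsto_measure_shift_diff)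
      have s1: "(\<lambda>n. s n) \<longlonglongrightarrow> 0"
      proof -
        have "(\<lambda>n. real n * s n * (1 / real n)) \<longlonglongrightarrow> W * 0" by (intro tendsto_mult s lim_1_over_n)
        then show ?thesis
          unfolding mult_zero_right
          by (rule Lim_transform_eventually) (auto simp: eventually_sequentially intro!: exI[of _ 1])
      qed
      have "(\<lambda>n. (1 - s n) ^ n) \<longlonglongrightarrow> exp (- W)"
      proof -
        have lim: "(\<lambda>n. (1 + - W / real n) ^ n) \<longlonglongrightarrow> exp (- W)" by (rule tendsto_exp_limit_sequentially)
        \<comment> \<open>Comparison with a sequence of known limit: for numbers of modulus at most
          1, the \<open>n\<close>-th powers differ by at most \<open>n\<close> times the difference
          of the bases.\<close>
        have "(\<lambda>n. (1 - s n) ^ n - (1 + - W / real n) ^ n) \<longlonglongrightarrow> 0"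
        proof (rule Lim_null_comparison)
          have "(\<lambda>n. \<bar>real n * s n - W\<bar>) \<longlonglongrightarrow> \<bar>W - W\<bar>" by (intro tendsto_intros s)
          then show "(\<lambda>n. \<bar>real n * s n - W\<bar>) \<longlonglongrightarrow> 0" by simp
          have "eventually (\<lambda>n. W < real n) sequentially"
            using filterlim_real_sequentially by (simp add: filterlim_at_top_dense)
          with order_tendstoD(2)[OF s1 zero_less_one] eventually_gt_at_top[of "0::nat"]
          show "eventually (\<lambda>n. norm ((1 - s n) ^ n - (1 + - W / real n) ^ n) \<le> \<bar>real n * s n - W\<bar>) sequentially"
          proof eventually_elim
            case (elim n)
            have "norm ((1 - s n) ^ n - (1 + - W / real n) ^ n) \<le> real n * norm ((1 - s n) - (1 + - W / real n))"
            proof (rule norm_power_diff)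
              show "norm (1 - s n) \<le> 1" using elim(1) by (simp add: s_def)
              show "norm (1 + - W / real n) \<le> 1" using elim W by (simp add: abs_le_iff)
            qed
            also have "\<dots> = \<bar>real n * ((1 - s n) - (1 + - W / real n))\<bar>" by (simp add: abs_mult)
            also have "real n * ((1 - s n) - (1 + - W / real n)) = W - real n * s n"
              using elim by (simp add: field_simps)
            finally show ?case by (simp add: abs_minus_commute)
          qed
        qed
        from tendsto_add[OF this lim] show ?thesis by simp
      qed
      then have "(\<lambda>n. ennreal ((1 - s n) ^ n)) \<longlonglongrightarrow> ennreal (exp (- W))"
        by (rule tendsto_ennrealI)
      moreover have "eventually (\<lambda>n. ennreal ((1 - s n) ^ n) = F n u) sequentially"
        using ev by eventually_elim (simp add: s_def)
      ultimately have "(\<lambda>n. F n u) \<longlonglongrightarrow> ennreal (exp (- W))"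
        by (rule Lim_transform_eventually)
      then show "(\<lambda>n. F (Suc n) u) \<longlonglongrightarrow> ennreal (exp (- (4 * width_fun K u)))"
        unfolding W_def by (rule LIMSEQ_Suc)
    qed
  qed measurable
  then have "(\<lambda>n. \<integral>\<^sup>+u. F n u \<partial>lborel) \<longlonglongrightarrow> ennreal (width_area / 8)"
    unfolding nn_integral_exp_width by (rule LIMSEQ_imp_Suc)
  then have "(\<lambda>n. ennreal ((real n)\<^sup>2 * mean_void n)) \<longlonglongrightarrow> ennreal (width_area / 8)"
    by (rule Lim_transform_eventually)
      (rule eventually_mono[OF eventually_gt_at_top[of "0::nat"]], simp add: scaled)
  then show ?thesis
    by (rule tendsto_ennrealD) (auto simp: width_area_def mean_void_nonneg)
qed

end

section \<open>The limit theorem\<close>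

text \<open>The last line expresses, with negation and conjunction only, that exactly one of the
  vertices 0 and 1 is adjacent to vertex 2. The existence of such a third vertex is denied.\<close>

definition twin_sentence :: fo_formula where
  "twin_sentence = Ex 0 (Ex 1 (Conj (Edge 0 1) (Neg (Ex 2
      (Conj (Conj (Neg (Eq 2 0)) (Neg (Eq 2 1)))
       (Neg (Conj (Neg (Conj (Edge 0 2) (Neg (Edge 1 2)))) (Neg (Conj (Edge 1 2) (Neg (Edge 0 2)))))))))))"

lemma fo_models_twin_sentence: "fo_models G twin_sentence \<longleftrightarrow> (\<exists>x y. adjacent_twins G x y)"
  by (auto simp: fo_models_def twin_sentence_def adjacent_twins_def)

context torus_body
begin

text \<open>\<open>crossdet u p\<close> is the inner product of \<open>p\<close> with
  \<open>u\<close> turned by a right angle. So that rotation, which preserves area, maps the unit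
  sublevel set of \<open>width_fun K\<close> onto the polar body.\<close>

lemma width_area_polar: "width_area = measure lebesgue (polar_body K)"
proof -
  define R where "R u = (vector [- u $ 2, u $ 1] :: real^2)" for u :: "real^2"
  have lin: "linear R" by (rule linearI) (simp_all add: R_def vec_eq_iff forall_2)
  have det: "det (matrix R) = 1" by (simp add: det_2 matrix_def R_def axis_def)
  have cross: "crossdet u p = R u \<bullet> p" for u p
    by (simp add: crossdet_def R_def inner_vec_def UNIV_2)
  have le: "width_fun K u \<le> 1 \<longleftrightarrow> (\<forall>p\<in>K. R u \<bullet> p \<le> 1)" for u
    using width_fun_attained[of u] width_fun_upper[of _ u] unfolding cross by force
  have RR: "R (- R u) = u" for u by (simp add: R_def vec_eq_iff forall_2)
  have "polar_body K = R ` {u. width_fun K u \<le> 1}"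
    unfolding le polar_body_def by (auto simp: image_iff) (metis RR)
  moreover have W: "{u. width_fun K u \<le> 1} \<in> sets borel" by measurable
  moreover have "{u. width_fun K u \<le> 1} \<in> lmeasurable"
    using W emeasure_width_le_1 by (intro fmeasurableI) auto
  ultimately show ?thesis
    using measure_linear_image[OF lin, of "{u. width_fun K u \<le> 1}"] det by (simp add: width_area_def)
qed

lemma width_area_pos: "0 < width_area"
proof -
  obtain c where c: "0 < c" "\<And>u. width_fun K u \<le> c * norm u" using width_fun_le_norm by blast
  have "ball 0 (1 / c) \<subseteq> {u. width_fun K u \<le> 1}"
  proof
    fix u :: "real^2" assume "u \<in> ball 0 (1 / c)"
    then have "c * norm u \<le> 1" using c(1) by (simp add: field_simps)
    then show "u \<in> {u. width_fun K u \<le> 1}" using c(2)[of u] by simp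
  qed
  then have "emeasure lborel (ball (0 :: real^2) (1 / c)) \<le> ennreal width_area"
    unfolding emeasure_width_le_1[symmetric] by (intro emeasure_mono) auto
  moreover have "0 < emeasure lborel (ball (0 :: real^2) (1 / c))"
    using c(1) by (simp add: emeasure_ball)
  ultimately have "0 < ennreal width_area" by (rule less_le_trans[rotated])
  then show ?thesis by simp
qed

lemma pr_twin_pairs_limit:
  "(\<lambda>n. pr {1..n} (\<lambda>x. card (twin_pairs (nbhd K) {1..n} x) = k))
    \<longlonglongrightarrow> (width_area / 16) ^ k / fact k * exp (- (width_area / 16))"
proof -
  obtain C where "\<And>\<alpha>. 0 < \<alpha> \<Longrightarrow> laplace \<alpha> \<le> C / \<alpha>\<^sup>2" using laplace_le by blast
  then show ?thesis
    using tendsto_mean_void width_area_pos by (intro twin_pairs_poisson_limit) auto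
qed

lemma adjacent_twins_geom:
  "adjacent_twins (geom_graph K n x) i j \<longleftrightarrow> {i, j} \<in> twin_pairs (nbhd K) {1..n} x"
proof -
  have "adjacent_twins (geom_graph K n x) i j \<longleftrightarrow> i \<in> {1..n} \<and> j \<in> {1..n} \<and> i \<noteq> j \<and> x j - x i \<in> nbhd K \<and>
      (\<forall>z\<in>{1..n} - {i, j}. x z - x i \<in> nbhd K \<longleftrightarrow> x z - x j \<in> nbhd K)"
    by (auto simp: adjacent_twins_def geom_graph_def nbhd_def)
  also have "\<dots> \<longleftrightarrow> i \<in> {1..n} \<and> j \<in> {1..n} \<and> i \<noteq> j \<and> closed_twins (nbhd K) {1..n} x i j"
  proof -
    have "closed_twins (nbhd K) {1..n} x i j \<longleftrightarrow> x j - x i \<in> nbhd K \<and>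
        (\<forall>z\<in>{1..n} - {i, j}. x z - x i \<in> nbhd K \<longleftrightarrow> x z - x j \<in> nbhd K)"
      if ij: "i \<in> {1..n}" "j \<in> {1..n}"
    proof
      assume "closed_twins (nbhd K) {1..n} x i j"
      then have ct: "x z - x i \<in> nbhd K \<longleftrightarrow> x z - x j \<in> nbhd K" if "z \<in> {1..n}" for z
        using that unfolding closed_twins_def by blast
      have "x j - x i \<in> nbhd K" using ct[OF ij(2)] zero_in_A by simp
      with ct show "x j - x i \<in> nbhd K \<and> (\<forall>z\<in>{1..n} - {i, j}. x z - x i \<in> nbhd K \<longleftrightarrow> x z - x j \<in> nbhd K)"
        by blast
    next
      assume r: "x j - x i \<in> nbhd K \<and> (\<forall>z\<in>{1..n} - {i, j}. x z - x i \<in> nbhd K \<longleftrightarrow> x z - x j \<in> nbhd K)"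
      then have "- (x j - x i) \<in> nbhd K" by (rule nbhd_uminus[OF conjunct1])
      then have "x i - x j \<in> nbhd K" by simp
      then have "x i - x i \<in> nbhd K \<longleftrightarrow> x i - x j \<in> nbhd K" "x j - x i \<in> nbhd K \<longleftrightarrow> x j - x j \<in> nbhd K"
        using r zero_in_A by simp_all
      with r show "closed_twins (nbhd K) {1..n} x i j" unfolding closed_twins_def by blast
    qed
    then show ?thesis by blast
  qed
  finally show ?thesis by (simp add: mem_twin_pairs_iff)
qed

lemma num_adjacent_twins_geom:
  "num_adjacent_twins (geom_graph K n x) = card (twin_pairs (nbhd K) {1..n} x)"
proof -
  have "{{i, j} | i j. adjacent_twins (geom_graph K n x) i j} = twin_pairs (nbhd K) {1..n} x"
    unfolding adjacent_twins_geom by (auto simp: twin_pairs_def)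
  then show ?thesis by (simp add: num_adjacent_twins_def)
qed

section \<open>Transfer to the given independent uniform points\<close>

context
  fixes M :: "nat \<Rightarrow> 'w measure" and X :: "nat \<Rightarrow> nat \<Rightarrow> 'w \<Rightarrow> torus"
  assumes X: "\<And>n. iid_uniform (M n) n (X n)"
begin

text \<open>Independence makes the joint law a product, and the count depends on the coordinates in
  \<open>{1..n}\<close> only. With \<open>n > 0\<close> the index set is nonempty, as required by
  the characterisation of independence through the product law.\<close>

lemma twin_count_distr:
  assumes n: "0 < n"
  shows "twin_count X K n \<in> measurable (M n) (count_space UNIV)"
    and "measure (M n) {\<omega> \<in> space (M n). twin_count X K n \<omega> = k} = pr {1..n} (\<lambda>x. card (twin_pairs (nbhd K) {1..n} x) = k)"
proof -
  interpret Mn: prob_space "M n" using X[of n] by (simp add: iid_uniform_def)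
  have ind: "Mn.indep_vars (\<lambda>_. torus_borel) (X n) {1..n}" and dist: "\<And>i. i \<in> {1..n} \<Longrightarrow> distr (M n) torus_borel (X n i) = torus_uniform"
    using X[of n] by (auto simp: iid_uniform_def)
  have rv: "X n i \<in> measurable (M n) torus_borel" if "i \<in> {1..n}" for i
    using ind that by (simp add: Mn.indep_vars_def)
  define f where "f \<omega> = (\<lambda>i\<in>{1..n}. X n i \<omega>)" for \<omega>
  have fm: "f \<in> measurable (M n) (P {1..n})"
    unfolding f_def using rv by (intro measurable_restrict) (simp cong: measurable_cong_sets)
  have "distr (M n) (Pi\<^sub>M {1..n} (\<lambda>_. torus_borel)) f = Pi\<^sub>M {1..n} (\<lambda>i. distr (M n) torus_borel (X n i))"
    using Mn.indep_vars_iff_distr_eq_PiM'[where I = "{1..n}" and M' = "\<lambda>_. torus_borel" and X = "X n"] ind rv n by (simp add: f_def[abs_def])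
  also have "\<dots> = P {1..n}" by (intro PiM_cong) (auto simp: dist)
  finally have d: "distr (M n) (P {1..n}) f = P {1..n}"
    by (subst distr_cong[OF refl _ refl, of _ "Pi\<^sub>M {1..n} (\<lambda>_. torus_borel)"]) (auto intro!: sets_PiM_cong)
  have tc: "twin_count X K n \<omega> = card (twin_pairs (nbhd K) {1..n} (f \<omega>))" for \<omega>
  proof -
    have "twin_pairs (nbhd K) {1..n} (\<lambda>i. X n i \<omega>) = twin_pairs (nbhd K) {1..n} (f \<omega>)"
      by (intro twin_pairs_cong) (simp add: f_def)
    then show ?thesis
      by (simp add: twin_count_def random_geom_graph_def num_adjacent_twins_geom)
  qed
  have cm: "(\<lambda>x. card (twin_pairs (nbhd K) {1..n} x)) \<in> measurable (P {1..n}) (count_space UNIV)"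
    by (rule card_twin_pairs_measurable) auto
  show "twin_count X K n \<in> measurable (M n) (count_space UNIV)"
    using measurable_compose[OF fm cm] by (simp add: tc[abs_def])
  have "pr {1..n} (\<lambda>x. card (twin_pairs (nbhd K) {1..n} x) = k)
      = measure (distr (M n) (P {1..n}) f) {x \<in> space (P {1..n}). card (twin_pairs (nbhd K) {1..n} x) = k}"
    by (simp only: d)
  also have "\<dots> = measure (M n) (f -` {x \<in> space (P {1..n}). card (twin_pairs (nbhd K) {1..n} x) = k} \<inter> space (M n))"
    using count_eq_measurable[of "{1..n}" "{1..n}" k] by (intro measure_distr fm) (simp add: pred_def)
  also have "f -` {x \<in> space (P {1..n}). card (twin_pairs (nbhd K) {1..n} x) = k} \<inter> space (M n)
      = {\<omega> \<in> space (M n). twin_count X K n \<omega> = k}"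
    using measurable_space[OF fm] by (auto simp: tc)
  finally show "measure (M n) {\<omega> \<in> space (M n). twin_count X K n \<omega> = k}
      = pr {1..n} (\<lambda>x. card (twin_pairs (nbhd K) {1..n} x) = k)" ..
qed

lemma twin_count_limit:
  "(\<lambda>n. measure (M n) {\<omega> \<in> space (M n). twin_count X K n \<omega> = k})
    \<longlonglongrightarrow> (width_area / 16) ^ k / fact k * exp (- (width_area / 16))"
  using pr_twin_pairs_limit[of k]
  by (rule Lim_transform_eventually)
     (rule eventually_mono[OF eventually_gt_at_top[of "0::nat"]], simp add: twin_count_distr(2))

lemma twin_count_poisson: "converges_to_poisson M (twin_count X K) (measure lebesgue (polar_body K) / 16)"
  unfolding width_area_polar[symmetric]
proof (rule converges_to_poissonI)
  show "prob_space (M n)" for n using X[of n] by (simp add: iid_uniform_def)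
  show "eventually (\<lambda>n. twin_count X K n \<in> measurable (M n) (count_space UNIV)) sequentially"
    using eventually_gt_at_top[of "0::nat"] by eventually_elim (rule twin_count_distr(1))
qed (use width_area_pos twin_count_limit in auto)

text \<open>The existence of an adjacent twin pair is a first-order property. Its probability tends
  to 1 - exp (- \<lambda>), which lies strictly between 0 and 1 because the polar body has positive
  finite area.\<close>

lemma no_zero_one_law: "\<not> fo_zero_one_law M (random_geom_graph X K)"
proof
  assume law: "fo_zero_one_law M (random_geom_graph X K)"
  let ?p = "\<lambda>n. measure (M n) {\<omega> \<in> space (M n). fo_models (random_geom_graph X K n \<omega>) twin_sentence}"
  have "fo_sentence twin_sentence" by (auto simp: fo_sentence_def twin_sentence_def)
  then have alt: "?p \<longlonglongrightarrow> 0 \<or> ?p \<longlonglongrightarrow> 1" using law by (simp add: fo_zero_one_law_def)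
  have models: "fo_models (random_geom_graph X K n \<omega>) twin_sentence \<longleftrightarrow> twin_count X K n \<omega> \<noteq> 0" for n \<omega>
  proof -
    have "twin_count X K n \<omega> \<noteq> 0 \<longleftrightarrow> twin_pairs (nbhd K) {1..n} (\<lambda>i. X n i \<omega>) \<noteq> {}"
      using finite_twin_pairs[of "{1..n}" "nbhd K" "\<lambda>i. X n i \<omega>"]
      by (simp add: twin_count_def random_geom_graph_def num_adjacent_twins_geom)
    also have "\<dots> \<longleftrightarrow> (\<exists>i j. {i, j} \<in> twin_pairs (nbhd K) {1..n} (\<lambda>i. X n i \<omega>))"
      by (auto simp: twin_pairs_def)
    finally show ?thesis
      by (simp add: fo_models_twin_sentence random_geom_graph_def adjacent_twins_geom)
  qed
  have "(\<lambda>n. 1 - measure (M n) {\<omega> \<in> space (M n). twin_count X K n \<omega> = 0}) \<longlonglongrightarrow> 1 - exp (- (width_area / 16))"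
    using twin_count_limit[of 0] by (intro tendsto_intros) simp
  moreover have "eventually (\<lambda>n. 1 - measure (M n) {\<omega> \<in> space (M n). twin_count X K n \<omega> = 0} = ?p n) sequentially"
    using eventually_gt_at_top[of "0::nat"]
  proof eventually_elim
    case (elim n)
    interpret Mn: prob_space "M n" using X[of n] by (simp add: iid_uniform_def)
    note twin_count_distr(1)[OF elim, measurable]
    have "{\<omega> \<in> space (M n). twin_count X K n \<omega> = 0} \<in> sets (M n)" by measurable
    moreover have "{\<omega> \<in> space (M n). fo_models (random_geom_graph X K n \<omega>) twin_sentence}
        = space (M n) - {\<omega> \<in> space (M n). twin_count X K n \<omega> = 0}" by (auto simp: models)
    ultimately show ?case by (simp only: Mn.prob_compl)
  qed
  ultimately have lim: "?p \<longlonglongrightarrow> 1 - exp (- (width_area / 16))" by (rule Lim_transform_eventually)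
  have "exp (- (width_area / 16)) < 1" using width_area_pos by simp
  then show False
    using alt LIMSEQ_unique[OF lim, of 0] LIMSEQ_unique[OF lim, of 1] by auto
qed

end

end

section \<open>Polar areas of the square and the disk\<close>

lemma origin_symmetricI: "(\<And>v. v \<in> K \<Longrightarrow> - v \<in> K) \<Longrightarrow> origin_symmetric K"
  unfolding origin_symmetric_def by (force simp: image_iff intro: minus_minus[symmetric])

lemma cube_eq_cbox: "{v :: real^2. \<forall>i. - r \<le> v $ i \<and> v $ i \<le> r} = cbox (\<chi> i. - r) (\<chi> i. r)"
  by (auto simp: mem_box_cart)

text \<open>The polar of the square is the diamond |u1| + |u2| \<le> 1 / r. It is the image of a
  square of side 2 / r under a linear map whose determinant has absolute value 1/2, hence the area
  (2 / r)^2 / 2.\<close>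

lemma polar_body_cube:
  fixes r :: real
  assumes r: "0 < r"
  shows "measure lebesgue (polar_body {v :: real^2. \<forall>i. - r \<le> v $ i \<and> v $ i \<le> r}) = 2 / r\<^sup>2"
proof -
  let ?K = "{v :: real^2. \<forall>i. - r \<le> v $ i \<and> v $ i \<le> r}"
  define L where "L u = (vector [(u $ 1 + u $ 2) / 2, (u $ 1 - u $ 2) / 2] :: real^2)" for u :: "real^2"
  have lin: "linear L" by (rule linearI) (simp_all add: L_def vec_eq_iff forall_2 field_simps)
  have det: "det (matrix L) = - 1 / 2" by (simp add: det_2 matrix_def L_def axis_def)
  let ?Q = "cbox (\<chi> i. - (1 / r)) (\<chi> i. 1 / r) :: (real^2) set"
  have polar: "u \<in> polar_body ?K \<longleftrightarrow> \<bar>u $ 1\<bar> + \<bar>u $ 2\<bar> \<le> 1 / r" for u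
  proof
    assume u: "u \<in> polar_body ?K"
    \<comment> \<open>A point of the square at which the linear form \<open>u\<close> is
      maximal.\<close>
    let ?x = "vector [r * sgn (u $ 1), r * sgn (u $ 2)] :: real^2"
    have "?x \<in> ?K" using r by (auto simp: forall_2 sgn_if)
    then have "u \<bullet> ?x \<le> 1" using u by (auto simp: polar_body_def)
    moreover have "u \<bullet> ?x = r * (\<bar>u $ 1\<bar> + \<bar>u $ 2\<bar>)"
      by (simp add: inner_vec_def UNIV_2 sgn_if algebra_simps abs_if)
    ultimately show "\<bar>u $ 1\<bar> + \<bar>u $ 2\<bar> \<le> 1 / r" using r by (simp add: field_simps)
  next
    assume u: "\<bar>u $ 1\<bar> + \<bar>u $ 2\<bar> \<le> 1 / r"
    have "u \<bullet> x \<le> 1" if x: "x \<in> ?K" for x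
    proof -
      have xi: "\<bar>x $ i\<bar> \<le> r" for i
      proof -
        have "- r \<le> x $ i \<and> x $ i \<le> r" using x by blast
        then show ?thesis by linarith
      qed
      have "u \<bullet> x = u $ 1 * x $ 1 + u $ 2 * x $ 2" by (simp add: inner_vec_def UNIV_2)
      also have "\<dots> \<le> \<bar>u $ 1\<bar> * \<bar>x $ 1\<bar> + \<bar>u $ 2\<bar> * \<bar>x $ 2\<bar>"
        by (intro add_mono) (metis abs_mult abs_ge_self)+
      also have "\<dots> \<le> \<bar>u $ 1\<bar> * r + \<bar>u $ 2\<bar> * r" using xi by (intro add_mono mult_left_mono) auto
      also have "\<dots> = r * (\<bar>u $ 1\<bar> + \<bar>u $ 2\<bar>)" by (simp add: algebra_simps)
      also have "\<dots> \<le> r * (1 / r)" using u r by (intro mult_left_mono) auto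
      finally show ?thesis using r by simp
    qed
    then show "u \<in> polar_body ?K" by (simp add: polar_body_def)
  qed
  have "polar_body ?K = L ` ?Q"
  proof (intro equalityI subsetI)
    fix u assume "u \<in> polar_body ?K"
    then have "\<bar>u $ 1\<bar> + \<bar>u $ 2\<bar> \<le> 1 / r" by (simp add: polar)
    then have "vector [u $ 1 + u $ 2, u $ 1 - u $ 2] \<in> ?Q" unfolding mem_box_cart forall_2 by simp linarith
    moreover have "u = L (vector [u $ 1 + u $ 2, u $ 1 - u $ 2])" by (simp add: L_def vec_eq_iff forall_2)
    ultimately show "u \<in> L ` ?Q" by blast
  next
    fix u assume "u \<in> L ` ?Q"
    then obtain q where q: "q \<in> ?Q" "u = L q" by blast
    then have "- (1 / r) \<le> q $ 1" "q $ 1 \<le> 1 / r" "- (1 / r) \<le> q $ 2" "q $ 2 \<le> 1 / r"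
      unfolding mem_box_cart forall_2 by simp_all
    \<comment> \<open>The left side is twice the larger of the absolute values of the two
      coordinates.\<close>
    then have "\<bar>q $ 1 + q $ 2\<bar> + \<bar>q $ 1 - q $ 2\<bar> \<le> 2 * (1 / r)" by linarith
    then have "\<bar>(q $ 1 + q $ 2) / 2\<bar> + \<bar>(q $ 1 - q $ 2) / 2\<bar> \<le> 1 / r" by simp
    then show "u \<in> polar_body ?K" unfolding polar by (simp add: q L_def)
  qed
  moreover have "measure lebesgue ?Q = (2 / r)\<^sup>2"
    using r by (subst measure_completion) (auto simp: content_cbox_cart UNIV_2 power2_eq_square interval_ne_empty_cart)
  moreover have "?Q \<in> lmeasurable" by simp
  ultimately show ?thesis
    using measure_linear_image[OF lin, of ?Q] det by (simp add: power_divide)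
qed

lemma polar_body_cball:
  fixes r :: real
  assumes r: "0 < r"
  shows "polar_body (cball (0 :: 'a::euclidean_space) r) = cball 0 (1 / r)"
proof (intro equalityI subsetI)
  fix u :: 'a assume u: "u \<in> polar_body (cball 0 r)"
  show "u \<in> cball 0 (1 / r)"
  proof (cases "u = 0")
    case False
    have "(r / norm u) *\<^sub>R u \<in> cball 0 r" using r False by simp
    with u have "u \<bullet> ((r / norm u) *\<^sub>R u) \<le> 1" unfolding polar_body_def by blast
    moreover have "u \<bullet> ((r / norm u) *\<^sub>R u) = r * norm u"
      using False by (simp add: power2_norm_eq_inner[symmetric] power2_eq_square)
    ultimately have "r * norm u \<le> 1" by simp
    then show ?thesis using r by (simp add: field_simps)
  qed (use r in simp)
next
  fix u :: 'a assume u: "u \<in> cball 0 (1 / r)"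
  have "u \<bullet> x \<le> 1" if "x \<in> cball 0 r" for x
  proof -
    have "u \<bullet> x \<le> norm u * norm x" by (rule norm_cauchy_schwarz)
    also have "\<dots> \<le> (1 / r) * r" using u that r by (intro mult_mono) auto
    finally show ?thesis using r by simp
  qed
  then show "u \<in> polar_body (cball 0 r)" by (simp add: polar_body_def)
qed

theorem theorem1p1:
  fixes M :: "nat \<Rightarrow> 'w measure" and X :: "nat \<Rightarrow> nat \<Rightarrow> 'w \<Rightarrow> torus"
  assumes X: "\<And>n. iid_uniform (M n) n (X n)"
  shows
    "(\<forall>K :: (real ^ 2) set.
        convex_body K \<and> origin_symmetric K \<and> K \<subseteq> {v. \<forall>i. - 1/2 < v $ i \<and> v $ i < 1/2} \<longrightarrow>
        converges_to_poisson M (twin_count X K) (measure lebesgue (polar_body K) / 16) \<and>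
        \<not> fo_zero_one_law M (random_geom_graph X K)) \<and>
     (\<forall>r. 0 < r \<and> r < 1/2 \<longrightarrow>
        converges_to_poisson M (twin_count X {v. \<forall>i. - r \<le> v $ i \<and> v $ i \<le> r}) (1 / (8 * r\<^sup>2)) \<and>
        converges_to_poisson M (twin_count X ((*\<^sub>R) r ` cball 0 1)) (pi / (16 * r\<^sup>2)))"
proof (intro conjI allI impI; (elim conjE)?)
  fix K :: "(real ^ 2) set"
  assume K: "convex_body K" "origin_symmetric K" "K \<subseteq> {v. \<forall>i. - 1/2 < v $ i \<and> v $ i < 1/2}"
  then interpret torus_body K by unfold_locales
  show "converges_to_poisson M (twin_count X K) (measure lebesgue (polar_body K) / 16)"
    by (rule twin_count_poisson[OF X])
  show "\<not> fo_zero_one_law M (random_geom_graph X K)"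
    by (rule no_zero_one_law[OF X])
next
  fix r :: real assume r: "0 < r" "r < 1/2"
  let ?K = "{v :: real^2. \<forall>i. - r \<le> v $ i \<and> v $ i \<le> r}"
  have "box (\<chi> i. - r) (\<chi> i. r) \<noteq> ({} :: (real^2) set)"
    using r by (simp add: interval_ne_empty_cart)
  then have "convex_body ?K"
    unfolding cube_eq_cbox by (simp add: convex_body_def interior_cbox)
  moreover have "origin_symmetric ?K"
  proof (rule origin_symmetricI)
    fix v assume v: "v \<in> ?K"
    have "- r \<le> (- v) $ i \<and> (- v) $ i \<le> r" for i
    proof -
      have "- r \<le> v $ i \<and> v $ i \<le> r" using v by blast
      then show ?thesis by simp
    qed
    then show "- v \<in> ?K" by blast
  qed
  moreover have "?K \<subseteq> {v. \<forall>i. - 1/2 < v $ i \<and> v $ i < 1/2}"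
  proof safe
    fix v :: "real^2" and i assume "\<forall>i. - r \<le> v $ i \<and> v $ i \<le> r"
    then have "- r \<le> v $ i" "v $ i \<le> r" by blast+
    then show "- 1/2 < v $ i" "v $ i < 1/2" using r by linarith+
  qed
  ultimately interpret torus_body ?K by unfold_locales
  show "converges_to_poisson M (twin_count X ?K) (1 / (8 * r\<^sup>2))"
    using twin_count_poisson[OF X] by (simp add: polar_body_cube[OF r(1)])
next
  fix r :: real assume r: "0 < r" "r < 1/2"
  let ?K = "cball 0 r :: (real^2) set"
  have eq: "(*\<^sub>R) r ` cball 0 1 = ?K"
    using r by (simp add: cball_scale)
  have "convex_body ?K" using r by (simp add: convex_body_def)
  moreover have "origin_symmetric ?K"
    by (rule origin_symmetricI) simp
  moreover have "?K \<subseteq> {v. \<forall>i. - 1/2 < v $ i \<and> v $ i < 1/2}"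
  proof safe
    fix v :: "real^2" and i assume "v \<in> ?K"
    then have "\<bar>v $ i\<bar> < 1/2" using component_le_norm_cart[of v i] r by simp
    then show "- 1/2 < v $ i" "v $ i < 1/2" by linarith+
  qed
  ultimately interpret torus_body ?K by unfold_locales
  have "measure lebesgue (polar_body ?K) = pi / r\<^sup>2"
    using r by (simp add: polar_body_cball content_cball unit_ball_vol_2 power_divide)
  then show "converges_to_poisson M (twin_count X ((*\<^sub>R) r ` cball 0 1)) (pi / (16 * r\<^sup>2))"
    using twin_count_poisson[OF X] unfolding eq by (simp add: mult.commute)
qed

end
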